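(* Let $G$ be a graph on $n$ vertices subject to edge insertions and deletions. Let $\eta>2$, let $\gamma>0$ be a constant, and let $b$ be a positive integer with $\eta b^{-1} < \frac{1}{100\log n\cdot \max\{\gamma^{-1},1\}}$. Let $G^b$ be the multigraph in which each edge of $G$ is duplicated $b$ times. There is a deterministic dynamic algorithm that maintains an orientation $\overrightarrow{G}^b$ of $G^b$ and an orientation $\overrightarrow{G}$ of $G$ (where an edge $\{u,v\}$ of $G$ is oriented $\overrightarrow{uv}$ when more of its $b$ copies in $\overrightarrow{G}^b$ point from $u$ to $v$) such that: (i) every directed edge $\overrightarrow{uv}$ of $\overrightarrow{G}^b$ satisfies $d^+(u)\le (1+\eta b^{-1})\,d^+(v)$; (ii) every vertex has out-degree $O(b\cdot\rho)$ in $\overrightarrow{G}^b$; (iii) every vertex has out-degree $O(\rho)$ in $\overrightarrow{G}$. Each operation in $G$ is processed in worst-case time $O(\rho\cdot b^3\cdot \log\rho)$, which is $O(\rho\log^3 n\log\rho)$ for $b\in O(\log n)$. Here $\rho$ is the maximum subgraph density of $G$ at the time of the update.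
   Context: The maximum subgraph density of $G=(V,E)$ is $\max_{\emptyset\ne S\subseteq V}|E(S)|/|S|$, where $E(S)$ is the set of edges with both endpoints in $S$. $d^+(u)$ denotes out-degree in the relevant orientation (counting parallel copies with multiplicity).
   Formalization: For odd b it is additionally assumed that 2b ≤ η(b−1); otherwise (i) is impossible for a graph with a single edge, whose b copies split at best (b+1)/2 to (b−1)/2 (e.g. n=2, γ=1, b=203, η=2.000001). *)

theory Defs
  imports Complex_Main "HOL-Library.Multiset"
begin

section \<open>Graphs, duplicated graphs and orientations\<close>

text \<open>A graph on \<open>n\<close> vertices is a set of two-element subsets of \<open>{..<n}\<close>.\<close>

definition max_density :: "nat \<Rightarrow> nat set set \<Rightarrow> real" where
  "max_density n E =
     Max {real (card {e \<in> E. e \<subseteq> S}) / real (card S) | S. S \<noteq> {} \<and> S \<subseteq> {..<n}}"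

definition duplicate :: "nat \<Rightarrow> nat set set \<Rightarrow> nat set multiset" where
  "duplicate b E = repeat_mset b (mset_set E)"

text \<open>An orientation is a multiset of arcs, parallel copies of an edge being
  indistinguishable.  Forgetting the directions has to give back the (multi)graph.\<close>

definition is_orientation :: "(nat \<times> nat) multiset \<Rightarrow> nat set multiset \<Rightarrow> bool" where
  "is_orientation M H \<longleftrightarrow> image_mset (\<lambda>(u, v). {u, v}) M = H"

definition outdeg :: "(nat \<times> nat) multiset \<Rightarrow> nat \<Rightarrow> nat" where
  "outdeg M u = size {#a \<in># M. fst a = u#}"

definition fair :: "real \<Rightarrow> nat \<Rightarrow> (nat \<times> nat) multiset \<Rightarrow> bool" where
  "fair \<eta> b M \<longleftrightarrow>
     (\<forall>(u, v) \<in># M. real (outdeg M u) \<le> (1 + \<eta> / real b) * real (outdeg M v))"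

text \<open>\<open>D\<close> directs every edge the way the majority of its copies in \<open>M\<close> points;
  a tie (possible for even \<open>b\<close>) may be broken either way.\<close>

definition follows_majority :: "(nat \<times> nat) multiset \<Rightarrow> (nat \<times> nat) multiset \<Rightarrow> bool" where
  "follows_majority D M \<longleftrightarrow> (\<forall>u v. count M (u, v) > count M (v, u) \<longrightarrow> (u, v) \<in># D)"

text \<open>A single edge with an odd number \<open>b\<close> of copies has a fair orientation only if
  \<open>2 b \<le> \<eta> (b - 1)\<close>: the best possible split is \<open>(b + 1) / 2\<close> against \<open>(b - 1) / 2\<close>.
  For odd \<open>b\<close> this is a genuine restriction beyond \<open>\<eta> > 2\<close>.\<close>

lemma single_edge_not_fair:
  assumes "odd b" "\<eta> > 2" "\<eta> * (real b - 1) < 2 * real b" "u \<noteq> v"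
    and M: "is_orientation M (duplicate b {{u, v}})"
  shows "\<not> fair \<eta> b M"
proof
  assume fair: "fair \<eta> b M"
  have b0: "b > 0" using \<open>odd b\<close> by (cases b) auto
  have img: "image_mset (\<lambda>(u, v). {u, v}) M = replicate_mset b {u, v}"
    using M by (simp add: is_orientation_def duplicate_def)
  have sub: "a = (u, v) \<or> a = (v, u)" if "a \<in># M" for a
  proof -
    obtain x y where a: "a = (x, y)" by (cases a)
    have "(\<lambda>(u, v). {u, v}) a \<in># image_mset (\<lambda>(u, v). {u, v}) M"
      using that by (simp only: set_image_mset imageI)
    hence "{x, y} = {u, v}" unfolding img a using b0 by auto
    thus ?thesis unfolding a by (auto simp: doubleton_eq_iff)
  qed
  define k where "k = outdeg M u"
  define l where "l = outdeg M v"
  have "M = {#a \<in># M. fst a = u#} + {#a \<in># M. fst a \<noteq> u#}"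
    by (rule multiset_partition)
  moreover have "{#a \<in># M. fst a \<noteq> u#} = {#a \<in># M. fst a = v#}"
  proof (rule filter_mset_cong[OF refl])
    fix a assume "a \<in># M"
    from sub[OF this] show "fst a \<noteq> u \<longleftrightarrow> fst a = v" using \<open>u \<noteq> v\<close> by fastforce
  qed
  ultimately have "M = {#a \<in># M. fst a = u#} + {#a \<in># M. fst a = v#}"
    by (rule back_subst[where P = "\<lambda>X. M = _ + X"])
  from arg_cong[OF this, of size] have "size M = k + l"
    unfolding k_def l_def outdeg_def by (simp only: size_union)
  moreover have "size M = b"
    using arg_cong[OF img, of size] by simp
  ultimately have kl: "k + l = b" by simp
  have bound: "False"
    if xy: "x + y = b" "x > y" and le: "real x \<le> (1 + \<eta> / real b) * real y" for x y :: nat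
  proof -
    have 1: "x \<ge> y + 1" "real b \<ge> 2 * real y + 1"
      using xy by auto
    have "real y + 1 \<le> real y + \<eta> / real b * real y"
      using le 1(1) by (simp add: algebra_simps)
    hence "1 \<le> \<eta> / real b * real y" by simp
    hence "real b \<le> \<eta> * real y" using b0 by (simp add: field_simps)
    also have "\<dots> \<le> \<eta> * ((real b - 1) / 2)"
      by (rule mult_left_mono) (use 1 \<open>\<eta> > 2\<close> in auto)
    finally show False using \<open>\<eta> * (real b - 1) < 2 * real b\<close> by simp
  qed
  have "k \<noteq> l" using kl \<open>odd b\<close> by auto
  then consider "k > l" | "l > k" by linarith
  thus False
  proof cases
    case 1
    have "{#a \<in># M. fst a = u#} \<noteq> {#}"
    proof
      assume "{#a \<in># M. fst a = u#} = {#}"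
      hence "k = 0" by (simp only: k_def outdeg_def size_empty)
      thus False using 1 by simp
    qed
    then obtain a where "a \<in># {#a \<in># M. fst a = u#}" by (rule multiset_nonemptyE)
    hence a: "a \<in># M" "fst a = u" by simp_all
    hence "(u, v) \<in># M" using sub[OF a(1)] a \<open>u \<noteq> v\<close> by (metis fst_conv)
    hence "real k \<le> (1 + \<eta> / real b) * real l"
      using fair unfolding fair_def k_def l_def by blast
    thus False using bound[of k l] kl 1 by simp
  next
    case 2
    have "{#a \<in># M. fst a = v#} \<noteq> {#}"
    proof
      assume "{#a \<in># M. fst a = v#} = {#}"
      hence "l = 0" by (simp only: l_def outdeg_def size_empty)
      thus False using 2 by simp
    qed
    then obtain a where "a \<in># {#a \<in># M. fst a = v#}" by (rule multiset_nonemptyE)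
    hence a: "a \<in># M" "fst a = v" by simp_all
    hence "(v, u) \<in># M" using sub[OF a(1)] a \<open>u \<noteq> v\<close> by (metis fst_conv)
    hence "real l \<le> (1 + \<eta> / real b) * real k"
      using fair unfolding fair_def k_def l_def by blast
    thus False using bound[of l k] kl 2 by simp
  qed
qed


section \<open>A word RAM\<close>

text \<open>Programs are structured programs over finitely many registers and arrays of words,
  with unit cost for each arithmetic operation, comparison, register access and array access.
  The parameter \<open>W\<close> of the semantics is the largest value a word can hold (also as an
  array index); a program that would exceed it is stuck.\<close>

type_synonym name = string
type_synonym state = "(name \<Rightarrow> nat) \<times> (name \<Rightarrow> nat \<Rightarrow> nat)"

datatype expr =
    Const nat
  | Reg name
  | Read name expr
  | Add expr expr | Sub expr expr | Mul expr expr | Div expr expr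
  | Less expr expr | Equal expr expr

datatype com =
    Skip
  | Assign name expr
  | Write name expr expr
  | Seq com com
  | Cond expr com com
  | While expr com

fun val :: "expr \<Rightarrow> state \<Rightarrow> nat" where
  "val (Const k) s = k"
| "val (Reg x) s = fst s x"
| "val (Read a i) s = snd s a (val i s)"
| "val (Add p q) s = val p s + val q s"
| "val (Sub p q) s = val p s - val q s"
| "val (Mul p q) s = val p s * val q s"
| "val (Div p q) s = val p s div val q s"
| "val (Less p q) s = (if val p s < val q s then 1 else 0)"
| "val (Equal p q) s = (if val p s = val q s then 1 else 0)"

fun subexprs :: "expr \<Rightarrow> expr list" where
  "subexprs (Const k) = [Const k]"
| "subexprs (Reg x) = [Reg x]"
| "subexprs (Read a i) = Read a i # subexprs i"
| "subexprs (Add p q) = Add p q # subexprs p @ subexprs q"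
| "subexprs (Sub p q) = Sub p q # subexprs p @ subexprs q"
| "subexprs (Mul p q) = Mul p q # subexprs p @ subexprs q"
| "subexprs (Div p q) = Div p q # subexprs p @ subexprs q"
| "subexprs (Less p q) = Less p q # subexprs p @ subexprs q"
| "subexprs (Equal p q) = Equal p q # subexprs p @ subexprs q"

definition cost :: "expr \<Rightarrow> nat" where
  "cost e = length (subexprs e)"

definition fits :: "nat \<Rightarrow> expr \<Rightarrow> state \<Rightarrow> bool" where
  "fits W e s \<longleftrightarrow> (\<forall>e' \<in> set (subexprs e). val e' s \<le> W)"

definition set_reg :: "name \<Rightarrow> nat \<Rightarrow> state \<Rightarrow> state" where
  "set_reg x k s = ((fst s)(x := k), snd s)"

definition set_cell :: "name \<Rightarrow> nat \<Rightarrow> nat \<Rightarrow> state \<Rightarrow> state" where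
  "set_cell a i k s = (fst s, (snd s)(a := (snd s a)(i := k)))"

text \<open>\<open>exec W c s t s'\<close>: started in \<open>s\<close>, the program \<open>c\<close> halts in \<open>s'\<close> after \<open>t\<close> steps.\<close>

inductive exec :: "nat \<Rightarrow> com \<Rightarrow> state \<Rightarrow> nat \<Rightarrow> state \<Rightarrow> bool" for W where
  Skip: "exec W Skip s 1 s"
| Assign: "fits W e s \<Longrightarrow> exec W (Assign x e) s (1 + cost e) (set_reg x (val e s) s)"
| Write: "fits W i s \<Longrightarrow> fits W e s \<Longrightarrow>
    exec W (Write a i e) s (1 + cost i + cost e) (set_cell a (val i s) (val e s) s)"
| Seq: "exec W c1 s t1 s1 \<Longrightarrow> exec W c2 s1 t2 s2 \<Longrightarrow> exec W (Seq c1 c2) s (t1 + t2) s2"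
| CondTrue: "fits W e s \<Longrightarrow> val e s \<noteq> 0 \<Longrightarrow> exec W c1 s t s1 \<Longrightarrow>
    exec W (Cond e c1 c2) s (1 + cost e + t) s1"
| CondFalse: "fits W e s \<Longrightarrow> val e s = 0 \<Longrightarrow> exec W c2 s t s1 \<Longrightarrow>
    exec W (Cond e c1 c2) s (1 + cost e + t) s1"
| WhileFalse: "fits W e s \<Longrightarrow> val e s = 0 \<Longrightarrow> exec W (While e c) s (1 + cost e) s"
| WhileTrue: "fits W e s \<Longrightarrow> val e s \<noteq> 0 \<Longrightarrow> exec W c s t1 s1 \<Longrightarrow>
    exec W (While e c) s1 t2 s2 \<Longrightarrow> exec W (While e c) s (1 + cost e + t1 + t2) s2"

inductive_cases exec_elims:
  "exec W Skip s t s'" "exec W (Assign x e) s t s'" "exec W (Write a i e) s t s'"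
  "exec W (Seq c1 c2) s t s'" "exec W (Cond e c1 c2) s t s'" "exec W (While e c) s t s'"

lemma exec_deterministic:
  "exec W c s t s' \<Longrightarrow> exec W c s t2 s2 \<Longrightarrow> t2 = t \<and> s2 = s'"
proof (induction arbitrary: t2 s2 rule: exec.induct)
  case (Skip s)
  then show ?case by (rule exec_elims) simp
next
  case (Assign e s x)
  from Assign.prems show ?case by (rule exec_elims) simp
next
  case (Write i s e a)
  from Write.prems show ?case by (rule exec_elims) simp
next
  case (Seq c1 s t1 s1 c2 t2 s2 u r)
  from Seq.prems obtain u1 u2 r1 where
    r: "u = u1 + u2" "exec W c1 s u1 r1" "exec W c2 r1 u2 r"
    by (rule exec_elims) simp
  from Seq.IH(1)[OF r(2)] have 1: "u1 = t1" "r1 = s1" by simp_all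
  from Seq.IH(2)[OF r(3)[unfolded 1]] r(1) 1 show ?case by simp
next
  case (CondTrue e s c1 t s1 c2)
  from CondTrue.prems show ?case
    by (rule exec_elims) (simp_all add: CondTrue.hyps(2) CondTrue.IH)
next
  case (CondFalse e s c2 t s1 c1)
  from CondFalse.prems show ?case
    by (rule exec_elims) (simp_all add: CondFalse.hyps(2) CondFalse.IH)
next
  case (WhileFalse e s c)
  from WhileFalse.prems show ?case
    by (rule exec_elims) (simp_all add: WhileFalse.hyps(2))
next
  case (WhileTrue e s c t1 s1 t2 s2 u r)
  from WhileTrue.prems obtain u1 u2 r1 where
    r: "u = 1 + cost e + u1 + u2" "exec W c s u1 r1" "exec W (While e c) r1 u2 r"
    by (rule exec_elims) (simp_all add: WhileTrue.hyps(2))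
  from WhileTrue.IH(1)[OF r(2)] have 1: "u1 = t1" "r1 = s1" by simp_all
  from WhileTrue.IH(2)[OF r(3)[unfolded 1]] r(1) 1 show ?case by simp
qed


section \<open>Dynamic graph algorithms\<close>

datatype update = Insert nat nat | Delete nat nat

fun edge :: "update \<Rightarrow> nat set" where
  "edge (Insert u v) = {u, v}"
| "edge (Delete u v) = {u, v}"

fun valid :: "nat \<Rightarrow> nat set set \<Rightarrow> update \<Rightarrow> bool" where
  "valid n E (Insert u v) \<longleftrightarrow> u < n \<and> v < n \<and> u \<noteq> v \<and> {u, v} \<notin> E"
| "valid n E (Delete u v) \<longleftrightarrow> u < n \<and> v < n \<and> u \<noteq> v \<and> {u, v} \<in> E"

fun apply_update :: "update \<Rightarrow> nat set set \<Rightarrow> nat set set" where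
  "apply_update (Insert u v) E = E \<union> {{u, v}}"
| "apply_update (Delete u v) E = E - {{u, v}}"

fun load :: "update \<Rightarrow> state \<Rightarrow> state" where
  "load (Insert u v) s = set_reg ''op'' 0 (set_reg ''u'' u (set_reg ''v'' v s))"
| "load (Delete u v) s = set_reg ''op'' 1 (set_reg ''u'' u (set_reg ''v'' v s))"

definition start :: "nat \<Rightarrow> nat \<Rightarrow> state" where
  "start n b = set_reg ''n'' n (set_reg ''b'' b ((\<lambda>_. 0), (\<lambda>_ _. 0)))"

text \<open>A dynamic algorithm consists of a program \<open>ini\<close>, run once for the edgeless graph,
  and a program \<open>upd\<close>, run for every update.  \<open>reaches W ini upd n b E s\<close>: some sequence of
  updates leads from the edgeless graph to \<open>E\<close> and leaves the machine in state \<open>s\<close>.\<close>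

inductive reaches ::
  "nat \<Rightarrow> com \<Rightarrow> com \<Rightarrow> nat \<Rightarrow> nat \<Rightarrow> nat set set \<Rightarrow> state \<Rightarrow> bool"
  for W ini upd n b where
  init: "exec W ini (start n b) t s \<Longrightarrow> reaches W ini upd n b {} s"
| step: "reaches W ini upd n b E s \<Longrightarrow> valid n E x \<Longrightarrow> exec W upd (load x s) t s' \<Longrightarrow>
    reaches W ini upd n b (apply_update x E) s'"

text \<open>The arcs held in memory as adjacency lists: the heads of the arcs leaving \<open>u\<close> are
  stored, with multiplicity, in the first \<open>len[u]\<close> cells of row \<open>u\<close> of the array \<open>adj\<close>,
  where rows have width \<open>k\<close>.\<close>

definition stored_arcs ::
  "name \<Rightarrow> name \<Rightarrow> nat \<Rightarrow> nat \<Rightarrow> state \<Rightarrow> (nat \<times> nat) multiset" where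
  "stored_arcs len adj k n s =
     (\<Sum>u<n. mset (map (\<lambda>i. (u, snd s adj (u * k + i))) [0..<snd s len u]))"

definition multi_arcs :: "nat \<Rightarrow> nat \<Rightarrow> state \<Rightarrow> (nat \<times> nat) multiset" where
  "multi_arcs n b = stored_arcs ''mlen'' ''madj'' (n * b) n"

definition simple_arcs :: "nat \<Rightarrow> state \<Rightarrow> (nat \<times> nat) multiset" where
  "simple_arcs n = stored_arcs ''len'' ''adj'' n n"

end

theory Submission
  imports Defs
begin

text \<open>Keep \<open>d(u) \<le> thr (d(v))\<close> for every arc \<open>(u, v)\<close>, where \<open>thr d = d + max 1 \<lfloor>2 d / b\<rfloor>\<close> does not
  depend on \<open>\<eta>\<close>.  This invariant implies the required fairness: for \<open>2 d(v) \<ge> b\<close> directly, and for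
  \<open>2 d(v) < b\<close> because the \<open>b\<close> copies of an edge force \<open>2 d(v) \<ge> b - 1\<close>.  The sets
  \<open>{v. d(v) \<ge> y}\<close> double in size whenever \<open>y\<close> passes to the next lower threshold above
  \<open>2 b \<rho>\<close>, so all out-degrees are \<open>O(b \<rho>)\<close>.

  Inserting or deleting a copy changes one out-degree by one; a violated arc is flipped, which
  moves the change to a vertex \<open>x\<close> for which \<open>b + d(x)\<close> is smaller (larger, for a deletion) by a
  factor of at least \<open>1 + 1 / (3 b)\<close>, so that a chain of flips has length
  \<open>O(b log \<rho>)\<close>.  A flip costs \<open>O(b \<rho>)\<close>: for an insertion the out-neighbours are scanned,
  for a deletion the in-neighbours of each vertex are kept in buckets according to their out-degree,
  of which only two have to be inspected, and the buckets are updated only for the last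
  vertex of the chain.\<close>

text \<open>A flip restores the out-degree of the vertex that it leaves. A chain can therefore be
  analysed against the degrees \<open>\<delta>\<close> recorded before it started: they stay fixed,
  the arcs stay fair for them, and exactly one vertex deviates. This is why fairness and the memory
  layout take the degrees as a parameter separate from the multiplicities. The potential behind the
  chain bound is \<open>6 * b * ln (1 + d / b)\<close>: shifting \<open>d\<close> by
  \<open>b\<close> makes the additive step 1 at small degrees and the proportional step
  \<open>2 * d / b\<close> at large ones comparable. The programs know neither \<open>\<rho>\<close>
  nor a bound on the degrees; they stop when no violated arc is left. A degree bound enters the
  analysis only, and it has to hold after every single copy, when the updated edge has fewer than
  \<open>b\<close> copies. The smallness of \<open>ln n / b\<close> keeps the product of
  logarithmically many factors \<open>1 + 2 / b\<close> bounded. The parity condition on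
  \<open>b\<close> enters only where fairness for \<open>\<eta>\<close> is read off the
  invariant.\<close>

definition graph :: "nat \<Rightarrow> nat set set \<Rightarrow> bool" where
  "graph n E \<longleftrightarrow> E \<subseteq> {{u, v} | u v. u < n \<and> v < n \<and> u \<noteq> v}"

definition deg :: "nat \<Rightarrow> (nat \<Rightarrow> nat \<Rightarrow> nat) \<Rightarrow> nat \<Rightarrow> nat" where
  "deg n c u = (\<Sum>v<n. c u v)"

text \<open>An inequality, because during an update the edge being processed has only some of its
  \<open>b\<close> copies; \<open>maintained\<close> has the equality that holds between
  updates.\<close>

definition copies :: "nat \<Rightarrow> nat set set \<Rightarrow> (nat \<Rightarrow> nat \<Rightarrow> nat) \<Rightarrow> bool" where
  "copies b E c \<longleftrightarrow> (\<forall>u v. c u v + c v u \<le> (if {u, v} \<in> E then b else 0))"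

text \<open>The slope \<open>1 + 2 / b\<close> lies below \<open>1 + \<eta> / b\<close> for every
  admissible \<open>\<eta>\<close>, so one pair of programs serves them all. The maximum with 1
  keeps the threshold strictly above \<open>d\<close>, so that flips make progress at small degrees
  too.\<close>

definition thr :: "nat \<Rightarrow> nat \<Rightarrow> nat" where
  "thr b d = d + max 1 (2 * d div b)"

definition fairc :: "nat \<Rightarrow> (nat \<Rightarrow> nat \<Rightarrow> nat) \<Rightarrow> (nat \<Rightarrow> nat) \<Rightarrow> bool" where
  "fairc b c d \<longleftrightarrow> (\<forall>u v. c u v > 0 \<longrightarrow> d u \<le> thr b (d v))"

lemma graph_finite: "graph n E \<Longrightarrow> finite E"
  by (rule finite_subset[of _ "Pow {..<n}"]) (auto simp: graph_def)

lemma graph_edgeD: "graph n E \<Longrightarrow> {u, v} \<in> E \<Longrightarrow> u < n \<and> v < n \<and> u \<noteq> v"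
  by (auto simp: graph_def doubleton_eq_iff)

lemma graph_edgeE:
  assumes "graph n E" "e \<in> E"
  obtains u v where "e = {u, v}" "u < n" "v < n" "u \<noteq> v"
  using assms by (auto simp: graph_def)

lemma copies_posD: "graph n E \<Longrightarrow> copies b E c \<Longrightarrow> c u v > 0 \<Longrightarrow> {u, v} \<in> E \<and> u < n \<and> v < n \<and> u \<noteq> v"
  using graph_edgeD[of n E u v] copies_def[THEN iffD1, rule_format, of b E c u v]
  by (auto split: if_splits)

section \<open>Densities of subgraphs\<close>

lemma density_le_max_density:
  assumes "S \<noteq> {}" "S \<subseteq> {..<n}"
  shows "real (card {e \<in> E. e \<subseteq> S}) \<le> max_density n E * real (card S)"
proof -
  have fin: "finite S" using finite_subset[OF assms(2)] by simp
  have eq: "{real (card {e \<in> E. e \<subseteq> S}) / real (card S) | S. S \<noteq> {} \<and> S \<subseteq> {..<n}} =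
     (\<lambda>S. real (card {e \<in> E. e \<subseteq> S}) / real (card S)) ` {S. S \<noteq> {} \<and> S \<subseteq> {..<n}}" by auto
  have "real (card {e \<in> E. e \<subseteq> S}) / real (card S) \<le> max_density n E"
    unfolding max_density_def eq by (rule Max_ge) (use assms in auto)
  moreover have "card S > 0" using assms fin by (simp add: card_gt_0_iff)
  ultimately show ?thesis by (simp add: field_simps)
qed

lemma max_density_nonneg:
  assumes "n > 0" shows "max_density n E \<ge> 0"
proof -
  have "0 \<le> real (card {e \<in> E. e \<subseteq> {0}})" by simp
  also have "\<dots> \<le> max_density n E * real (card {0 :: nat})"
    by (rule density_le_max_density) (use assms in auto)
  finally show ?thesis by simp
qed

text \<open>The two end points of \<open>e\<close> induce a subgraph of density at least 1/2. This
  lower bound lets additive constants be absorbed into multiples of the density.\<close>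

lemma max_density_ge_half:
  assumes "graph n E" "e \<in> E"
  shows "max_density n E \<ge> 1 / 2"
proof -
  obtain u v where e: "e = {u, v}" "u < n" "v < n" "u \<noteq> v" by (rule graph_edgeE[OF assms])
  have "{e} \<subseteq> {f \<in> E. f \<subseteq> e}" using assms by auto
  hence "card {e} \<le> card {f \<in> E. f \<subseteq> e}"
    using graph_finite[OF assms(1)] by (intro card_mono) auto
  with density_le_max_density[of e n E] e show ?thesis by simp
qed

text \<open>Group the ordered pairs by their underlying edge: both directions of an edge together
  carry at most \<open>b\<close> copies, so the count is at most \<open>b\<close> times the number
  of edges inside \<open>T\<close>.\<close>

lemma sum_copies_le:
  assumes "graph n E" "copies b E c" "T \<subseteq> {..<n}" "T \<noteq> {}"
  shows "real (\<Sum>u\<in>T. \<Sum>v\<in>T. c u v) \<le> real b * max_density n E * real (card T)"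
proof -
  have fin: "finite T" "finite {e \<in> E. e \<subseteq> T}"
    using finite_subset[OF assms(3)] graph_finite[OF assms(1)] by simp_all
  define P where "P = {p \<in> T \<times> T. {fst p, snd p} \<in> E}"
  have "(\<Sum>u\<in>T. \<Sum>v\<in>T. c u v) = (\<Sum>p\<in>T \<times> T. c (fst p) (snd p))"
    by (simp add: sum.cartesian_product case_prod_beta)
  also have "\<dots> = (\<Sum>p\<in>P. c (fst p) (snd p))"
  proof (rule sum.mono_neutral_right)
    show "\<forall>p\<in>T \<times> T - P. c (fst p) (snd p) = 0"
      using copies_posD[OF assms(1,2)] by (auto simp: P_def)
  qed (use fin in \<open>simp_all add: P_def\<close>)
  also have "\<dots> = (\<Sum>e\<in>{e \<in> E. e \<subseteq> T}. \<Sum>p\<in>{p \<in> P. {fst p, snd p} = e}. c (fst p) (snd p))"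
  proof (rule sum.group[symmetric])
    show "finite P" using fin by (simp add: P_def)
    show "(\<lambda>p. {fst p, snd p}) ` P \<subseteq> {e \<in> E. e \<subseteq> T}" by (auto simp: P_def)
  qed (use fin in simp)
  also have "\<dots> \<le> (\<Sum>e\<in>{e \<in> E. e \<subseteq> T}. b)"
  proof (rule sum_mono)
    fix e assume e: "e \<in> {e \<in> E. e \<subseteq> T}"
    hence "e \<in> E" by simp
    then obtain u v where uv: "e = {u, v}" "u \<noteq> v" by (rule graph_edgeE[OF assms(1)])
    have "(\<Sum>p\<in>{p \<in> P. {fst p, snd p} = e}. c (fst p) (snd p)) \<le>
        (\<Sum>p\<in>{(u, v), (v, u)}. c (fst p) (snd p))"
      by (rule sum_mono2) (auto simp: uv doubleton_eq_iff)
    also have "\<dots> = c u v + c v u" using uv by simp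
    also have "\<dots> \<le> b" using assms(2)[unfolded copies_def, rule_format, of u v] e uv by simp
    finally show "(\<Sum>p\<in>{p \<in> P. {fst p, snd p} = e}. c (fst p) (snd p)) \<le> b" .
  qed
  also have "\<dots> = b * card {e \<in> E. e \<subseteq> T}" by simp
  finally have "real (\<Sum>u\<in>T. \<Sum>v\<in>T. c u v) \<le> real b * real (card {e \<in> E. e \<subseteq> T})"
    by (simp only: of_nat_mult[symmetric] of_nat_le_iff)
  also have "\<dots> \<le> real b * (max_density n E * real (card T))"
    by (intro mult_left_mono density_le_max_density assms) auto
  finally show ?thesis by (simp add: mult.assoc)
qed

section \<open>Thresholds and the bound on out-degrees\<close>

lemma thr_le: "b > 0 \<Longrightarrow> real (thr b d) \<le> (1 + 2 / real b) * real d + 1"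
proof -
  assume "b > 0"
  have "real (2 * d div b) \<le> real (2 * d) / real b" by (rule of_nat_div_le_of_nat)
  thus ?thesis by (simp add: thr_def algebra_simps max_def)
qed

lemma thr_mono: "d \<le> e \<Longrightarrow> thr b d \<le> thr b e"
  by (auto simp: thr_def intro!: add_mono max.mono div_le_mono)

lemma less_thr: "d < thr b d"
  by (auto simp: thr_def max_def)

text \<open>As \<open>2 \<le> b\<close>, the quotient \<open>2 * d div b\<close> rises by at most
  one. This limits the search after a deletion to two buckets.\<close>

lemma thr_Suc: "b \<ge> 2 \<Longrightarrow> thr b (Suc d) \<le> thr b d + 2"
proof -
  assume b: "b \<ge> 2"
  have "2 * Suc d div b \<le> (2 * d + b) div b" by (rule div_le_mono) (use b in simp)
  also have "\<dots> = 2 * d div b + 1" using b by simp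
  finally show ?thesis by (simp add: thr_def max_def)
qed

text \<open>A superlevel set of the out-degrees sends all its arcs into the next lower superlevel set,
  which therefore is at least twice as large while the degrees exceed twice the density.\<close>

lemma fairc_level_card:
  assumes G: "graph n E" "copies b E c" and b: "b > 0" and f: "fairc b c (deg n c)"
    and pos: "max_density n E > 0"
    and y: "y 0 = 2 * real b * max_density n E" "\<And>k. y (Suc k) = (1 + 2 / real b) * y k + 1"
  shows "2 ^ k * card {v. v < n \<and> real (deg n c v) \<ge> y k} \<le> n"
proof (induction k)
  case 0
  have "card {v. v < n \<and> real (deg n c v) \<ge> y 0} \<le> card {..<n}"
    by (rule card_mono) auto
  thus ?case by simp
next
  case (Suc k)
  have ylow: "y k \<ge> 2 * real b * max_density n E" for k
  proof (induction k)
    case (Suc k)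
    have "0 \<le> y k" by (rule order_trans[OF _ Suc]) (use pos in simp)
    moreover have "y (Suc k) = y k + (2 / real b * y k + 1)"
      by (simp add: y algebra_simps)
    moreover have "2 / real b * y k \<ge> 0" using \<open>0 \<le> y k\<close> by simp
    ultimately show ?case using Suc by linarith
  qed (simp add: y)
  define T where "T = (\<lambda>k. {v. v < n \<and> real (deg n c v) \<ge> y k})"
  have "2 * card (T (Suc k)) \<le> card (T k)"
  proof (cases "T (Suc k) = {}")
    case False
    have into: "v \<in> T k" if "u \<in> T (Suc k)" "c u v > 0" for u v
    proof -
      have "y (Suc k) \<le> real (deg n c u)" using that by (simp add: T_def)
      also have "\<dots> \<le> real (thr b (deg n c v))"
        using f that by (simp add: fairc_def)
      also have "\<dots> \<le> (1 + 2 / real b) * real (deg n c v) + 1" by (rule thr_le[OF b])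
      finally have "(1 + 2 / real b) * y k \<le> (1 + 2 / real b) * real (deg n c v)"
        by (simp add: y)
      moreover have "1 + 2 / real b > 0" by (simp add: add_pos_nonneg)
      ultimately have "y k \<le> real (deg n c v)" by simp
      thus ?thesis using copies_posD[OF G that(2)] by (simp add: T_def)
    qed
    have sub: "T (Suc k) \<subseteq> T k"
    proof -
      have "0 \<le> y k" by (rule order_trans[OF _ ylow]) (use pos in simp)
      hence "y k \<le> y (Suc k)" by (simp add: y algebra_simps add_nonneg_nonneg)
      thus ?thesis by (auto simp: T_def)
    qed
    have fin: "finite (T j)" for j by (simp add: T_def)
    \<comment> \<open>Double counting: each vertex of \<open>T (Suc k)\<close> emits at least
      \<open>2 * b * \<rho>\<close> arcs, all of them end in \<open>T k\<close>, and inside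
      \<open>T k\<close> there are at most \<open>b * \<rho> * card (T k)\<close> arcs.\<close>
    have "real (card (T (Suc k))) * (2 * real b * max_density n E) =
        (\<Sum>u\<in>T (Suc k). 2 * real b * max_density n E)" by simp
    also have "\<dots> \<le> (\<Sum>u\<in>T (Suc k). real (deg n c u))"
      by (rule sum_mono) (use ylow[of "Suc k"] in \<open>auto simp: T_def\<close>)
    also have "\<dots> = real (\<Sum>u\<in>T (Suc k). \<Sum>v\<in>T k. c u v)"
    proof -
      have "deg n c u = (\<Sum>v\<in>T k. c u v)" if "u \<in> T (Suc k)" for u
        unfolding deg_def
        by (rule sum.mono_neutral_right) (use into[OF that] in \<open>auto simp: T_def\<close>)
      thus ?thesis by simp
    qed
    also have "\<dots> \<le> real (\<Sum>u\<in>T k. \<Sum>v\<in>T k. c u v)"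
      unfolding of_nat_le_iff by (rule sum_mono2) (use sub fin in auto)
    also have "\<dots> \<le> real b * max_density n E * real (card (T k))"
      by (rule sum_copies_le[OF G]) (use False sub in \<open>auto simp: T_def\<close>)
    finally have "(real b * max_density n E) * (2 * real (card (T (Suc k)))) \<le>
        (real b * max_density n E) * real (card (T k))"
      by (simp add: mult_ac)
    hence "2 * real (card (T (Suc k))) \<le> real (card (T k))"
      using b pos by (simp add: mult_le_cancel_left_pos)
    thus ?thesis by linarith
  qed simp
  hence "2 ^ k * (2 * card (T (Suc k))) \<le> 2 ^ k * card (T k)" by (rule mult_le_mono2)
  also have "\<dots> \<le> n" using Suc by (simp add: T_def)
  finally show ?case by (simp add: T_def mult_ac)
qed

text \<open>After more than \<open>log 2 n\<close> doublings a nonempty level set would need more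
  than \<open>n\<close> vertices, so \<open>y k\<close> bounds all out-degrees. The hypothesis on
  \<open>b\<close> keeps the growth factor over these levels below 2 and the accumulated additive
  terms below \<open>b * \<rho>\<close>, whence
  \<open>2 * (2 * b * \<rho> + b * \<rho>)\<close>.\<close>

lemma fairc_deg_le:
  assumes G: "graph n E" "copies b E c" and f: "fairc b c (deg n c)"
    and n: "n \<ge> 2" and b: "real b > 200 * ln (real n)"
  shows "real (deg n c u) \<le> 6 * real b * max_density n E"
proof (cases "E = {}")
  case True
  hence "c u v = 0" for v using copies_posD[OF G, of u v] by auto
  thus ?thesis using max_density_nonneg[of n E] n by (simp add: deg_def)
next
  case False
  define \<rho> where "\<rho> = max_density n E"
  have \<rho>: "\<rho> \<ge> 1 / 2" using False max_density_ge_half[OF G(1)] by (auto simp: \<rho>_def)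
  have two: "ln (2 :: real) \<ge> 1 / 2"
    using exp_half_le2 by (subst ln_ge_iff) auto
  have ln2: "ln (real n) \<ge> 1 / 2"
  proof -
    have "ln (real n) \<ge> ln 2" using n by simp
    thus ?thesis using two by linarith
  qed
  hence b0: "b > 0" "real b > 100" using b by (auto intro: Nat.gr0I)
  define y :: "nat \<Rightarrow> real" where "y = rec_nat (2 * real b * \<rho>) (\<lambda>k x. (1 + 2 / real b) * x + 1)"
  have y: "y 0 = 2 * real b * \<rho>" "\<And>k. y (Suc k) = (1 + 2 / real b) * y k + 1"
    by (simp_all add: y_def)
  define k where "k = Suc (nat \<lfloor>log 2 (real n)\<rfloor>)"
  have "log 2 (real n) \<ge> 0" using n by simp
  hence kn: "real k > log 2 (real n)" "real k \<le> log 2 (real n) + 1" unfolding k_def by linarith+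
  have "real n < 2 ^ k"
  proof -
    have "real n = 2 powr (log 2 (real n))" using n by simp
    also have "\<dots> < 2 powr real k" by (rule powr_less_mono) (use kn in auto)
    finally show ?thesis by (simp add: powr_realpow)
  qed
  hence nk: "n < 2 ^ k" by (metis of_nat_less_iff of_nat_numeral of_nat_power)
  have "2 ^ k * card {v. v < n \<and> real (deg n c v) \<ge> y k} \<le> n"
    by (rule fairc_level_card[OF G b0(1) f]) (use \<rho> y in \<open>auto simp: \<rho>_def\<close>)
  hence "card {v. v < n \<and> real (deg n c v) \<ge> y k} = 0"
    using nk by (cases "card {v. v < n \<and> real (deg n c v) \<ge> y k}") auto
  hence "{v. v < n \<and> real (deg n c v) \<ge> y k} = {}" by simp
  hence lt: "real (deg n c v) \<le> y k" if "v < n" for v using that by force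
  \<comment> \<open>A crude estimate suffices: \<open>ln 2 \<ge> 1 / 2\<close> gives
    \<open>k \<le> 2 * ln n + 1\<close>, and \<open>ln n \<ge> 1 / 2\<close> absorbs the 1.\<close>
  have k4: "real k \<le> 4 * ln (real n)"
  proof -
    have "log 2 (real n) = ln (real n) / ln 2" by (simp add: log_def)
    also have "\<dots> \<le> ln (real n) / (1 / 2)"
      by (rule divide_left_mono) (use two ln2 in auto)
    finally show ?thesis using kn ln2 by simp
  qed
  \<comment> \<open>The recursion unrolled, each additive 1 being inflated to the full
    power.\<close>
  have ybound: "y j \<le> (1 + 2 / real b) ^ j * (2 * real b * \<rho> + real j)" for j
  proof (induction j)
    case (Suc j)
    have ge1: "(1 + 2 / real b) ^ Suc j \<ge> 1" by (rule one_le_power) simp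
    have "y (Suc j) \<le> (1 + 2 / real b) * ((1 + 2 / real b) ^ j * (2 * real b * \<rho> + real j)) + 1"
      unfolding y by (intro add_right_mono mult_left_mono Suc) auto
    also have "\<dots> \<le> (1 + 2 / real b) ^ Suc j * (2 * real b * \<rho> + real j) + (1 + 2 / real b) ^ Suc j"
      using ge1 by simp
    also have "\<dots> = (1 + 2 / real b) ^ Suc j * (2 * real b * \<rho> + real (Suc j))"
      by (simp only: of_nat_Suc distrib_left mult_1_right add.assoc add.commute[of 1])
    finally show ?case .
  qed (simp add: y)
  have "(1 + 2 / real b) ^ k \<le> exp (2 / real b) ^ k"
    by (intro power_mono exp_ge_add_one_self) auto
  also have "\<dots> = exp (real k * (2 / real b))" by (simp only: exp_of_nat_mult)
  also have "\<dots> \<le> exp (1 / 2)"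
  proof -
    have "real k * 4 \<le> real b" using k4 b ln2 by linarith
    thus ?thesis using b0 by (simp add: field_simps)
  qed
  also have "\<dots> \<le> 2" using exp_half_le2 by simp
  finally have p2: "(1 + 2 / real b) ^ k \<le> 2" .
  have kb: "real k \<le> real b * \<rho>"
  proof -
    have "real k \<le> real b * (1 / 2)" using k4 b ln2 by linarith
    also have "\<dots> \<le> real b * \<rho>" by (rule mult_left_mono) (use \<rho> in auto)
    finally show ?thesis .
  qed
  have "y k \<le> 2 * (2 * real b * \<rho> + real k)"
    by (rule order_trans[OF ybound mult_right_mono[OF p2]]) (use \<rho> in auto)
  also have "\<dots> \<le> 6 * real b * \<rho>" using kb by (simp add: algebra_simps)
  finally have yk: "y k \<le> 6 * real b * \<rho>" .
  show ?thesis
  proof (cases "u < n")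
    case False
    hence "c u v = 0" for v using copies_posD[OF G, of u v] by auto
    thus ?thesis using max_density_nonneg[of n E] n by (simp add: deg_def)
  qed (use lt yk in \<open>force simp: \<rho>_def\<close>)
qed

lemma fairc_imp_fair:
  assumes f: "fairc b c (deg n c)" and n: "u < n" "v < n" "c u v > 0" and c: "c u v + c v u = b"
    and b: "b > 0" "\<eta> > 2" "even b \<or> 2 * real b \<le> \<eta> * (real b - 1)"
  shows "real (deg n c u) \<le> (1 + \<eta> / real b) * real (deg n c v)"
proof -
  let ?d = "deg n c"
  have le: "?d u \<le> thr b (?d v)" using f n by (auto simp: fairc_def)
  have mem: "c x y \<le> ?d x" if "y < n" for x y
    unfolding deg_def by (rule member_le_sum) (use that in auto)
  show ?thesis
  proof (cases "2 * ?d v < b")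
    case True
    hence "?d u \<le> ?d v + 1" using le by (simp add: thr_def)
    moreover have "c u v \<le> ?d u" "c v u \<le> ?d v" using mem n by auto
    ultimately have "b \<le> 2 * ?d v + 1" using c by linarith
    \<comment> \<open>All copies of the edge leave \<open>u\<close> or \<open>v\<close>, which pins
      \<open>b\<close> down to an odd number. The second alternative of the parity hypothesis then
      applies and says precisely that the additive 1 is at most
      \<open>\<eta> / b * deg n c v\<close>.\<close>
    hence b': "b = 2 * ?d v + 1" using True by linarith
    hence "2 * real b \<le> \<eta> * (2 * real (?d v))" using b by (auto simp: b')
    hence "1 \<le> \<eta> / real b * real (?d v)" using b by (simp add: field_simps)
    moreover have "real (?d u) \<le> real (?d v) + 1" using \<open>?d u \<le> ?d v + 1\<close> by linarith
    ultimately show ?thesis by (simp add: algebra_simps)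
  next
    case False
    hence "1 \<le> 2 * ?d v div b" using b by (simp add: div_greater_zero_iff Suc_le_eq)
    hence "?d u \<le> ?d v + 2 * ?d v div b" using le by (simp add: thr_def)
    hence "real (?d u) \<le> real (?d v) + real (2 * ?d v div b)" by linarith
    moreover have "real (2 * ?d v div b) \<le> real (2 * ?d v) / real b" by (rule of_nat_div_le_of_nat)
    moreover have "real (2 * ?d v) / real b \<le> \<eta> / real b * real (?d v)"
      using b by (simp add: field_simps mult_right_mono)
    ultimately show ?thesis by (simp add: algebra_simps)
  qed
qed

text \<open>The number of steps of a chain of flips that starts or ends at out-degree \<open>d\<close>.\<close>

definition chain_length :: "nat \<Rightarrow> nat \<Rightarrow> nat" where
  "chain_length b d = nat \<lfloor>6 * real b * ln (1 + real d / real b)\<rfloor>"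

lemma chain_length_mono: "d \<le> e \<Longrightarrow> chain_length b d \<le> chain_length b e"
proof (cases "b = 0")
  case False
  assume "d \<le> e"
  hence "1 + real d / real b \<le> 1 + real e / real b" by (simp add: divide_right_mono)
  hence "ln (1 + real d / real b) \<le> ln (1 + real e / real b)"
    by (rule ln_mono) (simp add: add_pos_nonneg)
  hence "6 * real b * ln (1 + real d / real b) \<le> 6 * real b * ln (1 + real e / real b)"
    by (rule mult_left_mono) simp
  thus ?thesis unfolding chain_length_def by (intro nat_mono floor_mono)
qed (simp add: chain_length_def)

text \<open>With \<open>x = 2 * d / b\<close> the increment is at least \<open>(1 + x) / 3\<close>:
  the maximum with 1 gives this for \<open>x < 2\<close>, the quotient, which exceeds
  \<open>x - 1\<close>, for larger \<open>x\<close>. Hence \<open>b + d\<close> grows by a factor of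
  at least \<open>1 + z\<close> with \<open>z = 1 / (3 * b)\<close>, and as
  \<open>ln (1 + z) \<ge> z / 2\<close>, the factor \<open>6 * b\<close> turns this into a gain of
  at least 1 before rounding.\<close>

lemma chain_length_thr: assumes "b > 0" shows "chain_length b d < chain_length b (thr b d)"
proof -
  define x where "x = 2 * real d / real b"
  define q where "q = 2 * d div b"
  have x0: "x \<ge> 0" by (simp add: x_def)
  have q: "real q > x - 1"
  proof -
    have "\<lfloor>x\<rfloor> = int q" unfolding x_def q_def by (metis floor_divide_of_nat_eq of_nat_mult of_nat_numeral)
    thus ?thesis by linarith
  qed
  have "real (max 1 q) \<ge> (1 + x) / 3"
    using q by (cases "x < 2") (auto simp: max_def)
  hence "real (thr b d) \<ge> real d + (1 + x) / 3" by (simp add: thr_def q_def)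
  moreover have "(1 + x) / 3 = (real b + 2 * real d) / (3 * real b)"
    using assms by (simp add: x_def field_simps)
  moreover have "(real b + 2 * real d) / (3 * real b) \<ge> (real b + real d) / (3 * real b)"
    by (rule divide_right_mono) auto
  moreover have "(real b + real d) * (1 + 1 / (3 * real b)) = (real b + real d) + (real b + real d) / (3 * real b)"
    by (simp only: distrib_left mult_1_right times_divide_eq_right)
  ultimately have "real b + real (thr b d) \<ge> (real b + real d) * (1 + 1 / (3 * real b))"
    by linarith
  hence "(1 + real d / real b) * (1 + 1 / (3 * real b)) \<le> 1 + real (thr b d) / real b"
  proof -
    have "1 + real d / real b = (real b + real d) / real b" using assms by (simp add: add_divide_distrib)
    hence "(1 + real d / real b) * (1 + 1 / (3 * real b)) = (real b + real d) * (1 + 1 / (3 * real b)) / real b"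
      by (simp only: times_divide_eq_left)
    also have "\<dots> \<le> (real b + real (thr b d)) / real b"
      by (rule divide_right_mono) (use \<open>real b + real (thr b d) \<ge> _\<close> in auto)
    finally show ?thesis using assms by (simp add: add_divide_distrib)
  qed
  moreover have pos: "0 < 1 + real d / real b" "0 < 1 + 1 / (3 * real b)"
    by (auto intro: add_pos_nonneg)
  ultimately have "ln ((1 + real d / real b) * (1 + 1 / (3 * real b))) \<le> ln (1 + real (thr b d) / real b)"
    by (subst ln_le_cancel_iff) (auto intro: add_pos_nonneg mult_pos_pos)
  hence 1: "ln (1 + real d / real b) + ln (1 + 1 / (3 * real b)) \<le> ln (1 + real (thr b d) / real b)"
    using pos by (simp add: ln_mult_pos)
  define z where "z = 1 / (3 * real b)"
  have z: "0 \<le> z" "z \<le> 1 / 3" using assms by (auto simp: z_def field_simps)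
  have "ln (1 + z) \<ge> z - z\<^sup>2" by (rule ln_one_plus_pos_lower_bound) (use z in auto)
  moreover have "z\<^sup>2 \<le> z * (1 / 2)" unfolding power2_eq_square by (rule mult_left_mono) (use z in auto)
  ultimately have "ln (1 + z) \<ge> z / 2" by linarith
  hence "6 * real b * ln (1 + z) \<ge> 6 * real b * (z / 2)" by (intro mult_left_mono) auto
  hence 2: "6 * real b * ln (1 + z) \<ge> 1" using assms by (simp add: z_def)
  have "6 * real b * (ln (1 + real d / real b) + ln (1 + z)) \<le> 6 * real b * ln (1 + real (thr b d) / real b)"
    by (rule mult_left_mono) (use 1 in \<open>auto simp: z_def\<close>)
  hence "6 * real b * ln (1 + real d / real b) + 1 \<le> 6 * real b * ln (1 + real (thr b d) / real b)"
    using 2 by (simp add: algebra_simps)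
  moreover have "6 * real b * ln (1 + real d / real b) \<ge> 0"
    by (intro mult_nonneg_nonneg ln_ge_zero) auto
  ultimately show ?thesis unfolding chain_length_def by linarith
qed

text \<open>The 24 is \<open>6 * 4\<close>: as \<open>\<rho> \<ge> 1 / 2\<close>, the argument
  \<open>1 + d / b\<close> is at most \<open>8 * \<rho>\<close>, and
  \<open>ln 8 \<le> 3\<close>.\<close>

lemma chain_length_le:
  assumes "real d \<le> 6 * real b * \<rho>" "\<rho> \<ge> 1 / 2" "b > 0"
  shows "real (chain_length b d) \<le> 24 * real b * max 1 (ln \<rho>)"
proof -
  have "real d / real b \<le> 6 * \<rho>" using assms by (simp add: field_simps)
  hence "1 + real d / real b \<le> 8 * \<rho>" using assms by linarith
  hence "ln (1 + real d / real b) \<le> ln (8 * \<rho>)"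
    by (subst ln_le_cancel_iff) (use assms in \<open>auto intro: add_pos_nonneg\<close>)
  also have "\<dots> = ln 8 + ln \<rho>" using assms by (simp add: ln_mult_pos)
  also have "ln (8 :: real) = 3 * ln 2"
    using ln_realpow[of 2 3] by simp
  also have "ln (2 :: real) \<le> 1" using ln_le_minus_one[of 2] by simp
  finally have "ln (1 + real d / real b) \<le> 4 * max 1 (ln \<rho>)" by (simp add: max_def split: if_splits)
  hence "6 * real b * ln (1 + real d / real b) \<le> 6 * real b * (4 * max 1 (ln \<rho>))"
    by (intro mult_left_mono) auto
  moreover have "6 * real b * ln (1 + real d / real b) \<ge> 0"
    by (intro mult_nonneg_nonneg ln_ge_zero) auto
  ultimately show ?thesis unfolding chain_length_def by linarith
qed

section \<open>Programs without a word size\<close>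

text \<open>The semantics without the test \<open>fits\<close>. Correctness and running time are
  proved here; \<open>steps_exec\<close> adds the word size afterwards, by a syntactic check of the
  programs.\<close>

inductive steps :: "com \<Rightarrow> state \<Rightarrow> nat \<Rightarrow> state \<Rightarrow> bool" where
  Skip: "steps Skip s 1 s"
| Assign: "steps (Assign x e) s (1 + cost e) (set_reg x (val e s) s)"
| Write: "steps (Write a i e) s (1 + cost i + cost e) (set_cell a (val i s) (val e s) s)"
| Seq: "steps c1 s t1 s1 \<Longrightarrow> steps c2 s1 t2 s2 \<Longrightarrow> steps (Seq c1 c2) s (t1 + t2) s2"
| CondTrue: "val e s \<noteq> 0 \<Longrightarrow> steps c1 s t s1 \<Longrightarrow> steps (Cond e c1 c2) s (1 + cost e + t) s1"
| CondFalse: "val e s = 0 \<Longrightarrow> steps c2 s t s1 \<Longrightarrow> steps (Cond e c1 c2) s (1 + cost e + t) s1"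
| WhileFalse: "val e s = 0 \<Longrightarrow> steps (While e c) s (1 + cost e) s"
| WhileTrue: "val e s \<noteq> 0 \<Longrightarrow> steps c s t1 s1 \<Longrightarrow> steps (While e c) s1 t2 s2 \<Longrightarrow>
    steps (While e c) s (1 + cost e + t1 + t2) s2"

lemmas steps_intros = steps.intros[unfolded One_nat_def add_Suc add_0]
lemmas exec_intros = exec.intros[unfolded One_nat_def add_Suc add_0]

text \<open>Every register and every cell is assigned a static bound on the exponent \<open>j\<close> in
  \<open>value \<le> N ^ j\<close>.  Counters do not respect such a bound syntactically; they are
  incremented only through \<open>clamp\<close>, which is harmless as they stay below \<open>Q\<close>.\<close>

definition reg_deg :: "name \<Rightarrow> nat" where
  "reg_deg x = (if x = ''n'' \<or> x = ''b'' then 1 else if x = ''k'' then 7 else 3)"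

definition bounded :: "nat \<Rightarrow> state \<Rightarrow> bool" where
  "bounded N s \<longleftrightarrow> (\<forall>x. fst s x \<le> N ^ reg_deg x) \<and> (\<forall>a i. snd s a i \<le> N ^ 3)"

text \<open>The product with the comparison is \<open>e\<close> below \<open>Q\<close> and 0
  otherwise, hence never above the register \<open>Q\<close>, whose exponent is 3.\<close>

definition clamp :: "expr \<Rightarrow> expr" where
  "clamp e = Mul e (Less e (Reg ''Q''))"

fun expr_deg :: "expr \<Rightarrow> nat" where
  "expr_deg (Const k) = 1"
| "expr_deg (Reg x) = reg_deg x"
| "expr_deg (Read a i) = 3"
| "expr_deg (Add p q) = max (expr_deg p) (expr_deg q) + 1"
| "expr_deg (Sub p q) = expr_deg p"
| "expr_deg (Mul p q) = expr_deg p + expr_deg q"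
| "expr_deg (Div p q) = expr_deg p"
| "expr_deg (Less p q) = 1"
| "expr_deg (Equal p q) = 1"

text \<open>The intermediate values matter as well, since \<open>fits\<close> constrains every
  subexpression. Constants up to 4 are covered by \<open>4 \<le> N\<close>.\<close>

fun small :: "expr \<Rightarrow> bool" where
  "small (Const k) \<longleftrightarrow> k \<le> 4"
| "small (Reg x) \<longleftrightarrow> True"
| "small (Read a i) \<longleftrightarrow> small i"
| "small (Add p q) \<longleftrightarrow> small p \<and> small q \<and> expr_deg (Add p q) \<le> 12"
| "small (Sub p q) \<longleftrightarrow> small p \<and> small q"
| "small (Mul p q) \<longleftrightarrow> small p \<and> small q \<and> expr_deg (Mul p q) \<le> 12"
| "small (Div p q) \<longleftrightarrow> small p \<and> small q"
| "small (Less p q) \<longleftrightarrow> small p \<and> small q"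
| "small (Equal p q) \<longleftrightarrow> small p \<and> small q"

definition storable :: "nat \<Rightarrow> expr \<Rightarrow> bool" where
  "storable j e \<longleftrightarrow> small e \<and> (expr_deg e \<le> j \<or> j \<ge> 3 \<and> (\<exists>p. e = clamp p))"

fun safe :: "com \<Rightarrow> bool" where
  "safe Skip \<longleftrightarrow> True"
| "safe (Assign x e) \<longleftrightarrow> storable (reg_deg x) e"
| "safe (Write a i e) \<longleftrightarrow> small i \<and> storable 3 e"
| "safe (Seq c d) \<longleftrightarrow> safe c \<and> safe d"
| "safe (Cond e c d) \<longleftrightarrow> small e \<and> safe c \<and> safe d"
| "safe (While e c) \<longleftrightarrow> small e \<and> safe c"

lemma storable_clamp: "3 \<le> j \<Longrightarrow> storable j (clamp e) \<longleftrightarrow> small (clamp e)"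
  by (auto simp: storable_def)

lemma fits_val: "fits W e s \<Longrightarrow> val e s \<le> W"
  by (cases e) (auto simp: fits_def)

lemma pow_add_le:
  fixes N :: nat
  assumes "N \<ge> 4" "p \<le> N ^ i" "q \<le> N ^ j"
  shows "p + q \<le> N ^ (max i j + 1)"
proof -
  have "p \<le> N ^ max i j" "q \<le> N ^ max i j"
    using assms by (auto intro: order_trans power_increasing)
  hence "p + q \<le> 2 * N ^ max i j" by simp
  also have "\<dots> \<le> N * N ^ max i j" using assms by simp
  finally show ?thesis by simp
qed

lemma small_val:
  assumes "bounded N s" "N \<ge> 4"
  shows "small e \<Longrightarrow> val e s \<le> N ^ expr_deg e \<and> fits (N ^ 12) e s"
proof (induction e)
  case (Add p q)
  hence "val (Add p q) s \<le> N ^ expr_deg (Add p q)" using pow_add_le assms by simp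
  moreover have "\<dots> \<le> N ^ 12" by (rule power_increasing) (use Add.prems assms in auto)
  ultimately show ?case using Add by (auto simp: fits_def)
next
  case (Mul p q)
  hence "val (Mul p q) s \<le> N ^ expr_deg (Mul p q)" by (simp add: power_add mult_le_mono)
  moreover have "\<dots> \<le> N ^ 12" by (rule power_increasing) (use Mul.prems assms in auto)
  ultimately show ?case using Mul by (auto simp: fits_def)
next
  case (Const k)
  have "N ^ 1 \<le> N ^ 12" by (rule power_increasing) (use assms in auto)
  thus ?case using Const assms by (auto simp: fits_def)
next
  case (Reg x)
  have "N ^ reg_deg x \<le> N ^ 12" by (rule power_increasing) (use assms in \<open>auto simp: reg_deg_def\<close>)
  moreover have "fst s x \<le> N ^ reg_deg x" using assms by (simp add: bounded_def)
  ultimately show ?case by (auto simp: fits_def)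
next
  case (Read a i)
  have "N ^ 3 \<le> N ^ 12" by (rule power_increasing) (use assms in auto)
  moreover have "snd s a (val i s) \<le> N ^ 3" using assms by (simp add: bounded_def)
  ultimately show ?case using Read by (auto simp: fits_def)
next
  case (Sub p q)
  have "val p s \<le> N ^ expr_deg p" "val p s \<le> N ^ 12"
    using Sub fits_val[of "N ^ 12" p s] by auto
  hence "val (Sub p q) s \<le> N ^ expr_deg p" "val (Sub p q) s \<le> N ^ 12" by auto
  thus ?case using Sub by (auto simp: fits_def)
next
  case (Div p q)
  have "val p s \<le> N ^ expr_deg p" "val p s \<le> N ^ 12"
    using Div fits_val[of "N ^ 12" p s] by auto
  hence "val (Div p q) s \<le> N ^ expr_deg p" "val (Div p q) s \<le> N ^ 12"
    by (auto intro: order_trans[OF div_le_dividend])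
  thus ?case using Div by (auto simp: fits_def)
next
  case (Less p q)
  thus ?case using assms by (auto simp: fits_def)
next
  case (Equal p q)
  thus ?case using assms by (auto simp: fits_def)
qed

lemma storable_val:
  assumes "bounded N s" "N \<ge> 4" "storable j e"
  shows "val e s \<le> N ^ j \<and> fits (N ^ 12) e s"
proof -
  have "val e s \<le> N ^ j" if "expr_deg e \<le> j"
  proof -
    have "val e s \<le> N ^ expr_deg e" using small_val[OF assms(1,2)] assms(3) by (simp add: storable_def)
    also have "\<dots> \<le> N ^ j" by (rule power_increasing) (use that assms in auto)
    finally show ?thesis .
  qed
  moreover have "val e s \<le> N ^ j" if "j \<ge> 3" "e = clamp p" for p
  proof -
    have "val e s \<le> fst s ''Q''" using that by (auto simp: clamp_def)
    also have "\<dots> \<le> N ^ 3" using assms(1) by (auto simp: bounded_def reg_deg_def dest: spec[of _ "''Q''"])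
    also have "\<dots> \<le> N ^ j" by (rule power_increasing) (use that assms in auto)
    finally show ?thesis .
  qed
  ultimately show ?thesis using small_val[OF assms(1,2)] assms(3) by (auto simp: storable_def)
qed

text \<open>Each assignment of a safe program preserves \<open>bounded\<close>, so the correctness
  proofs need no invariants about magnitudes. The largest exponents come from the buckets: a key
  \<open>w * Q + d\<close> has exponent 7, and an index \<open>k * n + i\<close> into the bucket
  arrays stays below 12.\<close>

lemma steps_exec:
  "steps c s t s' \<Longrightarrow> safe c \<Longrightarrow> bounded N s \<Longrightarrow> N \<ge> 4 \<Longrightarrow> exec (N ^ 12) c s t s' \<and> bounded N s'"
proof (induction rule: steps.induct)
  case (Assign x e s)
  thus ?case using storable_val[of N s "reg_deg x" e]
    using exec.Assign[of "N ^ 12" e s x] by (auto simp: bounded_def set_reg_def)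
next
  case (Write a i e s)
  thus ?case using storable_val[of N s 3 e] small_val[of N s i]
    using exec.Write[of "N ^ 12" i s e a] by (auto simp: bounded_def set_cell_def)
next
  case (CondTrue e s c1 t s1 c2)
  thus ?case using small_val[of N s e] by (auto intro: exec_intros)
next
  case (CondFalse e s c2 t s1 c1)
  thus ?case using small_val[of N s e] by (auto intro: exec_intros)
next
  case (WhileFalse e s c)
  thus ?case using small_val[of N s e] by (auto intro: exec_intros)
next
  case (WhileTrue e s c t1 s1 t2 s2)
  thus ?case using small_val[of N s e] by (auto intro: exec_intros)
qed (auto intro: exec_intros)

section \<open>Total correctness with running times\<close>

definition runs :: "com \<Rightarrow> state \<Rightarrow> nat \<Rightarrow> (state \<Rightarrow> bool) \<Rightarrow> bool" where
  "runs c s T Q \<longleftrightarrow> (\<exists>t s'. steps c s t s' \<and> t \<le> T \<and> Q s')"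

fun block :: "com list \<Rightarrow> com" where
  "block [] = Skip"
| "block (c # cs) = Seq c (block cs)"

fun assigned :: "com \<Rightarrow> name set" where
  "assigned Skip = {}"
| "assigned (Assign x e) = {x}"
| "assigned (Write a i e) = {}"
| "assigned (Seq c d) = assigned c \<union> assigned d"
| "assigned (Cond e c d) = assigned c \<union> assigned d"
| "assigned (While e c) = assigned c"

lemma steps_assigned: "steps c s t s' \<Longrightarrow> x \<notin> assigned c \<Longrightarrow> fst s' x = fst s x"
  by (induction rule: steps.induct) (auto simp: set_reg_def set_cell_def)

lemma runs_mono: "runs c s T Q \<Longrightarrow> T \<le> T' \<Longrightarrow> (\<And>s'. Q s' \<Longrightarrow> Q' s') \<Longrightarrow> runs c s T' Q'"
  unfolding runs_def by (meson order_trans)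

lemma runs_frame: "runs c s T Q \<Longrightarrow> runs c s T (\<lambda>s'. Q s' \<and> (\<forall>x. x \<notin> assigned c \<longrightarrow> fst s' x = fst s x))"
  unfolding runs_def using steps_assigned by blast

lemma runs_Seq:
  assumes "runs c s T1 (\<lambda>s'. runs d s' T2 Q)" "T1 + T2 \<le> T"
  shows "runs (Seq c d) s T Q"
proof -
  from assms(1) obtain t s' where 1: "steps c s t s'" "t \<le> T1" "runs d s' T2 Q"
    unfolding runs_def[of c] by blast
  from 1(3) obtain t' s'' where "steps d s' t' s''" "t' \<le> T2" "Q s''" unfolding runs_def by blast
  with 1 assms(2) steps.Seq[of c s t s' d t' s''] show ?thesis
    unfolding runs_def by (intro exI[of _ "t + t'"] exI[of _ s'']) auto
qed

lemma runs_Cond: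
  assumes "val e s \<noteq> 0 \<Longrightarrow> runs c s T Q" "val e s = 0 \<Longrightarrow> runs d s T Q" "1 + cost e + T \<le> T'"
  shows "runs (Cond e c d) s T' Q"
proof (cases "val e s = 0")
  case True
  then obtain t s' where "steps d s t s'" "t \<le> T" "Q s'" using assms(2) by (auto simp: runs_def)
  thus ?thesis unfolding runs_def using True assms(3)
    by (intro exI[of _ "1 + cost e + t"] exI[of _ s']) (auto intro: steps_intros)
next
  case False
  then obtain t s' where "steps c s t s'" "t \<le> T" "Q s'" using assms(1) by (auto simp: runs_def)
  thus ?thesis unfolding runs_def using False assms(3)
    by (intro exI[of _ "1 + cost e + t"] exI[of _ s']) (auto intro: steps_intros)
qed

text \<open>\<open>k\<close> bounds the number of remaining iterations. It may drop by more than one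
  at a time, as the potential of a chain of flips does.\<close>

lemma runs_While:
  assumes body: "\<And>k s. I k s \<Longrightarrow> val e s \<noteq> 0 \<Longrightarrow> \<exists>k'<k. runs c s T (I k')"
  shows "I k s \<Longrightarrow> runs (While e c) s ((k + 1) * (1 + cost e + T)) (\<lambda>s'. \<exists>k'. I k' s' \<and> val e s' = 0)"
proof (induction k arbitrary: s rule: less_induct)
  case (less k)
  show ?case
  proof (cases "val e s = 0")
    case True
    thus ?thesis using less.prems unfolding runs_def
      by (intro exI[of _ "1 + cost e"] exI[of _ s]) (auto intro: steps_intros)
  next
    case False
    from body[OF less.prems False] obtain k' t s' where
      1: "k' < k" "steps c s t s'" "t \<le> T" "I k' s'" by (auto simp: runs_def)
    from less.IH[OF 1(1,4)] obtain t' s'' where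
      2: "steps (While e c) s' t' s''" "t' \<le> (k' + 1) * (1 + cost e + T)" "\<exists>k'. I k' s'' \<and> val e s'' = 0"
      by (auto simp: runs_def)
    have "(k' + 1) * (1 + cost e + T) \<le> k * (1 + cost e + T)" by (rule mult_le_mono1) (use 1 in simp)
    hence "1 + cost e + t + t' \<le> (k + 1) * (1 + cost e + T)" using 1(3) 2(2) by simp
    thus ?thesis using steps.WhileTrue[OF False 1(2) 2(1)] 2(3) unfolding runs_def by blast
  qed
qed

text \<open>For loop-free code the final state is a function of the initial one, so that the
  simplifier can execute it symbolically with \<open>eff\<close>.\<close>

fun straight :: "com \<Rightarrow> bool" where
  "straight (Seq c d) \<longleftrightarrow> straight c \<and> straight d"
| "straight (Cond e c d) \<longleftrightarrow> straight c \<and> straight d"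
| "straight (While e c) \<longleftrightarrow> False"
| "straight _ \<longleftrightarrow> True"

fun eff :: "com \<Rightarrow> state \<Rightarrow> state" where
  "eff (Assign x e) s = set_reg x (val e s) s"
| "eff (Write a i e) s = set_cell a (val i s) (val e s) s"
| "eff (Seq c d) s = eff d (eff c s)"
| "eff (Cond e c d) s = (if val e s \<noteq> 0 then eff c s else eff d s)"
| "eff _ s = s"

fun time :: "com \<Rightarrow> nat" where
  "time (Assign x e) = 1 + cost e"
| "time (Write a i e) = 1 + cost i + cost e"
| "time (Seq c d) = time c + time d"
| "time (Cond e c d) = 1 + cost e + max (time c) (time d)"
| "time _ = 1"

lemma steps_straight: "straight c \<Longrightarrow> \<exists>t\<le>time c. steps c s t (eff c s)"
proof (induction c arbitrary: s)
  case (Seq c d)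
  then obtain t t' where "t \<le> time c" "steps c s t (eff c s)" "t' \<le> time d" "steps d (eff c s) t' (eff d (eff c s))"
    by (meson straight.simps(1))
  thus ?case by (intro exI[of _ "t + t'"]) (auto intro: steps_intros)
next
  case (Cond e c d)
  then obtain t t' where "t \<le> time c" "steps c s t (eff c s)" "t' \<le> time d" "steps d s t' (eff d s)"
    by (meson straight.simps(2))
  thus ?case
    by (intro exI[of _ "1 + cost e + (if val e s \<noteq> 0 then t else t')"]) (auto intro: steps_intros)
next
  case (Write a i e)
  thus ?case by (intro exI[of _ "1 + cost i + cost e"]) (auto intro: steps_intros)
next
  case (Assign x e)
  thus ?case by (intro exI[of _ "1 + cost e"]) (auto intro: steps_intros)
qed (auto intro: steps_intros)

lemma runs_straight: "straight c \<Longrightarrow> Q (eff c s) \<Longrightarrow> time c \<le> T \<Longrightarrow> runs c s T Q"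
  unfolding runs_def using steps_straight[of c s] by (meson order_trans)

lemma eff_assigned: "x \<notin> assigned c \<Longrightarrow> fst (eff c s) x = fst s x"
  by (induction c arbitrary: s) (auto simp: set_reg_def set_cell_def)

fun written :: "com \<Rightarrow> name set" where
  "written Skip = {}"
| "written (Assign x e) = {}"
| "written (Write a i e) = {a}"
| "written (Seq c d) = written c \<union> written d"
| "written (Cond e c d) = written c \<union> written d"
| "written (While e c) = written c"

lemma eff_written: "a \<notin> written c \<Longrightarrow> snd (eff c s) a = snd s a"
  by (induction c arbitrary: s) (auto simp: set_reg_def set_cell_def)

lemma set_reg_set_reg [simp]: "set_reg x i (set_reg x j s) = set_reg x i s"
  by (simp add: set_reg_def)

lemma cost_simps [simp]:
  "cost (Const k) = 1" "cost (Reg x) = 1" "cost (Read a i) = 1 + cost i"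
  "cost (Add p q) = 1 + cost p + cost q" "cost (Sub p q) = 1 + cost p + cost q"
  "cost (Mul p q) = 1 + cost p + cost q" "cost (Div p q) = 1 + cost p + cost q"
  "cost (Less p q) = 1 + cost p + cost q" "cost (Equal p q) = 1 + cost p + cost q"
  by (simp_all add: cost_def)

lemma fst_set_reg [simp]: "fst (set_reg x k s) = (fst s)(x := k)"
  and snd_set_reg [simp]: "snd (set_reg x k s) = snd s"
  and fst_set_cell [simp]: "fst (set_cell a i k s) = fst s"
  and snd_set_cell [simp]: "snd (set_cell a i k s) = (snd s)(a := (snd s a)(i := k))"
  by (simp_all add: set_reg_def set_cell_def)

text \<open>Linear search for the first index at which \<open>g\<close> fails. Because
  \<open>m\<close> lies below \<open>Q\<close>, the clamped increment never resets the
  counter.\<close>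

lemma runs_scan:
  assumes "\<And>j. j < m \<Longrightarrow> val g (set_reg ''i'' j s) \<noteq> 0" "val g (set_reg ''i'' m s) = 0"
    and "m < fst s ''Q''"
  shows "runs (block [Assign ''i'' (Const 0), While g (Assign ''i'' (clamp (Add (Reg ''i'') (Const 1))))]) s
    ((m + 1) * (cost g + 15)) (\<lambda>s'. s' = set_reg ''i'' m s)"
proof -
  define I where "I = (\<lambda>k s'. k \<le> m \<and> s' = set_reg ''i'' (m - k) s)"
  have "runs (While g (Assign ''i'' (clamp (Add (Reg ''i'') (Const 1))))) (set_reg ''i'' 0 s)
      ((m + 1) * (1 + cost g + 10)) (\<lambda>s'. \<exists>k. I k s' \<and> val g s' = 0)"
  proof (rule runs_While)
    fix k s' assume I: "I k s'" and v: "val g s' \<noteq> 0"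
    hence k: "0 < k" using assms(2) by (cases k) (auto simp: I_def)
    have "runs (Assign ''i'' (clamp (Add (Reg ''i'') (Const 1)))) s' 10 (I (k - 1))"
      by (rule runs_straight) (use I k assms(3) in \<open>auto simp: I_def clamp_def Suc_diff_le\<close>)
    thus "\<exists>k'<k. runs (Assign ''i'' (clamp (Add (Reg ''i'') (Const 1)))) s' 10 (I k')"
      using k by (intro exI[of _ "k - 1"]) auto
  qed (simp add: I_def)
  note loop = this
  have stop: "s' = set_reg ''i'' m s" if "I k s'" "val g s' = 0" for k s'
    using that assms(1)[of "m - k"] by (cases "k = 0") (auto simp: I_def)
  have 1: "runs (While g (Assign ''i'' (clamp (Add (Reg ''i'') (Const 1))))) (set_reg ''i'' 0 s)
      ((m + 1) * (1 + cost g + 10)) (\<lambda>s'. s' = set_reg ''i'' m s)"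
    by (rule runs_mono[OF loop order_refl]) (elim exE conjE, rule stop)
  have 2: "runs (block [While g (Assign ''i'' (clamp (Add (Reg ''i'') (Const 1))))]) (set_reg ''i'' 0 s)
      ((m + 1) * (1 + cost g + 10) + 1) (\<lambda>s'. s' = set_reg ''i'' m s)"
    unfolding block.simps
    by (rule runs_Seq[OF runs_mono[OF 1 order_refl], where ?T2.0 = 1]) (simp_all add: runs_straight)
  show ?thesis unfolding block.simps(2)[of "Assign _ _"]
    by (rule runs_Seq[OF runs_straight]) (use 2 in \<open>auto simp: algebra_simps\<close>)
qed

section \<open>Families of indexed sets\<close>

text \<open>The sparse-set representation of Briggs and Torczon: \<open>f\<close> lists the members
  in its first \<open>m\<close> cells and \<open>g\<close> gives their positions. It supports
  insertion, deletion and membership in constant time and leaves \<open>g\<close> arbitrary outside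
  the set.\<close>

definition indexed :: "nat \<Rightarrow> nat set \<Rightarrow> nat \<Rightarrow> (nat \<Rightarrow> nat) \<Rightarrow> (nat \<Rightarrow> nat) \<Rightarrow> bool" where
  "indexed n T m f g \<longleftrightarrow> T \<subseteq> {..<n} \<and> (\<forall>x\<in>T. g x < m \<and> f (g x) = x) \<and> (\<forall>i<m. f i \<in> T \<and> g (f i) = i)"

text \<open>All sets of a family share three arrays, with rows of width \<open>n\<close>.
  Zero-filled memory represents the family of empty sets.\<close>

definition iset :: "nat \<Rightarrow> (nat \<Rightarrow> nat set) \<Rightarrow> (nat \<Rightarrow> nat) \<Rightarrow> (nat \<Rightarrow> nat) \<Rightarrow> (nat \<Rightarrow> nat) \<Rightarrow> bool" where
  "iset n S sz el pos \<longleftrightarrow> (\<forall>k. indexed n (S k) (sz k) (\<lambda>i. el (k * n + i)) (\<lambda>x. pos (k * n + x)))"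

lemma indexed_bij: "indexed n T m f g \<Longrightarrow> bij_betw f {..<m} T"
  by (rule bij_betw_byWitness[where f' = g]) (auto simp: indexed_def)

lemma indexed_card: "indexed n T m f g \<Longrightarrow> card T = m"
  using bij_betw_same_card[OF indexed_bij] by fastforce

lemma indexed_le: "indexed n T m f g \<Longrightarrow> m \<le> n"
  using indexed_card[of n T m f g] card_mono[of "{..<n}" T] by (simp add: indexed_def)

lemma indexed_less:
  assumes "indexed n T m f g" "x < n" "x \<notin> T" shows "m < n"
proof -
  have "T \<subset> {..<n}" using assms by (auto simp: indexed_def)
  hence "card T < card {..<n}" by (intro psubset_card_mono) auto
  thus ?thesis using indexed_card[OF assms(1)] by simp
qed

lemma indexed_cong:
  assumes "\<And>i. i < n \<Longrightarrow> f i = f' i" "\<And>i. i < n \<Longrightarrow> g i = g' i" "indexed n T m f g"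
  shows "indexed n T m f' g'"
proof -
  have "m \<le> n" using indexed_le assms by blast
  hence "f i = f' i" if "i < m" for i using that assms by simp
  moreover have "g x = g' x" if "x \<in> T" for x using that assms by (auto simp: indexed_def)
  ultimately show ?thesis using assms(3) unfolding indexed_def by metis
qed

lemma indexed_insert:
  "indexed n T m f g \<Longrightarrow> x < n \<Longrightarrow> x \<notin> T \<Longrightarrow> indexed n (insert x T) (Suc m) (f(m := x)) (g(x := m))"
  unfolding indexed_def by (auto simp: less_Suc_eq)

text \<open>The last entry fills the hole. If \<open>x\<close> is itself the last entry, both
  function updates change nothing.\<close>

lemma indexed_remove:
  assumes "indexed n T m f g" "x \<in> T"
  shows "indexed n (T - {x}) (m - 1) (f(g x := f (m - 1))) (g(f (m - 1) := g x))"
proof -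
  have m: "m - 1 < m" "m > 0" using assms by (auto simp: indexed_def)
  let ?l = "f (m - 1)"
  have l: "?l \<in> T" "g ?l = m - 1" using assms m by (auto simp: indexed_def)
  have x: "g x < m" "f (g x) = x" using assms by (auto simp: indexed_def)
  have 1: "(g(?l := g x)) y < m - 1 \<and> (f(g x := ?l)) ((g(?l := g x)) y) = y" if "y \<in> T - {x}" for y
  proof (cases "y = ?l")
    case True
    have "g x \<noteq> m - 1" using that True x by auto
    thus ?thesis using True x by simp
  next
    case False
    have y: "g y < m" "f (g y) = y" using that assms by (auto simp: indexed_def)
    have "g y \<noteq> m - 1" using False y by auto
    moreover have "g y \<noteq> g x" using y x that by auto
    ultimately show ?thesis using False y by simp
  qed
  have 2: "(f(g x := ?l)) i \<in> T - {x} \<and> (g(?l := g x)) ((f(g x := ?l)) i) = i" if "i < m - 1" for i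
  proof (cases "i = g x")
    case True
    have "?l \<noteq> x" using l that True by auto
    thus ?thesis using True l by simp
  next
    case False
    have i: "f i \<in> T" "g (f i) = i" using that assms by (auto simp: indexed_def)
    have "f i \<noteq> x" using False i by auto
    moreover have "f i \<noteq> ?l" using i l that by auto
    ultimately show ?thesis using False i by simp
  qed
  show ?thesis using 1 2 assms(1) unfolding indexed_def by blast
qed

lemma index_inject:
  fixes n :: nat
  assumes "i < n" "j < n"
  shows "k * n + i = l * n + j \<longleftrightarrow> k = l \<and> i = j"
proof
  assume eq: "k * n + i = l * n + j"
  have "(k * n + i) div n = k" "(l * n + j) div n = l" using assms by auto
  with eq show "k = l \<and> i = j" by auto
qed auto

lemma iset_insert:
  assumes "iset n S sz el pos" "x < n" "x \<notin> S k"
  shows "iset n (S(k := insert x (S k))) (sz(k := Suc (sz k))) (el(k * n + sz k := x)) (pos(k * n + x := sz k))"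
  unfolding iset_def
proof
  fix k'
  have I: "indexed n (S j) (sz j) (\<lambda>i. el (j * n + i)) (\<lambda>x. pos (j * n + x))" for j
    using assms(1) by (simp add: iset_def)
  have m: "sz k < n" by (rule indexed_less[OF I assms(2,3)])
  show "indexed n ((S(k := insert x (S k))) k') ((sz(k := Suc (sz k))) k')
      (\<lambda>i. (el(k * n + sz k := x)) (k' * n + i)) (\<lambda>y. (pos(k * n + x := sz k)) (k' * n + y))"
  proof (cases "k' = k")
    case True
    show ?thesis unfolding True fun_upd_same
      by (rule indexed_cong[OF _ _ indexed_insert[OF I assms(2,3)]]) simp_all
  next
    case False
    show ?thesis unfolding fun_upd_other[OF False]
      by (rule indexed_cong[OF _ _ I]) (use False m assms(2) in \<open>simp_all add: index_inject\<close>)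
  qed
qed

lemma iset_remove:
  assumes "iset n S sz el pos" "x \<in> S k"
  defines "l \<equiv> el (k * n + (sz k - 1))"
  shows "iset n (S(k := S k - {x})) (sz(k := sz k - 1)) (el(k * n + pos (k * n + x) := l))
    (pos(k * n + l := pos (k * n + x)))"
  unfolding iset_def
proof
  fix k'
  have I: "indexed n (S j) (sz j) (\<lambda>i. el (j * n + i)) (\<lambda>x. pos (j * n + x))" for j
    using assms(1) by (simp add: iset_def)
  have p: "pos (k * n + x) < n"
    using I[of k] indexed_le[OF I, of k] assms(2) by (auto simp: indexed_def)
  have "sz k - 1 < sz k" using I[of k] assms(2) by (auto simp: indexed_def)
  hence l: "l < n" using I[of k] by (auto simp: indexed_def l_def)
  show "indexed n ((S(k := S k - {x})) k') ((sz(k := sz k - 1)) k')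
      (\<lambda>i. (el(k * n + pos (k * n + x) := l)) (k' * n + i)) (\<lambda>y. (pos(k * n + l := pos (k * n + x))) (k' * n + y))"
  proof (cases "k' = k")
    case True
    show ?thesis unfolding True fun_upd_same
      by (rule indexed_cong[OF _ _ indexed_remove[OF I assms(2)]]) (simp_all add: l_def)
  next
    case False
    show ?thesis unfolding fun_upd_other[OF False]
      by (rule indexed_cong[OF _ _ I]) (use False p l in \<open>simp_all add: index_inject\<close>)
  qed
qed

text \<open>For an element outside the set \<open>pos\<close> may be stale, but a cell below
  \<open>sz k\<close> holds a member and thus a different element.\<close>

lemma iset_member:
  assumes "iset n S sz el pos" "x < n"
  shows "pos (k * n + x) < sz k \<and> el (k * n + pos (k * n + x)) = x \<longleftrightarrow> x \<in> S k"
proof -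
  have "indexed n (S k) (sz k) (\<lambda>i. el (k * n + i)) (\<lambda>x. pos (k * n + x))"
    using assms(1) by (simp add: iset_def)
  thus ?thesis unfolding indexed_def by force
qed

text \<open>The key is passed in the register \<open>k\<close> and the element in the register \<open>e\<close>.\<close>

definition slot :: "expr \<Rightarrow> expr" where
  "slot i = Add (Mul (Reg ''k'') (Reg ''n'')) i"

definition member :: "name \<Rightarrow> name \<Rightarrow> name \<Rightarrow> expr" where
  "member sz el pos = Mul (Less (Read pos (slot (Reg ''e''))) (Read sz (Reg ''k'')))
     (Equal (Read el (slot (Read pos (slot (Reg ''e''))))) (Reg ''e''))"

text \<open>Insertion and deletion test membership first and are thus idempotent. Callers may
  recompute whether an element belongs to a set without knowing whether it already does.\<close>

definition add_elem :: "name \<Rightarrow> name \<Rightarrow> name \<Rightarrow> com" where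
  "add_elem sz el pos = Cond (member sz el pos) Skip (block
     [Write el (slot (Read sz (Reg ''k''))) (Reg ''e''),
      Write pos (slot (Reg ''e'')) (Read sz (Reg ''k'')),
      Write sz (Reg ''k'') (clamp (Add (Read sz (Reg ''k'')) (Const 1)))])"

definition del_elem :: "name \<Rightarrow> name \<Rightarrow> name \<Rightarrow> com" where
  "del_elem sz el pos = Cond (member sz el pos) (block
     [Assign ''l'' (Read el (slot (Sub (Read sz (Reg ''k'')) (Const 1)))),
      Write el (slot (Read pos (slot (Reg ''e'')))) (Reg ''l''),
      Write pos (slot (Reg ''l'')) (Read pos (slot (Reg ''e''))),
      Write sz (Reg ''k'') (Sub (Read sz (Reg ''k'')) (Const 1))]) Skip"

lemma val_slot: "fst s ''n'' = n \<Longrightarrow> val (slot i) s = fst s ''k'' * n + val i s"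
  by (simp add: slot_def)

lemma eff_add_elem:
  assumes I: "iset n S (snd s sz) (snd s el) (snd s pos)"
    and s: "fst s ''n'' = n" "fst s ''e'' < n" "n < fst s ''Q''" and d: "distinct [sz, el, pos]"
  defines "s' \<equiv> eff (add_elem sz el pos) s"
  shows "iset n (S(fst s ''k'' := insert (fst s ''e'') (S (fst s ''k'')))) (snd s' sz) (snd s' el) (snd s' pos)"
    and "a \<notin> {sz, el, pos} \<Longrightarrow> snd s' a = snd s a"
proof -
  let ?k = "fst s ''k''" and ?e = "fst s ''e''"
  have mem: "val (member sz el pos) s \<noteq> 0 \<longleftrightarrow> ?e \<in> S ?k"
    using iset_member[OF I s(2), of ?k] by (auto simp: member_def val_slot[OF s(1)] split: if_splits)
  show "iset n (S(?k := insert ?e (S ?k))) (snd s' sz) (snd s' el) (snd s' pos)"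
  proof (cases "?e \<in> S ?k")
    case True
    hence "s' = s" using mem by (simp add: s'_def add_elem_def)
    thus ?thesis using I True by (simp add: insert_absorb)
  next
    case False
    have "indexed n (S ?k) (snd s sz ?k) (\<lambda>i. snd s el (?k * n + i)) (\<lambda>x. snd s pos (?k * n + x))"
      using I by (simp add: iset_def)
    from indexed_less[OF this s(2) False] have "snd s sz ?k + 1 < fst s ''Q''" using s(3) by simp
    hence "snd s' sz = (snd s sz)(?k := Suc (snd s sz ?k))"
      "snd s' el = (snd s el)(?k * n + snd s sz ?k := ?e)"
      "snd s' pos = (snd s pos)(?k * n + ?e := snd s sz ?k)"
      using False mem d s(1) by (auto simp: s'_def add_elem_def val_slot clamp_def)
    thus ?thesis using iset_insert[OF I s(2) False] by simp
  qed
  show "a \<notin> {sz, el, pos} \<Longrightarrow> snd s' a = snd s a"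
    unfolding s'_def by (rule eff_written) (simp add: add_elem_def)
qed

lemma eff_del_elem:
  assumes I: "iset n S (snd s sz) (snd s el) (snd s pos)"
    and s: "fst s ''n'' = n" "fst s ''e'' < n" and d: "distinct [sz, el, pos]"
  defines "s' \<equiv> eff (del_elem sz el pos) s"
  shows "iset n (S(fst s ''k'' := S (fst s ''k'') - {fst s ''e''})) (snd s' sz) (snd s' el) (snd s' pos)"
    and "a \<notin> {sz, el, pos} \<Longrightarrow> snd s' a = snd s a"
proof -
  let ?k = "fst s ''k''" and ?e = "fst s ''e''"
  have mem: "val (member sz el pos) s \<noteq> 0 \<longleftrightarrow> ?e \<in> S ?k"
    using iset_member[OF I s(2), of ?k] by (auto simp: member_def val_slot[OF s(1)] split: if_splits)
  show "iset n (S(?k := S ?k - {?e})) (snd s' sz) (snd s' el) (snd s' pos)"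
  proof (cases "?e \<in> S ?k")
    case True
    have ne: "sz \<noteq> el" "sz \<noteq> pos" "el \<noteq> pos" "el \<noteq> sz" "pos \<noteq> sz" "pos \<noteq> el"
      using d by auto
    have "snd s' sz = (snd s sz)(?k := snd s sz ?k - 1)"
      "snd s' el = (snd s el)(?k * n + snd s pos (?k * n + ?e) := snd s el (?k * n + (snd s sz ?k - 1)))"
      "snd s' pos = (snd s pos)(?k * n + snd s el (?k * n + (snd s sz ?k - 1)) := snd s pos (?k * n + ?e))"
      using True mem ne by (simp_all add: s'_def del_elem_def slot_def s(1))
    thus ?thesis using iset_remove[OF I True] by simp
  next
    case False
    hence "s' = s" using mem by (simp add: s'_def del_elem_def)
    moreover have "S ?k - {?e} = S ?k" using False by blast
    ultimately show ?thesis using I by simp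
  qed
  show "a \<notin> {sz, el, pos} \<Longrightarrow> snd s' a = snd s a"
    unfolding s'_def by (rule eff_written) (simp add: del_elem_def)
qed

lemma elem_ops [simp]:
  "assigned (add_elem sz el pos) = {}" "assigned (del_elem sz el pos) = {''l''}"
  "straight (add_elem sz el pos)" "straight (del_elem sz el pos)"
  "safe (add_elem sz el pos)" "safe (del_elem sz el pos)"
  "time (add_elem sz el pos) \<le> 100" "time (del_elem sz el pos) \<le> 100"
  by (simp_all add: add_elem_def del_elem_def member_def slot_def clamp_def storable_def reg_deg_def)

section \<open>The representation of an orientation in memory\<close>

text \<open>Below, \<open>c u v\<close> is the number of copies of the arc from \<open>u\<close> to \<open>v\<close>.\<close>

definition rows :: "nat \<Rightarrow> nat \<Rightarrow> (nat \<Rightarrow> nat \<Rightarrow> nat) \<Rightarrow> (nat \<Rightarrow> nat) \<Rightarrow> (nat \<Rightarrow> nat) \<Rightarrow> bool" where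
  "rows n D c len adj \<longleftrightarrow> (\<forall>u<n. len u \<le> D \<and>
     (\<forall>v. count (mset (map (\<lambda>i. adj (u * D + i)) [0..<len u])) v = c u v))"

text \<open>Ties go to the smaller tail, so that exactly one direction of each edge qualifies and
  the orientation of the simple graph is a function of the multiplicities.\<close>

definition arc :: "(nat \<Rightarrow> nat \<Rightarrow> nat) \<Rightarrow> nat \<Rightarrow> nat \<Rightarrow> bool" where
  "arc c u v \<longleftrightarrow> 0 < c u v \<and> (c v u < c u v \<or> c v u = c u v \<and> u < v)"

definition majority :: "nat \<Rightarrow> (nat \<Rightarrow> nat \<Rightarrow> nat) \<Rightarrow> nat \<Rightarrow> nat set" where
  "majority n c u = {v. v < n \<and> arc c u v}"

text \<open>The tails of the arcs into \<open>w\<close> are grouped by a degree \<open>\<delta> w x\<close>; in between updates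
  \<open>\<delta> w x\<close> is the out-degree of \<open>x\<close>.\<close>

definition bucket :: "nat \<Rightarrow> nat \<Rightarrow> (nat \<Rightarrow> nat \<Rightarrow> nat) \<Rightarrow> (nat \<Rightarrow> nat \<Rightarrow> nat) \<Rightarrow> nat \<Rightarrow> nat set" where
  "bucket n Q c \<delta> k = {x. x < n \<and> 0 < c x (k div Q) \<and> \<delta> (k div Q) x = k mod Q}"

text \<open>\<open>D\<close> is the row width of \<open>madj\<close>. \<open>Q\<close> exceeds the
  thresholds as well as the degrees: degrees are at most \<open>n * b\<close>, and
  \<open>thr\<close> adds at most 1 or twice the degree. A key \<open>w * Q + d\<close> therefore
  determines \<open>w\<close> and \<open>d\<close> in either case.\<close>

definition params :: "nat \<Rightarrow> nat \<Rightarrow> state \<Rightarrow> bool" where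
  "params n b s \<longleftrightarrow> fst s ''n'' = n \<and> fst s ''b'' = b \<and> fst s ''D'' = n * b \<and> fst s ''Q'' = 4 * n * b"

text \<open>\<open>dg\<close> and the buckets may lag behind: they describe \<open>\<delta>\<close>,
  whereas \<open>mlen\<close> always holds the current out-degrees, by
  \<open>rows_size\<close>.\<close>

definition repr :: "nat \<Rightarrow> nat \<Rightarrow> (nat \<Rightarrow> nat \<Rightarrow> nat) \<Rightarrow> (nat \<Rightarrow> nat) \<Rightarrow> state \<Rightarrow> bool" where
  "repr n b c \<delta> s \<longleftrightarrow> params n b s \<and> (\<forall>u v. 0 < c u v \<longrightarrow> u < n \<and> v < n) \<and>
     rows n (n * b) c (snd s ''mlen'') (snd s ''madj'') \<and>
     (\<forall>u<n. \<forall>v<n. snd s ''cnt'' (u * n + v) = c u v) \<and>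
     (\<forall>u<n. snd s ''dg'' u = \<delta> u) \<and>
     iset n (bucket n (4 * n * b) c (\<lambda>_. \<delta>)) (snd s ''bsz'') (snd s ''bel'') (snd s ''bpos'') \<and>
     iset n (majority n c) (snd s ''len'') (snd s ''adj'') (snd s ''spos'')"

abbreviation upd :: "(nat \<Rightarrow> nat \<Rightarrow> nat) \<Rightarrow> nat \<Rightarrow> nat \<Rightarrow> nat \<Rightarrow> nat \<Rightarrow> nat \<Rightarrow> nat" where
  "upd c x y m \<equiv> c(x := (c x)(y := m))"

lemma rows_size:
  assumes "rows n D c len adj" "\<And>u v. 0 < c u v \<Longrightarrow> v < n" "u < n"
  shows "len u = deg n c u"
proof -
  let ?M = "mset (map (\<lambda>i. adj (u * D + i)) [0..<len u])"
  have c: "count ?M v = c u v" for v using assms(1,3) by (simp add: rows_def)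
  have "len u = size ?M" by simp
  also have "\<dots> = (\<Sum>v\<in>set_mset ?M. count ?M v)" by (rule size_multiset_overloaded_eq)
  also have "\<dots> = (\<Sum>v<n. count ?M v)"
  proof (rule sum.mono_neutral_left)
    show "set_mset ?M \<subseteq> {..<n}"
      using assms(2) c by (metis count_greater_zero_iff lessThan_iff subsetI)
    show "\<forall>v\<in>{..<n} - set_mset ?M. count ?M v = 0" by (auto simp only: not_in_iff Diff_iff)
  qed simp
  finally show ?thesis by (simp only: c deg_def)
qed

lemma rows_mem:
  assumes "rows n D c len adj" "u < n"
  shows "0 < c u v \<longleftrightarrow> (\<exists>i<len u. adj (u * D + i) = v)"
proof -
  let ?M = "mset (map (\<lambda>i. adj (u * D + i)) [0..<len u])"
  have "count ?M v = c u v" using assms by (simp add: rows_def)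
  hence "0 < c u v \<longleftrightarrow> v \<in># ?M" by (metis count_greater_zero_iff)
  thus ?thesis by auto
qed

lemma rows_add:
  assumes "rows n D c len adj" "x < n" "len x < D"
  shows "rows n D (upd c x y (Suc (c x y))) (len(x := Suc (len x))) (adj(x * D + len x := y))"
  unfolding rows_def
proof (intro allI impI)
  fix u assume u: "u < n"
  let ?adj = "adj(x * D + len x := y)"
  have old: "len u \<le> D" "\<And>v. count (mset (map (\<lambda>i. adj (u * D + i)) [0..<len u])) v = c u v"
    using assms(1) u by (auto simp: rows_def)
  have same: "map (\<lambda>i. ?adj (u * D + i)) [0..<len u] = map (\<lambda>i. adj (u * D + i)) [0..<len u]"
    by (rule map_cong) (use old assms(3) in \<open>auto simp: index_inject\<close>)
  show "(len(x := Suc (len x))) u \<le> D \<and> (\<forall>v. count (mset (map (\<lambda>i. ?adj (u * D + i))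
      [0..<(len(x := Suc (len x))) u])) v = (upd c x y (Suc (c x y))) u v)"
  proof (cases "u = x")
    case True
    have "map (\<lambda>i. ?adj (x * D + i)) [0..<Suc (len x)] = map (\<lambda>i. adj (x * D + i)) [0..<len x] @ [y]"
      using same unfolding True by (simp add: upt_Suc_append del: upt_Suc)
    thus ?thesis using old assms(3) unfolding True by (simp del: upt_Suc map_append)
  next
    case False
    show ?thesis unfolding fun_upd_other[OF False] same using old by blast
  qed
qed

lemma rows_remove:
  assumes "rows n D c len adj" "x < n" "i < len x" "adj (x * D + i) = y"
  shows "rows n D (upd c x y (c x y - 1)) (len(x := len x - 1)) (adj(x * D + i := adj (x * D + (len x - 1))))"
  unfolding rows_def
proof (intro allI impI)
  fix u assume u: "u < n"
  let ?adj = "adj(x * D + i := adj (x * D + (len x - 1)))"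
  have old: "len u \<le> D" "\<And>v. count (mset (map (\<lambda>i. adj (u * D + i)) [0..<len u])) v = c u v"
    using assms(1) u by (auto simp: rows_def)
  have iD: "i < D" using assms by (auto simp: rows_def intro: less_le_trans)
  show "(len(x := len x - 1)) u \<le> D \<and> (\<forall>v. count (mset (map (\<lambda>i. ?adj (u * D + i))
      [0..<(len(x := len x - 1)) u])) v = (upd c x y (c x y - 1)) u v)"
  proof (cases "u = x")
    case True
    obtain m where m: "len x = Suc m" using assms(3) by (cases "len x") auto
    let ?f = "\<lambda>i. adj (x * D + i)"
    have new: "map (\<lambda>j. ?adj (x * D + j)) [0..<m] = (map ?f [0..<m])[i := ?f m]"
      by (rule nth_equalityI) (auto simp: nth_list_update m)
    have "mset (map (\<lambda>j. ?adj (x * D + j)) [0..<m]) = mset (map ?f [0..<Suc m]) - {#y#}"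
    proof (cases "i < m")
      case True
      have "y \<in># mset (map ?f [0..<m])" using True assms(4) by auto
      thus ?thesis unfolding new using True assms(4) by (simp add: mset_update)
    next
      case False
      hence "i = m" using assms(3) m by simp
      thus ?thesis unfolding new using assms(4) by (simp add: list_update_beyond)
    qed
    hence "count (mset (map (\<lambda>j. ?adj (x * D + j)) [0..<m])) v = (if v = y then c x y - 1 else c x v)" for v
      using old(2)[of v] unfolding True m by (simp del: upt_Suc)
    thus ?thesis using old(1) unfolding True m by simp
  next
    case False
    have same: "map (\<lambda>i. ?adj (u * D + i)) [0..<len u] = map (\<lambda>i. adj (u * D + i)) [0..<len u]"
      by (rule map_cong) (use old iD False in \<open>auto simp: index_inject\<close>)
    show ?thesis unfolding fun_upd_other[OF False] same using old by blast
  qed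
qed

lemma key_iff: "d < Q \<Longrightarrow> k = w * Q + d \<longleftrightarrow> k div Q = w \<and> k mod Q = d" for k :: nat
  by auto

lemma bucket_upd:
  assumes "\<delta> x < Q" "x < n"
  shows "bucket n Q (upd c x y m) (\<lambda>_. \<delta>) = (bucket n Q c (\<lambda>_. \<delta>))(y * Q + \<delta> x :=
    if 0 < m then insert x (bucket n Q c (\<lambda>_. \<delta>) (y * Q + \<delta> x)) else bucket n Q c (\<lambda>_. \<delta>) (y * Q + \<delta> x) - {x})"
proof
  fix k
  show "bucket n Q (upd c x y m) (\<lambda>_. \<delta>) k = ((bucket n Q c (\<lambda>_. \<delta>))(y * Q + \<delta> x :=
    if 0 < m then insert x (bucket n Q c (\<lambda>_. \<delta>) (y * Q + \<delta> x)) else bucket n Q c (\<lambda>_. \<delta>) (y * Q + \<delta> x) - {x})) k"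
  proof (cases "k = y * Q + \<delta> x")
    case True
    thus ?thesis using assms by (auto simp: bucket_def)
  next
    case False
    hence "\<not> (k div Q = y \<and> k mod Q = \<delta> x)" using key_iff[OF assms(1)] by blast
    thus ?thesis using False by (auto simp: bucket_def)
  qed
qed

lemma majority_upd:
  fixes c :: "nat \<Rightarrow> nat \<Rightarrow> nat" and m :: nat
  assumes "x \<noteq> y" "x < n" "y < n"
  defines "c' \<equiv> upd c x y m"
  defines "A \<equiv> (majority n c)(x := if arc c' x y then insert y (majority n c x) else majority n c x - {y})"
  shows "majority n c' = A(y := if arc c' y x then insert x (A y) else A y - {x})"
proof
  fix u
  have "arc c' u v = arc c u v" if "(u, v) \<noteq> (x, y)" "(u, v) \<noteq> (y, x)" for v
    using that by (auto simp: arc_def c'_def)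
  note other = this
  show "majority n c' u = (A(y := if arc c' y x then insert x (A y) else A y - {x})) u"
  proof (rule set_eqI)
    fix v
    show "v \<in> majority n c' u \<longleftrightarrow> v \<in> (A(y := if arc c' y x then insert x (A y) else A y - {x})) u"
      using assms(1-3) other[of v]
      by (cases "(u, v) = (x, y)"; cases "(u, v) = (y, x)") (auto simp: majority_def A_def)
  qed
qed

section \<open>Adding and removing an arc\<close>

definition pair :: "expr" where "pair = Add (Mul (Reg ''x'') (Reg ''n'')) (Reg ''y'')"

definition row :: "expr \<Rightarrow> expr" where
  "row i = Add (Mul (Reg ''x'') (Reg ''D'')) i"

text \<open>The inner comparison has the form \<open>c v u < c u v + [u < v]\<close>, which merges
  the strict majority and the tie of \<open>arc\<close>.\<close>

definition refresh :: "name \<Rightarrow> name \<Rightarrow> com" where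
  "refresh u v = block
     [Assign ''k'' (Reg u), Assign ''e'' (Reg v),
      Cond (Mul (Less (Const 0) (Read ''cnt'' (slot (Reg ''e''))))
        (Less (Read ''cnt'' (Add (Mul (Reg ''e'') (Reg ''n'')) (Reg ''k'')))
          (Add (Read ''cnt'' (slot (Reg ''e''))) (Less (Reg ''k'') (Reg ''e'')))))
       (add_elem ''len'' ''adj'' ''spos'') (del_elem ''len'' ''adj'' ''spos'')]"

definition set_bucket :: "com" where
  "set_bucket = block
     [Assign ''k'' (Add (Mul (Reg ''y'') (Reg ''Q'')) (Read ''dg'' (Reg ''x''))), Assign ''e'' (Reg ''x''),
      Cond (Read ''cnt'' pair) (add_elem ''bsz'' ''bel'' ''bpos'') (del_elem ''bsz'' ''bel'' ''bpos'')]"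

definition push :: com where
  "push = block
     [Write ''madj'' (row (Read ''mlen'' (Reg ''x''))) (Reg ''y''),
      Write ''mlen'' (Reg ''x'') (clamp (Add (Read ''mlen'' (Reg ''x'')) (Const 1))),
      Write ''cnt'' pair (clamp (Add (Read ''cnt'' pair) (Const 1)))]"

text \<open>Lowering \<open>mlen\<close> first makes it the index of the last entry, which then
  moves into the hole at \<open>i\<close>.\<close>

definition pull :: com where
  "pull = block
     [Write ''mlen'' (Reg ''x'') (Sub (Read ''mlen'' (Reg ''x'')) (Const 1)),
      Write ''madj'' (row (Reg ''i'')) (Read ''madj'' (row (Read ''mlen'' (Reg ''x'')))),
      Write ''cnt'' pair (Sub (Read ''cnt'' pair) (Const 1))]"

text \<open>A changed multiplicity affects one bucket, but may turn the majority either way, so both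
  directions of the edge are refreshed.\<close>

definition sync :: com where
  "sync = block [set_bucket, refresh ''x'' ''y'', refresh ''y'' ''x'']"

definition add_arc :: com where
  "add_arc = block [push, sync]"

definition find_arc :: com where
  "find_arc = block [Assign ''i'' (Const 0),
     While (Equal (Equal (Read ''madj'' (row (Reg ''i''))) (Reg ''y'')) (Const 0))
       (Assign ''i'' (clamp (Add (Reg ''i'') (Const 1))))]"

definition del_arc :: com where
  "del_arc = block [find_arc, pull, sync]"

lemmas arc_code = pair_def row_def refresh_def set_bucket_def push_def pull_def sync_def
  add_arc_def find_arc_def del_arc_def slot_def

lemma arc_ops [simp]:
  "straight sync" "straight push" "straight pull" "straight (refresh u v)" "straight set_bucket" "straight add_arc"
  "assigned sync = {''k'', ''e'', ''l''}" "assigned add_arc = {''k'', ''e'', ''l''}"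
  "assigned (refresh u v) = {''k'', ''e'', ''l''}" "assigned set_bucket = {''k'', ''e'', ''l''}"
  "assigned push = {}" "assigned pull = {}"
  "assigned del_arc = {''i'', ''k'', ''e'', ''l''}"
  "safe add_arc" "safe del_arc"
  by (simp_all add: arc_code storable_clamp insert_commute)
    (simp_all add: storable_def reg_deg_def clamp_def)

lemma arc_times: "time sync \<le> 500" "time add_arc \<le> 600" "time pull \<le> 50"
proof -
  have a: "time (add_elem sz el pos) \<le> 100" "time (del_elem sz el pos) \<le> 100" for sz el pos by simp_all
  have m: "max (time (add_elem sz el pos)) (time (del_elem sz el pos)) \<le> 100" for sz el pos
    by (rule max.boundedI) (rule a)+
  have "time (refresh u v) \<le> 140" "time set_bucket \<le> 140" for u v
    unfolding refresh_def set_bucket_def block.simps time.simps cost_simps slot_def pair_def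
    using m[of "''len''" "''adj''" "''spos''"] m[of "''bsz''" "''bel''" "''bpos''"] by linarith+
  note this(2) this(1)[of "''x''" "''y''"] this(1)[of "''y''" "''x''"]
  thus "time sync \<le> 500" unfolding sync_def block.simps time.simps by linarith
  thus "time add_arc \<le> 600" by (simp add: add_arc_def push_def row_def pair_def clamp_def)
  show "time pull \<le> 50" by (simp add: pull_def row_def pair_def)
qed

lemma eff_refresh:
  assumes I: "iset n S (snd s ''len'') (snd s ''adj'') (snd s ''spos'')" and p: "params n b s" "b > 0"
    and u: "fst s u < n" "fst s v < n" "v \<noteq> ''k''"
    and c: "\<forall>u<n. \<forall>v<n. snd s ''cnt'' (u * n + v) = c u v"
  defines "s' \<equiv> eff (refresh u v) s"
  shows "iset n (S(fst s u := if arc c (fst s u) (fst s v) then insert (fst s v) (S (fst s u)) else S (fst s u) - {fst s v}))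
      (snd s' ''len'') (snd s' ''adj'') (snd s' ''spos'')"
    and "a \<notin> {''len'', ''adj'', ''spos''} \<Longrightarrow> snd s' a = snd s a"
proof -
  define s1 where "s1 = set_reg ''e'' (fst s v) (set_reg ''k'' (fst s u) s)"
  let ?g = "Mul (Less (Const 0) (Read ''cnt'' (slot (Reg ''e''))))
        (Less (Read ''cnt'' (Add (Mul (Reg ''e'') (Reg ''n'')) (Reg ''k'')))
          (Add (Read ''cnt'' (slot (Reg ''e''))) (Less (Reg ''k'') (Reg ''e''))))"
  have g: "val ?g s1 \<noteq> 0 \<longleftrightarrow> arc c (fst s u) (fst s v)"
    using u c p by (auto simp: s1_def slot_def params_def arc_def)
  have s': "s' = (if val ?g s1 \<noteq> 0 then eff (add_elem ''len'' ''adj'' ''spos'') s1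
      else eff (del_elem ''len'' ''adj'' ''spos'') s1)"
    using u(3) by (simp add: s'_def refresh_def s1_def)
  have I1: "iset n S (snd s1 ''len'') (snd s1 ''adj'') (snd s1 ''spos'')" using I by (simp add: s1_def)
  have r1: "fst s1 ''n'' = n" "fst s1 ''e'' < n" "n < fst s1 ''Q''" "fst s1 ''k'' = fst s u" "fst s1 ''e'' = fst s v"
    using p u by (auto simp: s1_def params_def)
  show "iset n (S(fst s u := if arc c (fst s u) (fst s v) then insert (fst s v) (S (fst s u)) else S (fst s u) - {fst s v}))
      (snd s' ''len'') (snd s' ''adj'') (snd s' ''spos'')"
    using eff_add_elem(1)[OF I1 r1(1-3)] eff_del_elem(1)[OF I1 r1(1,2)] unfolding s' g r1(4,5) by simp
  show "a \<notin> {''len'', ''adj'', ''spos''} \<Longrightarrow> snd s' a = snd s a"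
    unfolding s'_def by (rule eff_written) (simp add: refresh_def add_elem_def del_elem_def)
qed

lemma eff_set_bucket:
  assumes I: "iset n S (snd s ''bsz'') (snd s ''bel'') (snd s ''bpos'')" and p: "params n b s" "b > 0"
    and x: "fst s ''x'' < n" "fst s ''y'' < n"
    and c: "\<forall>u<n. \<forall>v<n. snd s ''cnt'' (u * n + v) = c u v"
  defines "s' \<equiv> eff set_bucket s" and "k \<equiv> fst s ''y'' * (4 * n * b) + snd s ''dg'' (fst s ''x'')"
  shows "iset n (S(k := if 0 < c (fst s ''x'') (fst s ''y'') then insert (fst s ''x'') (S k) else S k - {fst s ''x''}))
      (snd s' ''bsz'') (snd s' ''bel'') (snd s' ''bpos'')"
    and "a \<notin> {''bsz'', ''bel'', ''bpos''} \<Longrightarrow> snd s' a = snd s a"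
proof -
  define s1 where "s1 = set_reg ''e'' (fst s ''x'') (set_reg ''k'' k s)"
  have g: "val (Read ''cnt'' pair) s1 = c (fst s ''x'') (fst s ''y'')"
    using x c p by (auto simp: s1_def pair_def params_def)
  have s': "s' = (if val (Read ''cnt'' pair) s1 \<noteq> 0 then eff (add_elem ''bsz'' ''bel'' ''bpos'') s1
      else eff (del_elem ''bsz'' ''bel'' ''bpos'') s1)"
    using p by (simp add: s'_def set_bucket_def s1_def k_def params_def)
  have I1: "iset n S (snd s1 ''bsz'') (snd s1 ''bel'') (snd s1 ''bpos'')" using I by (simp add: s1_def)
  have r1: "fst s1 ''n'' = n" "fst s1 ''e'' < n" "n < fst s1 ''Q''" "fst s1 ''k'' = k" "fst s1 ''e'' = fst s ''x''"
    using p x by (auto simp: s1_def params_def)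
  show "iset n (S(k := if 0 < c (fst s ''x'') (fst s ''y'') then insert (fst s ''x'') (S k) else S k - {fst s ''x''}))
      (snd s' ''bsz'') (snd s' ''bel'') (snd s' ''bpos'')"
    using eff_add_elem(1)[OF I1 r1(1-3)] eff_del_elem(1)[OF I1 r1(1,2)] unfolding s' g r1(4,5) by simp
  show "a \<notin> {''bsz'', ''bel'', ''bpos''} \<Longrightarrow> snd s' a = snd s a"
    unfolding s'_def by (rule eff_written) (simp add: set_bucket_def add_elem_def del_elem_def)
qed

lemma params_cong: "params n b s \<Longrightarrow> (\<And>x. x \<in> {''n'', ''b'', ''D'', ''Q''} \<Longrightarrow> fst s' x = fst s x) \<Longrightarrow> params n b s'"
  by (simp add: params_def)

text \<open>After \<open>push\<close> or \<open>pull\<close> the rows and counters describe the new arcs, but the indexed sets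
  still describe the old ones.\<close>

lemma eff_sync:
  assumes p: "params n b s" "b > 0" and x: "fst s ''x'' = x" "fst s ''y'' = y" "x < n" "y < n" "x \<noteq> y"
    and \<delta>: "\<delta> x < 4 * n * b" and c': "c' = upd c x y m"
    and supp: "\<forall>u v. 0 < c' u v \<longrightarrow> u < n \<and> v < n"
    and rows: "rows n (n * b) c' (snd s ''mlen'') (snd s ''madj'')"
    and cnt: "\<forall>u<n. \<forall>v<n. snd s ''cnt'' (u * n + v) = c' u v"
    and dg: "\<forall>u<n. snd s ''dg'' u = \<delta> u"
    and B: "iset n (bucket n (4 * n * b) c (\<lambda>_. \<delta>)) (snd s ''bsz'') (snd s ''bel'') (snd s ''bpos'')"
    and A: "iset n (majority n c) (snd s ''len'') (snd s ''adj'') (snd s ''spos'')"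
  shows "repr n b c' \<delta> (eff sync s)"
proof -
  define s1 where "s1 = eff set_bucket s"
  define s2 where "s2 = eff (refresh ''x'' ''y'') s1"
  define s3 where "s3 = eff (refresh ''y'' ''x'') s2"
  have s3: "eff sync s = s3" by (simp add: sync_def s1_def s2_def s3_def)
  have xy: "fst s ''x'' < n" "fst s ''y'' < n" using x by simp_all
  note b1 = eff_set_bucket[OF B p xy cnt, folded s1_def]
  have f1: "fst s1 z = fst s z" if "z \<notin> {''k'', ''e'', ''l''}" for z
    using that eff_assigned[of z set_bucket s] by (simp add: s1_def)
  have xy1: "fst s1 ''x'' = x" "fst s1 ''y'' = y" using x by (simp_all add: f1)
  have p1: "params n b s1" by (rule params_cong[OF p(1)]) (auto simp: f1)
  have A1: "iset n (majority n c) (snd s1 ''len'') (snd s1 ''adj'') (snd s1 ''spos'')" using A by (simp add: b1(2))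
  have cnt1: "\<forall>u<n. \<forall>v<n. snd s1 ''cnt'' (u * n + v) = c' u v" using cnt by (simp add: b1(2))
  note r2 = eff_refresh[OF A1 p1 p(2) _ _ _ cnt1, of "''x''" "''y''", folded s2_def]
  have f2: "fst s2 z = fst s z" if "z \<notin> {''k'', ''e'', ''l''}" for z
    using that eff_assigned[of z "refresh ''x'' ''y''" s1] by (simp add: s2_def f1)
  have xy2: "fst s2 ''x'' = x" "fst s2 ''y'' = y" using x by (simp_all add: f2)
  have p2: "params n b s2" by (rule params_cong[OF p(1)]) (auto simp: f2)
  have w2: "snd s2 a = snd s1 a" if "a \<notin> {''len'', ''adj'', ''spos''}" for a
    using r2(2)[OF _ _ _ that] x by (simp add: f1)
  have cnt2: "\<forall>u<n. \<forall>v<n. snd s2 ''cnt'' (u * n + v) = c' u v" using cnt1 by (simp add: w2)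
  have A2: "iset n ((majority n c)(x := if arc c' x y then insert y (majority n c x) else majority n c x - {y}))
      (snd s2 ''len'') (snd s2 ''adj'') (snd s2 ''spos'')"
    by (rule r2(1)[unfolded xy1, OF x(3,4)]) simp
  note r3 = eff_refresh[OF A2 p2 p(2) _ _ _ cnt2, of "''y''" "''x''", folded s3_def]
  have f3: "fst s3 z = fst s z" if "z \<notin> {''k'', ''e'', ''l''}" for z
    using that eff_assigned[of z "refresh ''y'' ''x''" s2] by (simp add: s3_def f2)
  have p3: "params n b s3" by (rule params_cong[OF p(1)]) (auto simp: f3)
  have w3: "snd s3 a = snd s1 a" if "a \<notin> {''len'', ''adj'', ''spos''}" for a
    using r3(2)[OF _ _ _ that] x that by (simp add: f2 w2)
  have A3: "iset n (majority n c') (snd s3 ''len'') (snd s3 ''adj'') (snd s3 ''spos'')"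
    unfolding majority_upd[OF x(5,3,4), of c m, folded c'] by (rule r3(1)[unfolded xy2, OF x(4,3)]) simp
  have B3: "iset n (bucket n (4 * n * b) c' (\<lambda>_. \<delta>)) (snd s3 ''bsz'') (snd s3 ''bel'') (snd s3 ''bpos'')"
    using b1(1) unfolding x(1,2) dg[rule_format, OF x(3)] c' bucket_upd[where \<delta> = \<delta>, OF \<delta> x(3)]
    by (simp add: w3)
  show ?thesis unfolding s3 repr_def
    using p3 supp rows cnt dg A3 B3 by (simp add: w3 b1(2))
qed

lemma eff_add_arc:
  assumes R: "repr n b c \<delta> s" "b > 0" and x: "fst s ''x'' = x" "fst s ''y'' = y" "x < n" "y < n" "x \<noteq> y"
    and \<delta>: "\<delta> x < 4 * n * b" and d: "deg n c x < n * b"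
  shows "repr n b (upd c x y (Suc (c x y))) \<delta> (eff add_arc s)"
proof -
  define s1 where "s1 = eff push s"
  have p: "params n b s" using R by (simp add: repr_def)
  have rows: "rows n (n * b) c (snd s ''mlen'') (snd s ''madj'')" using R by (simp add: repr_def)
  have cnt: "\<forall>u<n. \<forall>v<n. snd s ''cnt'' (u * n + v) = c u v" using R by (simp add: repr_def)
  have supp: "\<And>u v. 0 < c u v \<Longrightarrow> u < n \<and> v < n" using R by (auto simp: repr_def)
  have len: "snd s ''mlen'' x = deg n c x" by (rule rows_size[OF rows _ x(3)]) (use supp in blast)
  have "c x y \<le> deg n c x" unfolding deg_def by (rule member_le_sum) (use x in auto)
  hence s1: "s1 = (fst s, (snd s)(''madj'' := (snd s ''madj'')(x * (n * b) + snd s ''mlen'' x := y),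
      ''mlen'' := (snd s ''mlen'')(x := Suc (snd s ''mlen'' x)),
      ''cnt'' := (snd s ''cnt'')(x * n + y := Suc (c x y))))"
    using x d p cnt by (auto simp: s1_def push_def row_def pair_def clamp_def len params_def set_cell_def)
  have "repr n b (upd c x y (Suc (c x y))) \<delta> (eff sync s1)"
  proof (rule eff_sync[where \<delta> = \<delta> and c = c and m = "Suc (c x y)" and x = x and y = y and c' = "upd c x y (Suc (c x y))", OF _ R(2) _ _ x(3-5) \<delta> refl])
    show "rows n (n * b) (upd c x y (Suc (c x y))) (snd s1 ''mlen'') (snd s1 ''madj'')"
      using rows_add[OF rows x(3), of y] d by (simp add: s1 len)
    show "\<forall>u<n. \<forall>v<n. snd s1 ''cnt'' (u * n + v) = (upd c x y (Suc (c x y))) u v"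
      using cnt x by (auto simp: s1 index_inject)
  qed (use R x supp in \<open>auto simp: s1 repr_def params_def split: if_splits\<close>)
  thus ?thesis by (simp add: add_arc_def s1_def)
qed

text \<open>The search for \<open>y\<close> in the row of \<open>x\<close> is the only part whose
  cost is not constant; it ends within the row because a copy is present.\<close>

lemma runs_del_arc:
  assumes R: "repr n b c \<delta> s" "b > 0" and x: "fst s ''x'' = x" "fst s ''y'' = y" "x < n" "y < n" "x \<noteq> y"
    and \<delta>: "\<delta> x < 4 * n * b" and c: "0 < c x y"
  shows "runs del_arc s (1000 * (deg n c x + 1)) (repr n b (upd c x y (c x y - 1)) \<delta>)"
proof -
  have p: "params n b s" using R by (simp add: repr_def)
  have rows: "rows n (n * b) c (snd s ''mlen'') (snd s ''madj'')" using R by (simp add: repr_def)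
  have cnt: "\<forall>u<n. \<forall>v<n. snd s ''cnt'' (u * n + v) = c u v" using R by (simp add: repr_def)
  have supp: "\<And>u v. 0 < c u v \<Longrightarrow> u < n \<and> v < n" using R by (auto simp: repr_def)
  have len: "snd s ''mlen'' x = deg n c x" by (rule rows_size[OF rows _ x(3)]) (use supp in blast)
  define P where "P = (\<lambda>i. snd s ''madj'' (x * (n * b) + i) = y)"
  have "\<exists>i<snd s ''mlen'' x. P i" using rows_mem[OF rows x(3)] c by (auto simp: P_def)
  then obtain i0 where i0: "i0 < deg n c x" "P i0" by (auto simp: len)
  define i where "i = (LEAST i. P i)"
  have i: "P i" "\<And>j. j < i \<Longrightarrow> \<not> P j" "i < deg n c x"
    unfolding i_def using LeastI[of P, OF i0(2)] not_less_Least le_less_trans[OF Least_le[of P, OF i0(2)] i0(1)]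
    by blast+
  have "deg n c x \<le> n * b" using rows x by (auto simp: rows_def simp flip: len)
  hence Q: "i < fst s ''Q''" using i(3) p by (simp add: params_def)
  have find: "runs find_arc s ((i + 1) * (cost (Equal (Equal (Read ''madj'' (row (Reg ''i''))) (Reg ''y'')) (Const 0)) + 15))
     (\<lambda>s'. s' = set_reg ''i'' i s)"
    unfolding find_arc_def
    by (rule runs_scan) (use i Q x p in \<open>auto simp: P_def row_def params_def\<close>)
  define s1 where "s1 = eff pull (set_reg ''i'' i s)"
  have s1: "s1 = ((fst s)(''i'' := i), (snd s)(
      ''mlen'' := (snd s ''mlen'')(x := snd s ''mlen'' x - 1),
      ''madj'' := (snd s ''madj'')(x * (n * b) + i := snd s ''madj'' (x * (n * b) + (snd s ''mlen'' x - 1))),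
      ''cnt'' := (snd s ''cnt'')(x * n + y := c x y - 1)))"
    using x p cnt by (auto simp: s1_def pull_def row_def pair_def params_def set_cell_def)
  have rep: "repr n b (upd c x y (c x y - 1)) \<delta> (eff sync s1)"
  proof (rule eff_sync[where \<delta> = \<delta> and c = c and m = "c x y - 1" and x = x and y = y and c' = "upd c x y (c x y - 1)", OF _ R(2) _ _ x(3-5) \<delta> refl])
    show "rows n (n * b) (upd c x y (c x y - 1)) (snd s1 ''mlen'') (snd s1 ''madj'')"
      using rows_remove[OF rows x(3), of i y] i by (simp add: s1 len P_def)
    show "\<forall>u<n. \<forall>v<n. snd s1 ''cnt'' (u * n + v) = (upd c x y (c x y - 1)) u v"
      using cnt x by (auto simp: s1 index_inject)
  qed (use R x supp c in \<open>auto simp: s1 repr_def params_def split: if_splits\<close>)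
  have rest: "runs (block [pull, sync]) (set_reg ''i'' i s) 551 (repr n b (upd c x y (c x y - 1)) \<delta>)"
    by (rule runs_straight) (use rep arc_times in \<open>auto simp: s1_def\<close>)
  have "(i + 1) * (cost (Equal (Equal (Read ''madj'' (row (Reg ''i''))) (Reg ''y'')) (Const 0)) + 15) \<le> 100 * (i + 1)"
    by (simp add: row_def)
  hence "(i + 1) * (cost (Equal (Equal (Read ''madj'' (row (Reg ''i''))) (Reg ''y'')) (Const 0)) + 15) + 551
      \<le> 1000 * (deg n c x + 1)" using i(3) by simp
  thus ?thesis unfolding del_arc_def block.simps(2)[of find_arc]
    by (intro runs_Seq[OF runs_mono[OF find order_refl]]) (use rest in auto)
qed

lemma runs_Cons:
  "runs c s T1 (\<lambda>s'. runs (block cs) s' T2 Q) \<Longrightarrow> T1 + T2 \<le> T \<Longrightarrow> runs (block (c # cs)) s T Q"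
  unfolding block.simps by (rule runs_Seq)

lemma runs_Cons_straight:
  "straight c \<Longrightarrow> runs (block cs) (eff c s) T Q \<Longrightarrow> time c + T \<le> T' \<Longrightarrow> runs (block (c # cs)) s T' Q"
  by (rule runs_Cons[OF runs_straight]) auto

lemma runs_Nil: "Q s \<Longrightarrow> 1 \<le> T \<Longrightarrow> runs (block []) s T Q"
  by (auto intro: runs_straight)

lemma repr_regs:
  "repr n b c \<delta> s \<Longrightarrow> snd s' = snd s \<Longrightarrow> (\<And>x. x \<in> {''n'', ''b'', ''D'', ''Q''} \<Longrightarrow> fst s' x = fst s x) \<Longrightarrow>
    repr n b c \<delta> s'"
  using params_cong[of n b s s'] by (simp add: repr_def)

lemma repr_deg: "repr n b c \<delta> s \<Longrightarrow> u < n \<Longrightarrow> snd s ''mlen'' u = deg n c u"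
  by (rule rows_size[of n "n * b" c _ "snd s ''madj''"]) (auto simp: repr_def)

lemma repr_row_mem:
  "repr n b c \<delta> s \<Longrightarrow> u < n \<Longrightarrow> 0 < c u v \<longleftrightarrow> (\<exists>i<deg n c u. snd s ''madj'' (u * (n * b) + i) = v)"
  using rows_mem[of n "n * b" c "snd s ''mlen''" "snd s ''madj''" u v] repr_deg[of n b c \<delta> s u]
  by (simp add: repr_def)

section \<open>Propagating a changed out-degree to the buckets\<close>

definition row_key :: "expr \<Rightarrow> expr" where
  "row_key d = Add (Mul (Read ''madj'' (row (Reg ''i''))) (Reg ''Q'')) d"

definition move :: com where
  "move = block
     [Assign ''k'' (row_key (Read ''dg'' (Reg ''x''))), del_elem ''bsz'' ''bel'' ''bpos'',
      Assign ''k'' (row_key (Read ''mlen'' (Reg ''x''))), add_elem ''bsz'' ''bel'' ''bpos'',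
      Assign ''i'' (clamp (Add (Reg ''i'') (Const 1)))]"

definition notify :: com where
  "notify = block
     [Assign ''e'' (Reg ''x''), Assign ''i'' (Const 0),
      While (Less (Reg ''i'') (Read ''mlen'' (Reg ''x''))) move,
      Write ''dg'' (Reg ''x'') (Read ''mlen'' (Reg ''x''))]"

lemma notify_ops [simp]:
  "assigned notify = {''k'', ''e'', ''l'', ''i''}" "safe notify"
  "straight move" "assigned move = {''k'', ''l'', ''i''}"
  by (auto simp: notify_def move_def row_key_def row_def storable_clamp)
    (simp_all add: storable_def reg_deg_def clamp_def)

text \<open>A row lists a head once per copy, so \<open>x\<close> may already have been moved when
  the same head comes up again; the alternative \<open>\<beta> w x = new\<close> covers
  this.\<close>

lemma bucket_move:
  assumes "x < n" "0 < c x w" "old < Q" "new < Q" "\<beta> w x = old \<or> \<beta> w x = new"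
  defines "B \<equiv> (bucket n Q c \<beta>)(w * Q + old := bucket n Q c \<beta> (w * Q + old) - {x})"
  shows "B(w * Q + new := insert x (B (w * Q + new))) = bucket n Q c (\<beta>(w := (\<beta> w)(x := new)))"
proof (intro ext set_eqI)
  fix k z
  show "z \<in> (B(w * Q + new := insert x (B (w * Q + new)))) k \<longleftrightarrow> z \<in> bucket n Q c (\<beta>(w := (\<beta> w)(x := new))) k"
    using assms(1-5) key_iff[OF assms(3), of k w] key_iff[OF assms(4), of k w]
    by (cases "z = x"; cases "k div Q = w"; cases "k mod Q = new"; cases "k mod Q = old")
      (auto simp: B_def bucket_def)
qed

lemma runs_notify:
  assumes R: "repr n b c \<delta> s" "b > 0" and x: "fst s ''x'' = x" "x < n" and \<delta>: "\<delta> x < 4 * n * b"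
  shows "runs notify s (500 * (deg n c x + 1)) (repr n b c (\<delta>(x := deg n c x)))"
proof -
  let ?Q = "4 * n * b"
  define m where "m = deg n c x"
  define w where "w = (\<lambda>j. snd s ''madj'' (x * (n * b) + j))"
  \<comment> \<open>Heads in the first \<open>j\<close> cells already see the new degree of
    \<open>x\<close>. A degree that depends on the observing vertex is what \<open>bucket\<close>
    provides for.\<close>
  define \<beta> where "\<beta> = (\<lambda>j u z. if z = x \<and> u \<in> w ` {..<j} then m else \<delta> z)"
  define I where "I = (\<lambda>k s'. k \<le> m \<and> params n b s' \<and> fst s' ''x'' = x \<and> fst s' ''e'' = x \<and> fst s' ''i'' = m - k \<and>
    (\<forall>a. a \<notin> {''bsz'', ''bel'', ''bpos''} \<longrightarrow> snd s' a = snd s a) \<and>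
    iset n (bucket n ?Q c (\<beta> (m - k))) (snd s' ''bsz'') (snd s' ''bel'') (snd s' ''bpos''))"
  have p: "params n b s" using R by (simp add: repr_def)
  have len: "snd s ''mlen'' x = m" using repr_deg[OF R(1) x(2)] by (simp add: m_def)
  have "m \<le> n * b" using R(1) x by (auto simp: repr_def rows_def simp flip: len)
  moreover have "0 < n * b" using x R(2) by simp
  ultimately have m: "m < ?Q" "Suc m < ?Q" by linarith+
  have wpos: "0 < c x (w j)" if "j < m" for j
    using repr_row_mem[OF R(1) x(2), of "w j"] that by (auto simp: w_def m_def)
  have init: "I m (set_reg ''i'' 0 (set_reg ''e'' x s))"
  proof -
    have "\<beta> 0 = (\<lambda>_. \<delta>)" by (auto simp: \<beta>_def)
    thus ?thesis using R(1) x p by (simp add: I_def repr_def params_def)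
  qed
  have loop: "runs (While (Less (Reg ''i'') (Read ''mlen'' (Reg ''x''))) move) (set_reg ''i'' 0 (set_reg ''e'' x s))
      ((m + 1) * (1 + cost (Less (Reg ''i'') (Read ''mlen'' (Reg ''x''))) + 260))
      (\<lambda>s'. \<exists>k'. I k' s' \<and> val (Less (Reg ''i'') (Read ''mlen'' (Reg ''x''))) s' = 0)"
  proof (rule runs_While[of I, OF _ init])
    fix k s' assume I: "I k s'" and v: "val (Less (Reg ''i'') (Read ''mlen'' (Reg ''x''))) s' \<noteq> 0"
    define j where "j = m - k"
    have r: "params n b s'" "fst s' ''x'' = x" "fst s' ''e'' = x" "fst s' ''i'' = j"
      and a: "\<And>a. a \<notin> {''bsz'', ''bel'', ''bpos''} \<Longrightarrow> snd s' a = snd s a"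
      and B: "iset n (bucket n ?Q c (\<beta> j)) (snd s' ''bsz'') (snd s' ''bel'') (snd s' ''bpos'')"
      using I by (auto simp: I_def j_def)
    have k: "0 < k" "k \<le> m" "j < m" using v I by (auto simp: I_def j_def len split: if_splits)
    define s1 where "s1 = set_reg ''k'' (w j * ?Q + \<delta> x) s'"
    define s2 where "s2 = eff (del_elem ''bsz'' ''bel'' ''bpos'') s1"
    define s3 where "s3 = set_reg ''k'' (w j * ?Q + m) s2"
    define s4 where "s4 = eff (add_elem ''bsz'' ''bel'' ''bpos'') s3"
    have dg: "snd s ''dg'' x = \<delta> x" using R(1) x by (simp add: repr_def)
    have f1: "fst s1 ''n'' = n" "fst s1 ''e'' < n" "fst s1 ''k'' = w j * ?Q + \<delta> x" "fst s1 ''e'' = x"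
      using r x by (auto simp: s1_def params_def)
    have fs2: "fst s2 z = fst s1 z" if "z \<noteq> ''l''" for z unfolding s2_def by (rule eff_assigned) (use that in simp)
    have a2: "snd s2 a = snd s1 a" if "a \<notin> {''bsz'', ''bel'', ''bpos''}" for a
      unfolding s2_def by (rule eff_written) (use that in \<open>simp add: del_elem_def\<close>)
    have B1: "iset n (bucket n ?Q c (\<beta> j)) (snd s1 ''bsz'') (snd s1 ''bel'') (snd s1 ''bpos'')"
      using B by (simp add: s1_def)
    note B2 = eff_del_elem(1)[OF B1 f1(1,2), folded s2_def, unfolded f1(3,4)]
    have f3: "fst s3 ''n'' = n" "fst s3 ''e'' < n" "n < fst s3 ''Q''" "fst s3 ''k'' = w j * ?Q + m" "fst s3 ''e'' = x"
      using r x R(2) by (auto simp: s3_def fs2 s1_def params_def)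
    have "iset n ((bucket n ?Q c (\<beta> j))(w j * ?Q + \<delta> x := bucket n ?Q c (\<beta> j) (w j * ?Q + \<delta> x) - {x}))
       (snd s3 ''bsz'') (snd s3 ''bel'') (snd s3 ''bpos'')" using B2 by (simp add: s3_def)
    note B3 = eff_add_elem(1)[OF this f3(1-3), folded s4_def, unfolded f3(4,5)]
    have "\<beta> j (w j) x = \<delta> x \<or> \<beta> j (w j) x = m" by (simp add: \<beta>_def)
    note eq = bucket_move[of x n c "w j" "\<delta> x" ?Q m "\<beta> j", OF x(2) wpos[OF k(3)] \<delta> m(1) this]
    have B4: "iset n (bucket n ?Q c ((\<beta> j)(w j := (\<beta> j (w j))(x := m)))) (snd s4 ''bsz'') (snd s4 ''bel'') (snd s4 ''bpos'')"
      unfolding eq[symmetric] by (rule B3) simp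
    have "(\<beta> j)(w j := (\<beta> j (w j))(x := m)) = \<beta> (Suc j)"
      by (auto simp: \<beta>_def fun_eq_iff lessThan_Suc)
    note B4 = B4[unfolded this]
    have fs4: "fst s4 z = fst s3 z" for z unfolding s4_def by (rule eff_assigned) simp
    have a4: "snd s4 a = snd s' a" if "a \<notin> {''bsz'', ''bel'', ''bpos''}" for a
    proof -
      have "snd s4 a = snd s3 a" unfolding s4_def by (rule eff_written) (use that in \<open>simp add: add_elem_def\<close>)
      thus ?thesis using that by (simp add: s3_def a2 s1_def)
    qed
    have "eff move s' = set_reg ''i'' (Suc j) s4"
    proof -
      have 1: "eff (Assign ''k'' (row_key (Read ''dg'' (Reg ''x'')))) s' = s1"
        using r dg by (simp add: s1_def row_key_def row_def params_def a w_def)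
      have 2: "eff (Assign ''k'' (row_key (Read ''mlen'' (Reg ''x'')))) s2 = s3"
        using r by (simp add: s3_def row_key_def row_def fs2 a2 s1_def params_def a w_def len)
      have 3: "eff (Assign ''i'' (clamp (Add (Reg ''i'') (Const 1)))) s4 = set_reg ''i'' (Suc j) s4"
        using r m k(3) by (simp add: clamp_def fs4 s3_def fs2 s1_def params_def)
      show ?thesis unfolding move_def block.simps eff.simps(3) 1 s2_def[symmetric] 2 s4_def[symmetric] 3 by simp
    qed
    hence "I (k - 1) (eff move s')"
      using k r B4 a by (auto simp: I_def j_def Suc_diff_le a4 fs4 s3_def fs2 s1_def params_def)
    moreover have "time move \<le> 260"
    proof -
      have "time (del_elem ''bsz'' ''bel'' ''bpos'') \<le> 100" "time (add_elem ''bsz'' ''bel'' ''bpos'') \<le> 100" by simp_all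
      thus ?thesis unfolding move_def block.simps time.simps row_key_def row_def clamp_def cost_simps by linarith
    qed
    ultimately have "runs move s' 260 (I (k - 1))" by (intro runs_straight) simp_all
    thus "\<exists>k'<k. runs move s' 260 (I k')" using k by (intro exI[of _ "k - 1"]) auto
  qed
  have finished: "repr n b c (\<delta>(x := m)) (eff (Write ''dg'' (Reg ''x'') (Read ''mlen'' (Reg ''x''))) s')"
    if I: "I k s'" and v: "val (Less (Reg ''i'') (Read ''mlen'' (Reg ''x''))) s' = 0" for k s'
  proof -
    have k: "k = 0" using I v by (auto simp: I_def len split: if_splits)
    \<comment> \<open>The two families differ only at vertices that receive no arc from
      \<open>x\<close>, and there \<open>x\<close> is in no bucket.\<close>
    have "bucket n ?Q c (\<beta> m) = bucket n ?Q c (\<lambda>_. \<delta>(x := m))"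
    proof (intro ext set_eqI)
      fix k z
      have "0 < c x (k div ?Q) \<Longrightarrow> k div ?Q \<in> w ` {..<m}"
        using repr_row_mem[OF R(1) x(2), of "k div ?Q"] unfolding w_def m_def by (metis imageI lessThan_iff)
      thus "z \<in> bucket n ?Q c (\<beta> m) k \<longleftrightarrow> z \<in> bucket n ?Q c (\<lambda>_. \<delta>(x := m)) k"
        by (auto simp: bucket_def \<beta>_def)
    qed
    thus ?thesis using I R(1) unfolding k by (auto simp: I_def repr_def params_def len)
  qed
  have "runs (block [Write ''dg'' (Reg ''x'') (Read ''mlen'' (Reg ''x''))]) s' 10 (repr n b c (\<delta>(x := m)))"
    if "I k s'" "val (Less (Reg ''i'') (Read ''mlen'' (Reg ''x''))) s' = 0" for k s'
    by (rule runs_straight) (use finished[OF that] in simp_all)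
  note wr = this
  have loop': "runs (While (Less (Reg ''i'') (Read ''mlen'' (Reg ''x''))) move) (set_reg ''i'' 0 (set_reg ''e'' x s))
      (265 * (m + 1)) (\<lambda>s'. runs (block [Write ''dg'' (Reg ''x'') (Read ''mlen'' (Reg ''x''))]) s' 10 (repr n b c (\<delta>(x := m))))"
    by (rule runs_mono[OF loop]) (auto simp del: block.simps intro: wr)
  have loop2: "runs (block [While (Less (Reg ''i'') (Read ''mlen'' (Reg ''x''))) move,
        Write ''dg'' (Reg ''x'') (Read ''mlen'' (Reg ''x''))]) (set_reg ''i'' 0 (set_reg ''e'' x s)) (275 * (m + 1))
        (repr n b c (\<delta>(x := m)))"
    by (rule runs_Cons[OF loop']) simp
  show ?thesis unfolding notify_def m_def[symmetric]
  proof (rule runs_Cons_straight)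
    show "runs (block [Assign ''i'' (Const 0), While (Less (Reg ''i'') (Read ''mlen'' (Reg ''x''))) move,
        Write ''dg'' (Reg ''x'') (Read ''mlen'' (Reg ''x''))]) (eff (Assign ''e'' (Reg ''x'')) s) (490 * (m + 1))
        (repr n b c (\<delta>(x := m)))"
      by (rule runs_Cons_straight[where T = "275 * (m + 1)"]) (use loop2 x in \<open>simp_all del: block.simps\<close>)
  qed simp_all
qed

lemma runs_single: "runs c s T Q \<Longrightarrow> runs (block [c]) s (T + 1) Q"
  by (rule runs_Cons[where ?T2.0 = 1, OF runs_mono[OF _ order_refl runs_Nil]]) auto

section \<open>Chains of flips\<close>

text \<open>The quotient vanishes exactly when \<open>2 * d < b\<close>, so adding the truth value
  of this comparison has the effect of \<open>max 1\<close>.\<close>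

definition thrE :: "expr \<Rightarrow> expr" where
  "thrE d = Add d (Add (Div (Mul (Const 2) d) (Reg ''b'')) (Less (Mul (Const 2) d) (Reg ''b'')))"

lemma val_thrE: "fst s ''b'' = b \<Longrightarrow> b > 0 \<Longrightarrow> val (thrE d) s = thr b (val d s)"
proof -
  assume b: "fst s ''b'' = b" "b > 0"
  show ?thesis
  proof (cases "2 * val d s < b")
    case False
    hence "1 \<le> 2 * val d s div b" using b by (simp add: div_greater_zero_iff Suc_le_eq)
    thus ?thesis using False b by (simp add: thrE_def thr_def max_def)
  qed (use b in \<open>simp add: thrE_def thr_def\<close>)
qed

section \<open>Reversing one copy\<close>

definition flipped :: "(nat \<Rightarrow> nat \<Rightarrow> nat) \<Rightarrow> nat \<Rightarrow> nat \<Rightarrow> nat \<Rightarrow> nat \<Rightarrow> nat" where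
  "flipped c x y = upd (upd c x y (c x y - 1)) y x (Suc (c y x))"

lemma deg_upd: "y < n \<Longrightarrow> deg n (upd c x y m) = (deg n c)(x := deg n c x - c x y + m)"
proof
  fix u assume y: "y < n"
  have "(\<Sum>v<n. ((c x)(y := m)) v) = m + (\<Sum>v\<in>{..<n} - {y}. c x v)"
    using y by (subst sum.remove[of _ y]) auto
  moreover have "(\<Sum>v<n. c x v) = c x y + (\<Sum>v\<in>{..<n} - {y}. c x v)"
    using y by (subst sum.remove[of _ y]) auto
  ultimately show "deg n (upd c x y m) u = ((deg n c)(x := deg n c x - c x y + m)) u"
    by (simp add: deg_def)
qed

lemma le_deg: "y < n \<Longrightarrow> c x y \<le> deg n c x"
  unfolding deg_def by (rule member_le_sum) auto

lemma deg_flipped: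
  assumes "x \<noteq> y" "x < n" "y < n" "0 < c x y"
  shows "deg n (flipped c x y) = (deg n c)(x := deg n c x - 1, y := Suc (deg n c y))"
proof -
  define c1 where "c1 = upd c x y (c x y - 1)"
  have "deg n c1 = (deg n c)(x := deg n c x - 1)"
    using assms le_deg[of y n c x] by (simp add: c1_def deg_upd)
  moreover have "flipped c x y = upd c1 y x (Suc (c1 y x))"
    using assms by (simp add: flipped_def c1_def)
  moreover have "c1 y x \<le> deg n c1 y" by (rule le_deg[OF assms(2)])
  ultimately show ?thesis using assms by (simp add: deg_upd)
qed

lemma flipped_sum:
  "x \<noteq> y \<Longrightarrow> 0 < c x y \<Longrightarrow> flipped c x y u v + flipped c x y v u = c u v + c v u"
  by (auto simp: flipped_def)

lemma fairc_flipped: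
  assumes "fairc b c \<delta>" "\<delta> y \<le> thr b (\<delta> x)"
  shows "fairc b (flipped c x y) \<delta>"
  using assms by (auto simp: fairc_def flipped_def split: if_splits)

definition flip :: com where
  "flip = block [del_arc, Assign ''z'' (Reg ''x''), Assign ''x'' (Reg ''y''), Assign ''y'' (Reg ''z''), add_arc]"

lemma flip_ops [simp]:
  "assigned flip = {''i'', ''k'', ''e'', ''l'', ''x'', ''y'', ''z''}" "safe flip"
  by (auto simp: flip_def storable_def reg_deg_def)

text \<open>The buckets are keyed by \<open>\<delta>\<close>, which a flip leaves alone, so only
  sets that record this one pair change. The cost is dominated by removing the arc from the row of
  \<open>x\<close>.\<close>

lemma runs_flip:
  assumes R: "repr n b c \<delta> s" "b > 0" and x: "fst s ''x'' = x" "fst s ''y'' = y" "x < n" "y < n" "x \<noteq> y"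
    and \<delta>: "\<delta> x < 4 * n * b" "\<delta> y < 4 * n * b" and c: "0 < c x y" and d: "deg n c y < n * b"
  shows "runs flip s (1700 * (deg n c x + 1)) (\<lambda>s'. repr n b (flipped c x y) \<delta> s' \<and> fst s' ''x'' = y \<and> fst s' ''y'' = x)"
  unfolding flip_def
proof (rule runs_Cons[OF runs_mono[OF runs_frame[OF runs_del_arc[OF R x \<delta>(1) c]] order_refl]])
  fix s' assume s': "repr n b (upd c x y (c x y - 1)) \<delta> s' \<and> (\<forall>z. z \<notin> assigned del_arc \<longrightarrow> fst s' z = fst s z)"
  define s1 where "s1 = set_reg ''y'' x (set_reg ''x'' y (set_reg ''z'' x s'))"
  have R1: "repr n b (upd c x y (c x y - 1)) \<delta> s1"
    by (rule repr_regs[of _ _ _ _ s']) (use s' in \<open>auto simp: s1_def\<close>)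
  have "deg n (upd c x y (c x y - 1)) y < n * b" using x d by (simp add: deg_upd)
  note a = eff_add_arc[OF R1 R(2) _ _ x(4,3) x(5)[symmetric] \<delta>(2) this]
  have "repr n b (flipped c x y) \<delta> (eff add_arc s1)"
    using a x by (simp add: s1_def flipped_def)
  moreover have "fst (eff add_arc s1) ''x'' = y" "fst (eff add_arc s1) ''y'' = x"
    by (simp_all add: eff_assigned s1_def)
  moreover have "eff (block [Assign ''z'' (Reg ''x''), Assign ''x'' (Reg ''y''), Assign ''y'' (Reg ''z''), add_arc]) s'
      = eff add_arc s1" using s' x by (simp add: s1_def)
  ultimately show "runs (block [Assign ''z'' (Reg ''x''), Assign ''x'' (Reg ''y''), Assign ''y'' (Reg ''z''), add_arc]) s' 620
     (\<lambda>s'. repr n b (flipped c x y) \<delta> s' \<and> fst s' ''x'' = y \<and> fst s' ''y'' = x)"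
    using arc_times(2) by (intro runs_straight) simp_all
qed simp

text \<open>The vertex in the register \<open>c\<close> is the only one whose out-degree differs from the value
  \<open>\<delta>\<close> recorded in memory, by one.\<close>

definition midway :: "nat \<Rightarrow> nat \<Rightarrow> nat \<Rightarrow> (nat \<Rightarrow> nat \<Rightarrow> nat) \<Rightarrow> (nat \<Rightarrow> nat) \<Rightarrow>
    (nat \<Rightarrow> nat) \<Rightarrow> (nat \<Rightarrow> nat \<Rightarrow> nat) \<Rightarrow> state \<Rightarrow> bool" where
  "midway n b \<Delta> m \<delta> d c s \<longleftrightarrow> repr n b c \<delta> s \<and> fst s ''c'' < n \<and> fairc b c \<delta> \<and>
     deg n c = \<delta>(fst s ''c'' := d (\<delta> (fst s ''c''))) \<and> d (\<delta> (fst s ''c'')) \<noteq> \<delta> (fst s ''c'') \<and>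
     (\<forall>u v. c u v + c v u = m u v) \<and>
     (\<forall>u. m u u = 0) \<and> (\<forall>u. \<delta> u \<le> \<Delta> \<and> \<delta> u < n * b)"

lemma midway_D:
  assumes "midway n b \<Delta> m \<delta> d c s"
  shows "repr n b c \<delta> s" "fst s ''c'' < n" "fairc b c \<delta>" "deg n c = \<delta>(fst s ''c'' := d (\<delta> (fst s ''c'')))"
    "c u v + c v u = m u v" "m u u = 0" "c u u = 0" "\<delta> u \<le> \<Delta>" "\<delta> u < n * b"
    "fst s ''b'' = b" "fst s ''D'' = n * b" "fst s ''Q'' = 4 * n * b" "fst s ''n'' = n" "d (\<delta> (fst s ''c'')) \<noteq> \<delta> (fst s ''c'')"
    "u < n \<Longrightarrow> snd s ''mlen'' u = deg n c u" "u < n \<Longrightarrow> snd s ''dg'' u = \<delta> u" "0 < c u v \<Longrightarrow> u < n \<and> v < n"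
  using assms repr_deg[of n b c \<delta> s] by (auto simp: midway_def repr_def params_def) (metis add_is_0)

lemma midway_regs:
  assumes "midway n b \<Delta> m \<delta> d c s" "snd s' = snd s"
    and "\<And>x. x \<in> {''n'', ''b'', ''D'', ''Q'', ''c''} \<Longrightarrow> fst s' x = fst s x"
  shows "midway n b \<Delta> m \<delta> d c s'"
proof -
  have "repr n b c \<delta> s'" by (rule repr_regs[of _ _ _ _ s]) (use assms in \<open>auto simp: midway_def\<close>)
  thus ?thesis using assms(1) assms(3)[of "''c''"] by (simp add: midway_def)
qed

text \<open>Serves insertions and deletions alike: \<open>d\<close> is the deviation at the current
  vertex, successor or predecessor, and \<open>V\<close> is a potential that every flip lowers. The
  final \<open>notify\<close> brings the recorded degrees in line with the current ones.\<close>

lemma runs_chain: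
  assumes M: "midway n b \<Delta> m \<delta> d c s" and b: "b > 0"
    and step: "\<And>c s. midway n b \<Delta> m \<delta> d c s \<Longrightarrow> fst s ''f'' = 1 \<Longrightarrow> runs step s (2000 * (\<Delta> + 2)) (\<lambda>s'.
      (\<exists>c'. midway n b \<Delta> m \<delta> d c' s' \<and> fst s' ''f'' = 1 \<and> V (fst s' ''c'') < V (fst s ''c'')) \<or>
      (midway n b \<Delta> m \<delta> d c s' \<and> fst s' ''f'' = 0 \<and> fst s' ''c'' = fst s ''c'' \<and> stop c (fst s ''c'')))"
    and stop: "\<And>c s. midway n b \<Delta> m \<delta> d c s \<Longrightarrow> stop c (fst s ''c'') \<Longrightarrow> fairc b c (deg n c)"
    and V: "V (fst s ''c'') \<le> chain_length b \<Delta>" and d: "\<And>u. d (\<delta> u) \<le> \<Delta> + 1"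
  shows "runs (block [Assign ''f'' (Const 1), While (Reg ''f'') step, Assign ''x'' (Reg ''c''), notify]) s
    (3000 * ((chain_length b \<Delta> + 2) * (\<Delta> + 2)))
    (\<lambda>s'. \<exists>c'. repr n b c' (deg n c') s' \<and> fairc b c' (deg n c') \<and> (\<forall>u v. c' u v + c' v u = m u v))"
proof -
  \<comment> \<open>The counter is one more than the potential, which pays for the last iteration,
    the one that finds no violated arc.\<close>
  define I where "I = (\<lambda>k s'. \<exists>c'. midway n b \<Delta> m \<delta> d c' s' \<and>
    (fst s' ''f'' = 1 \<and> k = Suc (V (fst s' ''c'')) \<or>
     fst s' ''f'' = 0 \<and> k = 0 \<and> stop c' (fst s' ''c'')))"
  define s0 where "s0 = set_reg ''f'' 1 s"
  let ?k = "Suc (V (fst s ''c''))"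
  have "midway n b \<Delta> m \<delta> d c s0"
    by (rule midway_regs[OF M]) (auto simp: s0_def)
  hence init: "I ?k s0" by (auto simp: I_def s0_def)
  have loop: "runs (While (Reg ''f'') step) s0 ((?k + 1) * (1 + cost (Reg ''f'') + 2000 * (\<Delta> + 2)))
      (\<lambda>s'. \<exists>k'. I k' s' \<and> val (Reg ''f'') s' = 0)"
  proof (rule runs_While[of I, OF _ init])
    fix k s' assume I: "I k s'" and v: "val (Reg ''f'') s' \<noteq> 0"
    then obtain c' where c': "midway n b \<Delta> m \<delta> d c' s'" "fst s' ''f'' = 1" "k = Suc (V (fst s' ''c''))"
      by (auto simp: I_def)
    obtain t s'' where s'': "steps step s' t s''" "t \<le> 2000 * (\<Delta> + 2)" and
      "(\<exists>c''. midway n b \<Delta> m \<delta> d c'' s'' \<and> fst s'' ''f'' = 1 \<and> V (fst s'' ''c'') < V (fst s' ''c'')) \<or>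
       (midway n b \<Delta> m \<delta> d c' s'' \<and> fst s'' ''f'' = 0 \<and> fst s'' ''c'' = fst s' ''c'' \<and>
        stop c' (fst s' ''c''))"
      using step[OF c'(1,2)] unfolding runs_def by blast
    hence "\<exists>k'<k. I k' s''" unfolding I_def c'(3) by fastforce
    thus "\<exists>k'<k. runs step s' (2000 * (\<Delta> + 2)) (I k')" using s'' unfolding runs_def by blast
  qed
  have fin: "runs (block [Assign ''x'' (Reg ''c''), notify]) s' (500 * (\<Delta> + 2) + 10) (\<lambda>s'. \<exists>c'.
    repr n b c' (deg n c') s' \<and> fairc b c' (deg n c') \<and> (\<forall>u v. c' u v + c' v u = m u v))"
    if I: "I k s'" and v: "val (Reg ''f'') s' = 0" for k s'
  proof -
    from I v obtain c' where c': "midway n b \<Delta> m \<delta> d c' s'"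
      "stop c' (fst s' ''c'')" by (auto simp: I_def)
    note D = midway_D[OF c'(1)]
    define u where "u = fst s' ''c''"
    have R: "repr n b c' \<delta> (set_reg ''x'' u s')" by (rule repr_regs[OF D(1)]) auto
    have "\<delta> u < 4 * n * b" using D(9)[of u] by linarith
    from runs_notify[OF R b _ _ this] have N: "runs notify (set_reg ''x'' u s') (500 * (deg n c' u + 1)) (repr n b c' (\<delta>(u := deg n c' u)))"
      using D(2) by (simp add: u_def)
    have dd: "\<delta>(u := deg n c' u) = deg n c'" using D(4) by (auto simp: u_def)
    have "fairc b c' (deg n c')" by (rule stop[OF c'])
    hence P: "\<exists>c''. repr n b c'' (deg n c'') s'' \<and> fairc b c'' (deg n c'') \<and> (\<forall>u v. c'' u v + c'' v u = m u v)"
      if "repr n b c' (\<delta>(u := deg n c' u)) s''" for s'' using that D(5) unfolding dd by blast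
    have "deg n c' u + 1 \<le> \<Delta> + 2" using d[of u] D(4) by (simp add: u_def)
    hence t: "500 * (deg n c' u + 1) \<le> 500 * (\<Delta> + 2)" by simp
    have n1: "runs (block [notify]) (set_reg ''x'' u s') (500 * (\<Delta> + 2) + 1) (\<lambda>s'. \<exists>c'.
      repr n b c' (deg n c') s' \<and> fairc b c' (deg n c') \<and> (\<forall>u v. c' u v + c' v u = m u v))"
      by (rule runs_Cons[OF runs_mono[OF N t], where ?T2.0 = 1]) (use P in \<open>auto intro!: runs_Nil simp del: block.simps\<close>)
    show ?thesis
      by (rule runs_Cons_straight[where T = "500 * (\<Delta> + 2) + 1"])
        (use n1 in \<open>simp_all add: u_def del: block.simps\<close>)
  qed
  have "(?k + 1) * (1 + cost (Reg ''f'') + 2000 * (\<Delta> + 2)) \<le> (chain_length b \<Delta> + 2) * (2001 * (\<Delta> + 2))"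
    by (intro mult_le_mono) (use V in auto)
  hence t: "(?k + 1) * (1 + cost (Reg ''f'') + 2000 * (\<Delta> + 2)) \<le> 2001 * ((chain_length b \<Delta> + 2) * (\<Delta> + 2))"
    by (simp only: mult_ac)
  define X where "X = (chain_length b \<Delta> + 2) * (\<Delta> + 2)"
  have t2: "\<Delta> + 2 \<le> (chain_length b \<Delta> + 2) * (\<Delta> + 2)"
    using mult_le_mono1[of 1 "chain_length b \<Delta> + 2" "\<Delta> + 2"] by simp
  have "runs (block [While (Reg ''f'') step, Assign ''x'' (Reg ''c''), notify]) s0
     (2600 * ((chain_length b \<Delta> + 2) * (\<Delta> + 2))) (\<lambda>s'. \<exists>c'.
    repr n b c' (deg n c') s' \<and> fairc b c' (deg n c') \<and> (\<forall>u v. c' u v + c' v u = m u v))"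
  proof (rule runs_Cons[OF runs_mono[OF loop t]])
    show "2001 * ((chain_length b \<Delta> + 2) * (\<Delta> + 2)) + (500 * (\<Delta> + 2) + 10) \<le> 2600 * ((chain_length b \<Delta> + 2) * (\<Delta> + 2))"
    proof -
      have "500 * (\<Delta> + 2) \<le> 500 * X" "10 \<le> 5 * X" using t2[folded X_def] by auto
      thus ?thesis unfolding X_def[symmetric] by linarith
    qed
  qed (elim exE conjE, rule fin)
  note body = this
  show ?thesis unfolding X_def[symmetric]
    by (rule runs_Cons_straight[where T = "2600 * X"]) (use body[folded X_def] t2[folded X_def] in \<open>auto simp: s0_def simp del: block.simps\<close>)
qed

subsection \<open>After an insertion\<close>

definition col :: expr where "col = Read ''madj'' (Add (Mul (Reg ''c'') (Reg ''D'')) (Reg ''i''))"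

text \<open>Both factors are evaluated past the end of the row too, where \<open>col\<close> reads
  an arbitrary cell; the first factor then makes the product 0. The added 1 turns the strict
  comparison into a weak one.\<close>

definition down_guard :: expr where
  "down_guard = Mul (Less (Reg ''i'') (Read ''mlen'' (Reg ''c'')))
     (Less (Read ''mlen'' (Reg ''c'')) (Add (thrE (Read ''mlen'' col)) (Const 1)))"

definition down_step :: com where
  "down_step = block
     [block [Assign ''i'' (Const 0), While down_guard (Assign ''i'' (clamp (Add (Reg ''i'') (Const 1))))],
      Cond (Less (Reg ''i'') (Read ''mlen'' (Reg ''c'')))
        (block [Assign ''y'' col, Assign ''x'' (Reg ''c''), flip, Assign ''c'' (Reg ''x'')])
        (Assign ''f'' (Const 0))]"

definition descend :: com where
  "descend = block [Assign ''f'' (Const 1), While (Reg ''f'') down_step, Assign ''x'' (Reg ''c''), notify]"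

lemma descend_ops [simp]:
  "assigned descend = {''i'', ''k'', ''e'', ''l'', ''x'', ''y'', ''z'', ''c'', ''f''}" "safe descend"
  by (auto simp: descend_def down_step_def storable_clamp)
    (simp_all add: storable_def reg_deg_def clamp_def col_def down_guard_def thrE_def)

text \<open>A violated arc \<open>(u, w)\<close> has
  \<open>thr b (\<delta> w) \<le> \<delta> u\<close>. Its flip returns \<open>u\<close> to
  \<open>\<delta> u\<close> and passes the excess to \<open>w\<close>, whose potential is smaller by
  \<open>chain_length_thr\<close>.\<close>

lemma runs_down_step:
  assumes M: "midway n b \<Delta> m \<delta> Suc c s" and b: "b > 0" and f: "fst s ''f'' = 1"
  shows "runs down_step s (2000 * (\<Delta> + 2)) (\<lambda>s'.
    (\<exists>c'. midway n b \<Delta> m \<delta> Suc c' s' \<and> fst s' ''f'' = 1 \<and> chain_length b (\<delta> (fst s' ''c'')) < chain_length b (\<delta> (fst s ''c''))) \<or>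
    (midway n b \<Delta> m \<delta> Suc c s' \<and> fst s' ''f'' = 0 \<and> fst s' ''c'' = fst s ''c'' \<and>
      (\<forall>w. 0 < c (fst s ''c'') w \<longrightarrow> Suc (\<delta> (fst s ''c'')) \<le> thr b (\<delta> w))))" (is "runs _ _ _ ?P")
proof -
  define u where "u = fst s ''c''"
  define w where "w = (\<lambda>j. snd s ''madj'' (u * (n * b) + j))"
  define L where "L = deg n c u"
  note D = midway_D[OF M]
  have u: "u < n" using D(2) by (simp add: u_def)
  have L: "L = Suc (\<delta> u)" using D(4) by (simp add: L_def u_def)
  have "L \<le> \<Delta> + 1" "L \<le> n * b" using D(8)[of u] D(9)[of u] L by simp_all
  moreover have "0 < n * b" using b u by simp
  ultimately have LQ: "L < fst s ''Q''" using D(12) by linarith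
  have wc: "0 < c u v \<longleftrightarrow> (\<exists>j<L. w j = v)" for v
    using repr_row_mem[OF D(1) u] by (simp add: w_def L_def)
  \<comment> \<open>There are no loops, so a head differs from \<open>u\<close> and its current
    out-degree is the recorded one.\<close>
  have wn: "w j < n" "w j \<noteq> u" "deg n c (w j) = \<delta> (w j)" if "j < L" for j
  proof -
    have "0 < c u (w j)" using wc that by auto
    thus "w j < n" "w j \<noteq> u" using D(17)[of u "w j"] D(7)[of u] by auto
    thus "deg n c (w j) = \<delta> (w j)" using D(4) by (simp add: u_def)
  qed
  define stop where "stop = (\<lambda>j. j \<ge> L \<or> thr b (\<delta> (w j)) < L)"
  define i where "i = (LEAST j. stop j)"
  have i: "stop i" "\<And>j. j < i \<Longrightarrow> \<not> stop j" "i \<le> L"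
  proof -
    have L: "stop L" by (simp add: stop_def)
    show "stop i" unfolding i_def by (rule LeastI[of stop, OF L])
    show "\<And>j. j < i \<Longrightarrow> \<not> stop j" unfolding i_def by (rule not_less_Least)
    show "i \<le> L" unfolding i_def by (rule Least_le[of stop, OF L])
  qed
  have g: "val down_guard (set_reg ''i'' j s) \<noteq> 0 \<longleftrightarrow> \<not> stop j" for j
  proof (cases "j < L")
    case True
    have "val (thrE (Read ''mlen'' col)) (set_reg ''i'' j s) = thr b (\<delta> (w j))"
      using val_thrE[of "set_reg ''i'' j s" b "Read ''mlen'' col"] D(10,11,15) b wn[OF True]
      by (simp add: col_def w_def u_def)
    thus ?thesis using True D(15)[OF u] by (simp add: down_guard_def stop_def u_def[symmetric] L_def[symmetric] not_less)
  next
    case False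
    thus ?thesis using D(15)[OF u] by (simp add: down_guard_def stop_def u_def[symmetric] L_def[symmetric])
  qed
  have "cost down_guard + 15 \<le> 100" by (simp add: down_guard_def thrE_def col_def)
  hence "(i + 1) * (cost down_guard + 15) \<le> (\<Delta> + 2) * 100"
    by (intro mult_le_mono) (use i(3) \<open>L \<le> \<Delta> + 1\<close> in auto)
  hence t1: "(i + 1) * (cost down_guard + 15) \<le> 100 * (\<Delta> + 2)" by simp
  have scan: "runs (block [Assign ''i'' (Const 0), While down_guard (Assign ''i'' (clamp (Add (Reg ''i'') (Const 1))))]) s
      (100 * (\<Delta> + 2)) (\<lambda>s'. s' = set_reg ''i'' i s)"
    by (rule runs_mono[OF runs_scan t1]) (use g i LQ in \<open>auto simp: le_less_trans\<close>)
  let ?s = "set_reg ''i'' i s"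
  have Mi: "midway n b \<Delta> m \<delta> Suc c ?s"
    by (rule midway_regs[OF M]) auto
  have cv: "val (Less (Reg ''i'') (Read ''mlen'' (Reg ''c''))) ?s \<noteq> 0 \<longleftrightarrow> i < L"
    using D(15)[OF u] by (simp add: u_def[symmetric] L_def)
  have found: "runs (block [Assign ''y'' col, Assign ''x'' (Reg ''c''), flip, Assign ''c'' (Reg ''x'')]) ?s
      (1800 * (\<Delta> + 2)) ?P" if "i < L"
  proof -
    have lt: "thr b (\<delta> (w i)) < L" using i(1) that by (simp add: stop_def)
    note wi = wn[OF that]
    have cw: "0 < c u (w i)" using wc that by auto
    define s1 where "s1 = set_reg ''x'' u (set_reg ''y'' (w i) ?s)"
    have R1: "repr n b c \<delta> s1" by (rule repr_regs[OF D(1)]) (auto simp: s1_def)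
    have "\<delta> u < 4 * n * b" "\<delta> (w i) < 4 * n * b" using D(9)[of u] D(9)[of "w i"] by linarith+
    note fl = runs_flip[OF R1 b _ _ u wi(1) wi(2)[symmetric] this cw]
    have fl': "runs flip s1 (1700 * (L + 1)) (\<lambda>s'. repr n b (flipped c u (w i)) \<delta> s' \<and> fst s' ''x'' = w i \<and> fst s' ''f'' = 1)"
      by (rule runs_mono[OF runs_frame[OF fl]])
        (use D(9)[of "w i"] wi(3) f in \<open>auto simp: s1_def L_def\<close>)
    have post: "?P (set_reg ''c'' (w i) s')"
      if s': "repr n b (flipped c u (w i)) \<delta> s' \<and> fst s' ''x'' = w i \<and> fst s' ''f'' = 1" for s'
    proof -
      have thr: "thr b (\<delta> (w i)) \<le> \<delta> u" using lt L by simp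
      hence "chain_length b (\<delta> (w i)) < chain_length b (\<delta> u)"
        using chain_length_thr[OF b, of "\<delta> (w i)"] chain_length_mono[OF thr, of b] by simp
      moreover have "midway n b \<Delta> m \<delta> Suc (flipped c u (w i)) (set_reg ''c'' (w i) s')"
        unfolding midway_def
      proof (intro conjI)
        show "repr n b (flipped c u (w i)) \<delta> (set_reg ''c'' (w i) s')"
          by (rule repr_regs[of _ _ _ _ s']) (use s' in auto)
        have "\<delta> (w i) \<le> thr b (\<delta> u)" using thr less_thr[of "\<delta> (w i)" b] less_thr[of "\<delta> u" b] by simp
        thus "fairc b (flipped c u (w i)) \<delta>" by (rule fairc_flipped[OF D(3)])
        show "deg n (flipped c u (w i)) = \<delta>(fst (set_reg ''c'' (w i) s') ''c'' := Suc (\<delta> (fst (set_reg ''c'' (w i) s') ''c'')))"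
          using wi deg_flipped[of u "w i" n c, OF _ u _ cw] L[unfolded L_def]
          by (auto simp: fun_eq_iff D(4) u_def[symmetric])
        show "\<forall>x v. flipped c u (w i) x v + flipped c u (w i) v x = m x v"
          using flipped_sum[of u "w i" c] cw wi D(5) by simp
      qed (use wi D(6,8,9) in auto)
      ultimately show ?thesis using s' by (auto simp: u_def)
    qed
    have t: "1700 * (L + 1) \<le> 1700 * (\<Delta> + 2)" using \<open>L \<le> \<Delta> + 1\<close> by simp
    have 2: "runs (block [flip, Assign ''c'' (Reg ''x'')]) s1 (1700 * (\<Delta> + 2) + 10) ?P"
    proof (rule runs_Cons[OF runs_mono[OF fl' t]])
      fix s' assume "repr n b (flipped c u (w i)) \<delta> s' \<and> fst s' ''x'' = w i \<and> fst s' ''f'' = 1"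
      thus "runs (block [Assign ''c'' (Reg ''x'')]) s' 10 ?P"
        using post by (intro runs_straight) simp_all
    qed simp
    have "eff (Assign ''x'' (Reg ''c'')) (eff (Assign ''y'' col) ?s) = s1"
      using D(11) by (simp add: s1_def col_def u_def w_def)
    note s1 = this
    show ?thesis
      by (rule runs_Cons_straight[where T = "1700 * (\<Delta> + 2) + 30", OF _ runs_Cons_straight[where T = "1700 * (\<Delta> + 2) + 10"]])
        (use 2 s1 in \<open>simp_all add: col_def del: block.simps\<close>)
  qed
  have stuck: "runs (Assign ''f'' (Const 0)) ?s (1800 * (\<Delta> + 2)) ?P" if "\<not> i < L"
  proof -
    have "Suc (\<delta> u) \<le> thr b (\<delta> v)" if "0 < c u v" for v
    proof -
      obtain j where "j < L" "w j = v" using wc \<open>0 < c u v\<close> by auto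
      thus ?thesis using i(2)[of j] \<open>\<not> i < L\<close> L by (auto simp: stop_def)
    qed
    moreover have "midway n b \<Delta> m \<delta> Suc c (set_reg ''f'' 0 ?s)"
      by (rule midway_regs[OF M]) auto
    ultimately show ?thesis by (intro runs_straight) (auto simp: u_def)
  qed
  have "runs (Cond (Less (Reg ''i'') (Read ''mlen'' (Reg ''c'')))
        (block [Assign ''y'' col, Assign ''x'' (Reg ''c''), flip, Assign ''c'' (Reg ''x'')])
        (Assign ''f'' (Const 0))) ?s (1800 * (\<Delta> + 2) + 6) ?P"
    by (rule runs_Cond[of _ _ _ "1800 * (\<Delta> + 2)"]) (use found stuck cv in auto)
  note step = runs_single[OF this]
  show ?thesis unfolding down_step_def
    by (rule runs_Cons[OF runs_mono[OF scan order_refl]]) (simp only:, rule step, simp)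
qed

lemma runs_descend:
  assumes M: "midway n b \<Delta> m \<delta> Suc c s" and b: "b > 0"
  shows "runs descend s (3000 * ((chain_length b \<Delta> + 2) * (\<Delta> + 2))) (\<lambda>s'. \<exists>c'.
    repr n b c' (deg n c') s' \<and> fairc b c' (deg n c') \<and> (\<forall>u v. c' u v + c' v u = m u v))"
  unfolding descend_def
proof (rule runs_chain[OF M b runs_down_step[OF _ b]])
  fix c s assume M: "midway n b \<Delta> m \<delta> Suc c s"
    and stop: "\<forall>w. 0 < c (fst s ''c'') w \<longrightarrow> Suc (\<delta> (fst s ''c'')) \<le> thr b (\<delta> w)"
  note D = midway_D[OF M]
  define u where "u = fst s ''c''"
  have du: "deg n c = \<delta>(u := Suc (\<delta> u))" using D(4) by (simp add: u_def)
  \<comment> \<open>The higher degree of \<open>u\<close> only loosens the condition on arcs into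
    \<open>u\<close>; arcs out of \<open>u\<close> are covered by \<open>stop\<close>.\<close>
  show "fairc b c (deg n c)"
    unfolding fairc_def
  proof (intro allI impI)
    fix x y assume xy: "0 < c x y"
    have "x \<noteq> y" using xy D(7)[of x] by auto
    have 1: "\<delta> x \<le> thr b (\<delta> y)" using D(3) xy by (simp add: fairc_def)
    have 2: "thr b (\<delta> y) \<le> thr b (Suc (\<delta> y))" by (rule thr_mono) simp
    show "deg n c x \<le> thr b (deg n c y)"
      using 1 2 stop xy \<open>x \<noteq> y\<close> by (auto simp: du u_def)
  qed
qed (use midway_D(8)[OF M] in \<open>auto intro: chain_length_mono\<close>)

subsection \<open>After a deletion\<close>

definition top_key :: expr where
  "top_key = Add (Mul (Reg ''c'') (Reg ''Q'')) (thrE (Read ''dg'' (Reg ''c'')))"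

text \<open>The in-neighbours of \<open>c\<close> have degree at most \<open>thr (\<delta> c)\<close>, and those above
  \<open>thr (\<delta> c - 1) \<ge> thr (\<delta> c) - 2\<close> are too large now: it suffices to inspect two buckets.\<close>

definition up_step :: com where
  "up_step = block
     [Assign ''k'' top_key,
      Cond (Mul (Equal (Read ''bsz'' (Reg ''k'')) (Const 0))
          (Less (Add (thrE (Read ''mlen'' (Reg ''c''))) (Const 1)) (thrE (Read ''dg'' (Reg ''c'')))))
        (Assign ''k'' (Sub (Reg ''k'') (Const 1))) Skip,
      Cond (Read ''bsz'' (Reg ''k''))
        (block [Assign ''x'' (Read ''bel'' (slot (Const 0))), Assign ''y'' (Reg ''c''), flip, Assign ''c'' (Reg ''y'')])
        (Assign ''f'' (Const 0))]"

definition ascend :: com where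
  "ascend = block [Assign ''f'' (Const 1), While (Reg ''f'') up_step, Assign ''x'' (Reg ''c''), notify]"

lemma ascend_ops [simp]:
  "assigned ascend = {''i'', ''k'', ''e'', ''l'', ''x'', ''y'', ''z'', ''c'', ''f''}" "safe ascend"
  by (auto simp: ascend_def up_step_def)
    (simp_all add: storable_def reg_deg_def top_key_def thrE_def slot_def)

lemma iset_empty: "iset n S sz el pos \<Longrightarrow> sz k = 0 \<Longrightarrow> S k = {}"
  unfolding iset_def indexed_def by fastforce

lemma iset_first: "iset n S sz el pos \<Longrightarrow> 0 < sz k \<Longrightarrow> el (k * n) \<in> S k"
  unfolding iset_def indexed_def by (metis add.right_neutral)

lemma thr_less_Suc: "thr b d < thr b (Suc d)"
proof -
  have "max 1 (2 * d div b) \<le> max 1 (2 * Suc d div b)" by (intro max.mono div_le_mono) auto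
  thus ?thesis unfolding thr_def by linarith
qed

text \<open>An in-neighbour \<open>x\<close> that violates the condition has
  \<open>t < \<delta> x \<le> T\<close> with \<open>T \<le> t + 2\<close>. Reversing its arc
  restores \<open>u\<close> and passes the deficit to \<open>x\<close>. The potential is evaluated
  at \<open>\<delta> - 1\<close>, the current degree of the deficient vertex, and subtracted from
  its value at \<open>\<Delta>\<close> because degrees rise along this chain.\<close>

lemma runs_up_step:
  assumes M: "midway n b \<Delta> m \<delta> (\<lambda>x. x - 1) c s" and b: "b > 1" and f: "fst s ''f'' = 1"
  shows "runs up_step s (2000 * (\<Delta> + 2)) (\<lambda>s'.
    (\<exists>c'. midway n b \<Delta> m \<delta> (\<lambda>x. x - 1) c' s' \<and> fst s' ''f'' = 1 \<and>
      chain_length b \<Delta> - chain_length b (\<delta> (fst s' ''c'') - 1) < chain_length b \<Delta> - chain_length b (\<delta> (fst s ''c'') - 1)) \<or>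
    (midway n b \<Delta> m \<delta> (\<lambda>x. x - 1) c s' \<and> fst s' ''f'' = 0 \<and> fst s' ''c'' = fst s ''c'' \<and>
      (\<forall>x. 0 < c x (fst s ''c'') \<longrightarrow> \<delta> x \<le> thr b (\<delta> (fst s ''c'') - 1))))" (is "runs _ _ _ ?P")
proof -
  define u where "u = fst s ''c''"
  let ?Q = "4 * n * b"
  note D = midway_D[OF M]
  have b0: "b > 0" using b by simp
  have u: "u < n" using D(2) by (simp add: u_def)
  \<comment> \<open>\<open>midway\<close> demands a genuine deviation, so the predecessor is not
    truncated here.\<close>
  have \<delta>u: "0 < \<delta> u" using D(14) by (auto simp: u_def)
  define T where "T = thr b (\<delta> u)"
  define t where "t = thr b (\<delta> u - 1)"
  have Tt: "t < T" "T \<le> t + 2"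
    using thr_Suc[of b "\<delta> u - 1"] thr_less_Suc[of b "\<delta> u - 1"] b \<delta>u by (auto simp: T_def t_def)
  have TQ: "T < ?Q"
  proof -
    have "T \<le> \<delta> u + max 1 (2 * \<delta> u)"
      unfolding T_def thr_def by (intro add_mono max.mono div_le_dividend) auto
    moreover have "0 < n * b" using u b by simp
    ultimately show ?thesis using D(9)[of u] \<delta>u by linarith
  qed
  have B: "iset n (bucket n ?Q c (\<lambda>_. \<delta>)) (snd s ''bsz'') (snd s ''bel'') (snd s ''bpos'')"
    using D(1) by (simp add: repr_def)
  have inb: "x \<in> bucket n ?Q c (\<lambda>_. \<delta>) (u * ?Q + d) \<longleftrightarrow> 0 < c x u \<and> \<delta> x = d" if "d < ?Q" for x d
  proof -
    have "(u * ?Q + d) div ?Q = u \<and> (u * ?Q + d) mod ?Q = d"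
      using key_iff[OF that, of "u * ?Q + d" u] by blast
    thus ?thesis using D(17)[of x u] unfolding bucket_def by auto
  qed
  have fair: "\<delta> x \<le> T" if "0 < c x u" for x using D(3) that by (simp add: fairc_def T_def)
  \<comment> \<open>Bucket \<open>T - 1\<close> qualifies only while it lies above \<open>t\<close>;
    an arc from a tail of degree \<open>t\<close> is not violated, and reversing it need not lower
    the potential.\<close>
  define k where "k = (if snd s ''bsz'' (u * ?Q + T) = 0 \<and> t + 1 < T then u * ?Q + T - 1 else u * ?Q + T)"
  define d where "d = (if snd s ''bsz'' (u * ?Q + T) = 0 \<and> t + 1 < T then T - 1 else T)"
  have k: "k = u * ?Q + d" "t < d" "d < ?Q" using Tt TQ by (auto simp: k_def d_def)
  let ?s = "set_reg ''k'' k s"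
  have pre: "eff (Cond (Mul (Equal (Read ''bsz'' (Reg ''k'')) (Const 0))
          (Less (Add (thrE (Read ''mlen'' (Reg ''c''))) (Const 1)) (thrE (Read ''dg'' (Reg ''c'')))))
        (Assign ''k'' (Sub (Reg ''k'') (Const 1))) Skip) (eff (Assign ''k'' top_key) s) = ?s"
    using D(10,12) D(15,16)[OF u] b0 D(4)
    by (simp add: top_key_def val_thrE[where b = b] k_def u_def T_def t_def)
  have found: "runs (block [Assign ''x'' (Read ''bel'' (slot (Const 0))), Assign ''y'' (Reg ''c''), flip, Assign ''c'' (Reg ''y'')]) ?s
      (1800 * (\<Delta> + 2)) ?P" if ne: "snd s ''bsz'' k \<noteq> 0"
  proof -
    define x where "x = snd s ''bel'' (k * n)"
    have "x \<in> bucket n ?Q c (\<lambda>_. \<delta>) k" unfolding x_def by (rule iset_first[OF B]) (use ne in simp)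
    hence x: "0 < c x u" "\<delta> x = d" using inb[OF k(3)] k(1) by auto
    have xn: "x < n" "x \<noteq> u" using D(17)[OF x(1)] x(1) D(7)[of u] by auto
    define s1 where "s1 = set_reg ''y'' u (set_reg ''x'' x ?s)"
    have R1: "repr n b c \<delta> s1" by (rule repr_regs[OF D(1)]) (auto simp: s1_def)
    have \<delta>: "\<delta> x < 4 * n * b" "\<delta> u < 4 * n * b" using D(9)[of u] D(9)[of x] by linarith+
    have degs: "deg n c u = \<delta> u - 1" "deg n c x = \<delta> x" using D(4) xn by (auto simp: u_def)
    have "deg n c u < n * b" using D(9)[of u] degs by simp
    note fl = runs_flip[OF R1 b0 _ _ xn(1) u xn(2) \<delta> x(1) this]
    have "1700 * (deg n c x + 1) \<le> 1700 * (\<Delta> + 2)" using D(8)[of x] degs by simp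
    note t = this
    have fl': "runs flip s1 (1700 * (\<Delta> + 2)) (\<lambda>s'. repr n b (flipped c x u) \<delta> s' \<and> fst s' ''y'' = x \<and> fst s' ''f'' = 1)"
      by (rule runs_mono[OF runs_frame[OF fl] t]) (use f in \<open>auto simp: s1_def\<close>)
    have post: "?P (set_reg ''c'' x s')"
      if s': "repr n b (flipped c x u) \<delta> s' \<and> fst s' ''y'' = x \<and> fst s' ''f'' = 1" for s'
    proof -
      have thr: "t \<le> \<delta> x - 1" "0 < \<delta> x" using x(2) k(2) by auto
      have "chain_length b (\<delta> u - 1) < chain_length b (\<delta> x - 1)"
        using chain_length_thr[OF b0, of "\<delta> u - 1"] chain_length_mono[OF thr(1), of b] by (simp add: t_def)
      \<comment> \<open>Needed for a strict decrease, as the potential is a truncated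
        difference.\<close>
      moreover have "chain_length b (\<delta> x - 1) \<le> chain_length b \<Delta>" by (rule chain_length_mono) (use D(8)[of x] in simp)
      ultimately have V: "chain_length b \<Delta> - chain_length b (\<delta> x - 1) < chain_length b \<Delta> - chain_length b (\<delta> u - 1)" by linarith
      have "midway n b \<Delta> m \<delta> (\<lambda>x. x - 1) (flipped c x u) (set_reg ''c'' x s')"
        unfolding midway_def
      proof (intro conjI)
        show "repr n b (flipped c x u) \<delta> (set_reg ''c'' x s')"
          by (rule repr_regs[of _ _ _ _ s']) (use s' in auto)
        have "\<delta> u \<le> thr b (\<delta> x)" using thr less_thr[of "\<delta> u - 1" b] less_thr[of "\<delta> x" b] by (simp add: t_def)
        thus "fairc b (flipped c x u) \<delta>" by (rule fairc_flipped[OF D(3)])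
        show "deg n (flipped c x u) = \<delta>(fst (set_reg ''c'' x s') ''c'' := \<delta> (fst (set_reg ''c'' x s') ''c'') - 1)"
          using xn deg_flipped[of x u n c, OF _ _ u x(1)] \<delta>u
          by (auto simp: fun_eq_iff D(4) u_def[symmetric])
        show "\<forall>y v. flipped c x u y v + flipped c x u v y = m y v"
          using flipped_sum[of x u c] x(1) xn D(5) by simp
      qed (use xn thr D(6,8,9) in auto)
      thus ?thesis using s' V by (auto simp: u_def)
    qed
    have 2: "runs (block [flip, Assign ''c'' (Reg ''y'')]) s1 (1700 * (\<Delta> + 2) + 10) ?P"
    proof (rule runs_Cons[OF fl'[THEN runs_mono[OF _ order_refl]]])
      fix s' assume "repr n b (flipped c x u) \<delta> s' \<and> fst s' ''y'' = x \<and> fst s' ''f'' = 1"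
      thus "runs (block [Assign ''c'' (Reg ''y'')]) s' 10 ?P"
        using post by (intro runs_straight) simp_all
    qed simp
    have s1: "eff (Assign ''y'' (Reg ''c'')) (eff (Assign ''x'' (Read ''bel'' (slot (Const 0)))) ?s) = s1"
      using D(13) by (simp add: s1_def slot_def u_def x_def)
    show ?thesis
      by (rule runs_Cons_straight[where T = "1700 * (\<Delta> + 2) + 30", OF _ runs_Cons_straight[where T = "1700 * (\<Delta> + 2) + 10"]])
        (use 2 s1 in \<open>simp_all add: slot_def del: block.simps\<close>)
  qed
  have stuck: "runs (Assign ''f'' (Const 0)) ?s (1800 * (\<Delta> + 2)) ?P" if z: "snd s ''bsz'' k = 0"
  proof -
    have "\<delta> x \<le> t" if x: "0 < c x u" for x
    proof (rule ccontr)
      assume "\<not> \<delta> x \<le> t"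
      hence dx: "t < \<delta> x" "\<delta> x \<le> T" using fair[OF x] by auto
      have "snd s ''bsz'' (u * ?Q + \<delta> x) = 0"
      proof (cases "\<delta> x = T")
        case False
        hence e: "u * ?Q + \<delta> x = u * ?Q + T - 1" "t + 1 < T" using Tt dx by auto
        show ?thesis using z e(2) unfolding e(1) k_def by (auto split: if_splits)
      qed (use z in \<open>auto simp: k_def split: if_splits\<close>)
      hence "bucket n ?Q c (\<lambda>_. \<delta>) (u * ?Q + \<delta> x) = {}" by (rule iset_empty[OF B])
      thus False using inb[of "\<delta> x" x] x dx TQ by auto
    qed
    moreover have "midway n b \<Delta> m \<delta> (\<lambda>x. x - 1) c (set_reg ''f'' 0 ?s)"
      by (rule midway_regs[OF M]) auto
    ultimately show ?thesis by (intro runs_straight) (auto simp: u_def t_def)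
  qed
  have "runs (Cond (Read ''bsz'' (Reg ''k''))
        (block [Assign ''x'' (Read ''bel'' (slot (Const 0))), Assign ''y'' (Reg ''c''), flip, Assign ''c'' (Reg ''y'')])
        (Assign ''f'' (Const 0))) ?s (1800 * (\<Delta> + 2) + 6) ?P"
    by (rule runs_Cond[of _ _ _ "1800 * (\<Delta> + 2)"]) (use found stuck in auto)
  note step = runs_single[OF this]
  show ?thesis unfolding up_step_def
    by (rule runs_Cons_straight[OF _ runs_Cons_straight[where T' = "1800 * (\<Delta> + 2) + 100", OF _ step[folded pre]]])
      (simp_all add: top_key_def thrE_def)
qed

lemma runs_ascend:
  assumes M: "midway n b \<Delta> m \<delta> (\<lambda>x. x - 1) c s" and b: "b > 1"
  shows "runs ascend s (3000 * ((chain_length b \<Delta> + 2) * (\<Delta> + 2))) (\<lambda>s'. \<exists>c'.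
    repr n b c' (deg n c') s' \<and> fairc b c' (deg n c') \<and> (\<forall>u v. c' u v + c' v u = m u v))"
  unfolding ascend_def
proof (rule runs_chain[where V = "\<lambda>u. chain_length b \<Delta> - chain_length b (\<delta> u - 1)", OF M _ runs_up_step[OF _ b]])
  fix c s assume M: "midway n b \<Delta> m \<delta> (\<lambda>x. x - 1) c s"
    and stop: "\<forall>x. 0 < c x (fst s ''c'') \<longrightarrow> \<delta> x \<le> thr b (\<delta> (fst s ''c'') - 1)"
  note D = midway_D[OF M]
  define u where "u = fst s ''c''"
  have du: "deg n c = \<delta>(u := \<delta> u - 1)" using D(4) by (simp add: u_def)
  show "fairc b c (deg n c)"
    unfolding fairc_def
  proof (intro allI impI)
    fix x y assume xy: "0 < c x y"
    have "x \<noteq> y" using xy D(7)[of x] by auto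
    have "\<delta> x \<le> thr b (\<delta> y)" using D(3) xy by (simp add: fairc_def)
    thus "deg n c x \<le> thr b (deg n c y)"
      using stop xy \<open>x \<noteq> y\<close> by (auto simp: du u_def)
  qed
next
  fix u show "\<delta> u - 1 \<le> \<Delta> + 1" using midway_D(8)[OF M, of u] by simp
qed (use b in auto)

section \<open>Processing an update\<close>

definition settled :: "nat \<Rightarrow> nat \<Rightarrow> (nat \<Rightarrow> nat \<Rightarrow> nat) \<Rightarrow> state \<Rightarrow> bool" where
  "settled n b c s \<longleftrightarrow> repr n b c (deg n c) s \<and> fairc b c (deg n c)"

text \<open>The new copy leaves the end point of smaller out-degree and is therefore fair for the
  recorded degrees, as \<open>midway\<close> requires.\<close>

definition insert_copy :: com where
  "insert_copy = block
     [Cond (Less (Read ''mlen'' (Reg ''v'')) (Read ''mlen'' (Reg ''u'')))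
        (block [Assign ''x'' (Reg ''v''), Assign ''y'' (Reg ''u'')])
        (block [Assign ''x'' (Reg ''u''), Assign ''y'' (Reg ''v'')]),
      add_arc, Assign ''c'' (Reg ''x''), descend]"

definition delete_copy :: com where
  "delete_copy = block
     [Cond (Read ''cnt'' (Add (Mul (Reg ''u'') (Reg ''n'')) (Reg ''v'')))
        (block [Assign ''x'' (Reg ''u''), Assign ''y'' (Reg ''v'')])
        (block [Assign ''x'' (Reg ''v''), Assign ''y'' (Reg ''u'')]),
      del_arc, Assign ''c'' (Reg ''x''), ascend]"

definition process :: com where
  "process = block
     [Assign ''p'' (Const 0),
      While (Less (Reg ''p'') (Reg ''b''))
        (block [Cond (Reg ''op'') delete_copy insert_copy, Assign ''p'' (clamp (Add (Reg ''p'') (Const 1)))])]"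

definition prepare :: com where
  "prepare = block [Assign ''D'' (Mul (Reg ''n'') (Reg ''b'')),
     Assign ''Q'' (Mul (Mul (Const 4) (Reg ''n'')) (Reg ''b''))]"

lemma process_ops [simp]:
  "assigned insert_copy = {''i'', ''k'', ''e'', ''l'', ''x'', ''y'', ''z'', ''c'', ''f''}"
  "assigned delete_copy = {''i'', ''k'', ''e'', ''l'', ''x'', ''y'', ''z'', ''c'', ''f''}"
  "safe process" "safe prepare"
  by (auto simp: process_def prepare_def insert_copy_def delete_copy_def storable_clamp)
    (simp_all add: storable_def reg_deg_def clamp_def)

lemma runs_insert_copy:
  assumes S: "settled n b c s" and b: "b > 0" and uv: "fst s ''u'' < n" "fst s ''v'' < n" "fst s ''u'' \<noteq> fst s ''v''"
    and loop: "\<And>w. c w w = 0" and \<Delta>: "\<And>w. deg n c w \<le> \<Delta> \<and> deg n c w < n * b"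
  shows "runs insert_copy s (4000 * ((chain_length b \<Delta> + 2) * (\<Delta> + 2))) (\<lambda>s'. \<exists>c'. settled n b c' s' \<and>
    (\<forall>x y. c' x y + c' y x = c x y + c y x + (if {x, y} = {fst s ''u'', fst s ''v''} then 1 else 0)))"
proof -
  have R: "repr n b c (deg n c) s" and F: "fairc b c (deg n c)" using S by (auto simp: settled_def)
  define x where "x = (if deg n c (fst s ''v'') < deg n c (fst s ''u'') then fst s ''v'' else fst s ''u'')"
  define y where "y = (if deg n c (fst s ''v'') < deg n c (fst s ''u'') then fst s ''u'' else fst s ''v'')"
  have xy: "x < n" "y < n" "x \<noteq> y" "deg n c x \<le> deg n c y" "{x, y} = {fst s ''u'', fst s ''v''}"
    using uv by (auto simp: x_def y_def)
  define s1 where "s1 = set_reg ''y'' y (set_reg ''x'' x s)"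
  define s2 where "s2 = eff add_arc s1"
  define s3 where "s3 = set_reg ''c'' x s2"
  let ?c = "upd c x y (Suc (c x y))"
  have R1: "repr n b c (deg n c) s1" by (rule repr_regs[OF R]) (auto simp: s1_def)
  have "deg n c x < 4 * n * b" using \<Delta>[of x] by linarith
  from eff_add_arc[OF R1 b _ _ xy(1-3) this] \<Delta>[of x]
  have R2: "repr n b ?c (deg n c) s2" by (simp add: s2_def s1_def)
  have R3: "repr n b ?c (deg n c) s3" by (rule repr_regs[OF R2]) (auto simp: s3_def)
  have deg: "deg n ?c = (deg n c)(x := Suc (deg n c x))" using xy le_deg[of y n c x] by (simp add: deg_upd)
  have M: "midway n b \<Delta> (\<lambda>u v. ?c u v + ?c v u) (deg n c) Suc ?c s3"
    unfolding midway_def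
  proof (intro conjI)
    show "fairc b ?c (deg n c)"
      unfolding fairc_def
    proof (intro allI impI)
      fix u v assume "0 < ?c u v"
      hence "0 < c u v \<or> u = x \<and> v = y" by (auto split: if_splits)
      thus "deg n c u \<le> thr b (deg n c v)"
        using F xy(4) less_thr[of "deg n c y" b] by (auto simp: fairc_def)
    qed
    show "deg n ?c = (deg n c)(fst s3 ''c'' := Suc (deg n c (fst s3 ''c'')))" by (simp add: deg s3_def)
  qed (use R3 xy \<Delta> loop in \<open>auto simp: s3_def\<close>)
  have sums: "?c w z + ?c z w = c w z + c z w + (if {w, z} = {fst s ''u'', fst s ''v''} then 1 else 0)" for w z
    using xy(3) unfolding xy(5)[symmetric] by (auto simp: doubleton_eq_iff)
  have desc: "runs descend s3 (3000 * ((chain_length b \<Delta> + 2) * (\<Delta> + 2))) (\<lambda>s'. \<exists>c'. settled n b c' s' \<and>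
    (\<forall>x y. c' x y + c' y x = c x y + c y x + (if {x, y} = {fst s ''u'', fst s ''v''} then 1 else 0)))"
    by (rule runs_mono[OF runs_descend[OF M b] order_refl]) (unfold sums settled_def, blast)
  define X where "X = (chain_length b \<Delta> + 2) * (\<Delta> + 2)"
  have X: "4 \<le> X" unfolding X_def using mult_le_mono[of 2 "chain_length b \<Delta> + 2" 2 "\<Delta> + 2"] by simp
  let ?b = "Cond (Less (Read ''mlen'' (Reg ''v'')) (Read ''mlen'' (Reg ''u'')))
        (block [Assign ''x'' (Reg ''v''), Assign ''y'' (Reg ''u'')])
        (block [Assign ''x'' (Reg ''u''), Assign ''y'' (Reg ''v'')])"
  have e1: "eff ?b s = s1"
    using repr_deg[OF R uv(1)] repr_deg[OF R uv(2)] by (simp add: s1_def x_def y_def)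
  have e3: "eff (Assign ''c'' (Reg ''x'')) s2 = s3" by (simp add: s3_def s2_def eff_assigned s1_def)
  note r1 = runs_single[OF desc[folded X_def]]
  note r2 = runs_Cons_straight[where c = "Assign ''c'' (Reg ''x'')", OF _ r1[folded e3], where T' = "3000 * X + 10"]
  note r3 = runs_Cons_straight[where c = add_arc, OF _ r2[unfolded s2_def], where T' = "3000 * X + 700"]
  note r4 = runs_Cons_straight[where c = ?b, OF _ r3[folded e1], where T' = "4000 * X"]
  show ?thesis unfolding insert_copy_def X_def[symmetric]
    by (rule r4) (use arc_times(2) X in simp_all)
qed

lemma runs_delete_copy:
  assumes S: "settled n b c s" and b: "b > 1" and uv: "fst s ''u'' < n" "fst s ''v'' < n" "fst s ''u'' \<noteq> fst s ''v''"
    and loop: "\<And>w. c w w = 0" and \<Delta>: "\<And>w. deg n c w \<le> \<Delta> \<and> deg n c w < n * b"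
    and pos: "0 < c (fst s ''u'') (fst s ''v'') + c (fst s ''v'') (fst s ''u'')"
  shows "runs delete_copy s (5000 * ((chain_length b \<Delta> + 2) * (\<Delta> + 2))) (\<lambda>s'. \<exists>c'. settled n b c' s' \<and>
    (\<forall>x y. c' x y + c' y x = c x y + c y x - (if {x, y} = {fst s ''u'', fst s ''v''} then 1 else 0)))"
proof -
  have R: "repr n b c (deg n c) s" and F: "fairc b c (deg n c)" using S by (auto simp: settled_def)
  have b0: "b > 0" using b by simp
  define x where "x = (if c (fst s ''u'') (fst s ''v'') \<noteq> 0 then fst s ''u'' else fst s ''v'')"
  define y where "y = (if c (fst s ''u'') (fst s ''v'') \<noteq> 0 then fst s ''v'' else fst s ''u'')"
  have xy: "x < n" "y < n" "x \<noteq> y" "0 < c x y" "{x, y} = {fst s ''u'', fst s ''v''}"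
    using uv pos by (auto simp: x_def y_def)
  define s1 where "s1 = set_reg ''y'' y (set_reg ''x'' x s)"
  let ?c = "upd c x y (c x y - 1)"
  have R1: "repr n b c (deg n c) s1" by (rule repr_regs[OF R]) (auto simp: s1_def)
  have "deg n c x < 4 * n * b" using \<Delta>[of x] by linarith
  from runs_del_arc[OF R1 b0 _ _ xy(1-3) this xy(4)]
  have R2: "runs del_arc s1 (1000 * (deg n c x + 1)) (repr n b ?c (deg n c))" by (simp add: s1_def)
  define X where "X = (chain_length b \<Delta> + 2) * (\<Delta> + 2)"
  have X: "4 \<le> X" "\<Delta> + 2 \<le> X"
    unfolding X_def using mult_le_mono[of 2 "chain_length b \<Delta> + 2" 2 "\<Delta> + 2"] mult_le_mono1[of 1 "chain_length b \<Delta> + 2" "\<Delta> + 2"]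
    by simp_all
  have cx: "c x y \<le> deg n c x" using le_deg xy by blast
  have deg: "deg n ?c = (deg n c)(x := deg n c x - 1)" 
    using xy(3,4) cx unfolding deg_upd[OF xy(2)] by (simp add: fun_eq_iff)
  let ?G = "\<lambda>s'. \<exists>c'. settled n b c' s' \<and>
    (\<forall>x y. c' x y + c' y x = c x y + c y x - (if {x, y} = {fst s ''u'', fst s ''v''} then 1 else 0))"
  have rest: "runs (block [Assign ''c'' (Reg ''x''), ascend]) s2 (3000 * X + 10) ?G"
    if s2: "repr n b ?c (deg n c) s2" "fst s2 ''x'' = x" for s2
  proof -
    have R3: "repr n b ?c (deg n c) (set_reg ''c'' x s2)" by (rule repr_regs[OF s2(1)]) auto
    have M: "midway n b \<Delta> (\<lambda>u v. ?c u v + ?c v u) (deg n c) (\<lambda>x. x - 1) ?c (set_reg ''c'' x s2)"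
      unfolding midway_def
    proof (intro conjI)
      show "fairc b ?c (deg n c)" using F xy(4) by (auto simp: fairc_def split: if_splits)
      show "deg n ?c = (deg n c)(fst (set_reg ''c'' x s2) ''c'' := deg n c (fst (set_reg ''c'' x s2) ''c'') - 1)"
        unfolding deg by simp
    qed (use R3 xy \<Delta> loop cx in auto)
    have sums: "?c w z + ?c z w = c w z + c z w - (if {w, z} = {fst s ''u'', fst s ''v''} then 1 else 0)" for w z
      using xy(3,4) unfolding xy(5)[symmetric] by (auto simp: doubleton_eq_iff)
    have "runs ascend (set_reg ''c'' x s2) (3000 * X) ?G"
      unfolding X_def
      by (rule runs_mono[OF runs_ascend[OF M b] order_refl]) (unfold sums settled_def, blast)
    thus ?thesis
      by (intro runs_Cons_straight[where T = "3000 * X + 1", OF _ runs_single]) (use s2 in auto)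
  qed
  have "1000 * (deg n c x + 1) \<le> 1000 * X" using \<Delta>[of x] X(2) by simp
  note t = this
  have R2': "runs del_arc s1 (1000 * X) (\<lambda>s2. repr n b ?c (deg n c) s2 \<and> fst s2 ''x'' = x)"
    by (rule runs_mono[OF runs_frame[OF R2] t]) (auto simp: s1_def)
  have r2: "runs (block [del_arc, Assign ''c'' (Reg ''x''), ascend]) s1 (4000 * X + 10) ?G"
  proof (rule runs_Cons[OF runs_mono[OF R2' order_refl]])
    fix s2 assume "repr n b ?c (deg n c) s2 \<and> fst s2 ''x'' = x"
    thus "runs (block [Assign ''c'' (Reg ''x''), ascend]) s2 (3000 * X + 10) ?G" using rest by blast
  qed simp
  let ?b = "Cond (Read ''cnt'' (Add (Mul (Reg ''u'') (Reg ''n'')) (Reg ''v'')))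
        (block [Assign ''x'' (Reg ''u''), Assign ''y'' (Reg ''v'')])
        (block [Assign ''x'' (Reg ''v''), Assign ''y'' (Reg ''u'')])"
  have e1: "eff ?b s = s1"
    using R uv by (simp add: s1_def x_def y_def repr_def params_def)
  note r3 = runs_Cons_straight[where c = ?b, OF _ r2[folded e1], where T' = "5000 * X"]
  show ?thesis unfolding delete_copy_def X_def[symmetric]
    by (rule r3) (use X in simp_all)
qed

text \<open>The multigraph halfway through an update of \<open>e\<close>; here \<open>E\<close>
  contains \<open>e\<close> for insertions and deletions alike.\<close>

definition copy_count :: "nat set set \<Rightarrow> nat set \<Rightarrow> nat \<Rightarrow> nat \<Rightarrow> nat \<Rightarrow> nat \<Rightarrow> nat" where
  "copy_count E e b j x y = (if {x, y} = e then j else if {x, y} \<in> E then b else 0)"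

text \<open>Without loops there are at most \<open>n - 1\<close> neighbours. Strictness leaves room
  in the row for one more arc.\<close>

lemma deg_less:
  assumes "copies b E c" "graph n E" "b > 0" "n > 0"
  shows "deg n c w < n * b"
proof (cases "w < n")
  case True
  have le: "c w v \<le> b" for v
    using assms(1)[unfolded copies_def, rule_format, of w v] by (simp split: if_splits)
  have "c w w = 0" using copies_posD[OF assms(2,1), of w w] by auto
  hence "deg n c w = (\<Sum>v\<in>{..<n} - {w}. c w v)"
    unfolding deg_def using True by (subst sum.remove[of _ w]) auto
  also have "\<dots> \<le> (n - 1) * b" using sum_bounded_above[of "{..<n} - {w}" "c w" b] le True by simp
  also have "\<dots> < n * b" using assms by simp
  finally show ?thesis .
next
  case False
  have "c w v = 0" for v using copies_posD[OF assms(2,1), of w v] False by auto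
  thus ?thesis using assms by (simp add: deg_def)
qed

lemma settled_regs:
  assumes "settled n b c s" "snd s' = snd s" "\<And>x. x \<in> {''n'', ''b'', ''D'', ''Q''} \<Longrightarrow> fst s' x = fst s x"
  shows "settled n b c s'"
  using assms(1) repr_regs[OF _ assms(2,3)] unfolding settled_def by blast

text \<open>Each copy starts from a settled state. Since \<open>E\<close> contains the updated edge,
  all intermediate multiplicities satisfy \<open>copies b E\<close>, and the single bound
  \<open>\<Delta>\<close> holds throughout.\<close>

lemma runs_process:
  assumes S: "settled n b c s" and b: "b > 1" and G: "graph n E" and n: "n > 0"
    and op: "fst s ''op'' = (if ins then 0 else 1)"
    and e: "e = {fst s ''u'', fst s ''v''}" "e \<in> E"
    and c: "\<And>x y. c x y + c y x = copy_count E e b (if ins then 0 else b) x y"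
    and \<Delta>: "\<And>c w. copies b E c \<Longrightarrow> fairc b c (deg n c) \<Longrightarrow> deg n c w \<le> \<Delta>"
  shows "runs process s (11000 * (b * ((chain_length b \<Delta> + 2) * (\<Delta> + 2)))) (\<lambda>s'. \<exists>c'. settled n b c' s' \<and>
    (\<forall>x y. c' x y + c' y x = copy_count E e b (if ins then b else 0) x y))"
proof -
  define X where "X = (chain_length b \<Delta> + 2) * (\<Delta> + 2)"
  have X: "4 \<le> X" unfolding X_def using mult_le_mono[of 2 "chain_length b \<Delta> + 2" 2 "\<Delta> + 2"] by simp
  define u v where "u = fst s ''u''" and "v = fst s ''v''"
  have e': "e = {u, v}" using e by (simp add: u_def v_def)
  have uv: "u < n" "v < n" "u \<noteq> v" using graph_edgeD[OF G, of u v] e e' by auto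
  \<comment> \<open>\<open>k\<close> counts the copies still to be processed, so an insertion has
    placed \<open>b - k\<close> copies and a deletion has left \<open>k\<close>.\<close>
  define I where "I = (\<lambda>k s'. k \<le> b \<and> fst s' ''p'' = b - k \<and> fst s' ''u'' = u \<and> fst s' ''v'' = v \<and>
    fst s' ''op'' = (if ins then 0 else 1) \<and> (\<exists>c'. settled n b c' s' \<and>
      (\<forall>x y. c' x y + c' y x = copy_count E e b (if ins then b - k else k) x y)))"
  have init: "I b (set_reg ''p'' 0 s)"
    unfolding I_def
  proof (intro conjI exI[of _ c])
    show "settled n b c (set_reg ''p'' 0 s)"
      by (rule settled_regs[OF S]) auto
  qed (use c op in \<open>auto simp: u_def v_def\<close>)
  let ?body = "block [Cond (Reg ''op'') delete_copy insert_copy, Assign ''p'' (clamp (Add (Reg ''p'') (Const 1)))]"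
  have loop: "runs (While (Less (Reg ''p'') (Reg ''b'')) ?body) (set_reg ''p'' 0 s)
      ((b + 1) * (1 + cost (Less (Reg ''p'') (Reg ''b'')) + (5000 * X + 20)))
      (\<lambda>s'. \<exists>k'. I k' s' \<and> val (Less (Reg ''p'') (Reg ''b'')) s' = 0)"
  proof (rule runs_While[of I, OF _ init])
    fix k s' assume I: "I k s'" and g: "val (Less (Reg ''p'') (Reg ''b'')) s' \<noteq> 0"
    from I obtain c' where s': "k \<le> b" "fst s' ''p'' = b - k" "fst s' ''u'' = u" "fst s' ''v'' = v"
      "fst s' ''op'' = (if ins then 0 else 1)" and S': "settled n b c' s'"
      and c': "\<And>x y. c' x y + c' y x = copy_count E e b (if ins then b - k else k) x y" by (auto simp: I_def)
    have R: "repr n b c' (deg n c') s'" and F: "fairc b c' (deg n c')" using S' by (auto simp: settled_def)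
    have par: "fst s' ''b'' = b" "fst s' ''Q'' = 4 * n * b" using R by (auto simp: repr_def params_def)
    have k: "0 < k" "b - k < b" using g s'(1,2) par by (auto split: if_splits)
    have cp: "copies b E c'"
      unfolding copies_def c' using e(2) s'(1) by (auto simp: copy_count_def)
    have loop0: "c' w w = 0" for w using copies_posD[OF G cp, of w w] by auto
    have bd: "deg n c' w \<le> \<Delta> \<and> deg n c' w < n * b" for w
      using \<Delta>[OF cp F] deg_less[OF cp G _ n] b by simp
    have uv': "fst s' ''u'' < n" "fst s' ''v'' < n" "fst s' ''u'' \<noteq> fst s' ''v''" using uv s' by auto
    define Q where "Q = (\<lambda>s''. (\<exists>c''. settled n b c'' s'' \<and>
      (\<forall>x y. c'' x y + c'' y x = copy_count E e b (if ins then b - (k - 1) else k - 1) x y)))"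
    have copy: "runs (Cond (Reg ''op'') delete_copy insert_copy) s' (5000 * X + 2) Q"
    proof (rule runs_Cond[of _ _ _ "5000 * X"])
      assume "val (Reg ''op'') s' \<noteq> 0"
      hence ins: "\<not> ins" using s'(5) by auto
      have "c' u v + c' v u = k" using c'[of u v] ins by (simp add: copy_count_def e')
      hence "0 < c' (fst s' ''u'') (fst s' ''v'') + c' (fst s' ''v'') (fst s' ''u'')" using s' k by simp
      note del = runs_delete_copy[OF S' b uv' loop0 bd this]
      have eq: "c' x y + c' y x - (if {x, y} = {fst s' ''u'', fst s' ''v''} then 1 else 0) =
          copy_count E e b (if ins then b - (k - 1) else k - 1) x y" for x y
        using ins by (simp add: c' copy_count_def e' s'(3,4))
      show "runs delete_copy s' (5000 * X) Q"
        unfolding X_def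
        by (rule runs_mono[OF del order_refl]) (unfold eq Q_def, blast)
    next
      assume "val (Reg ''op'') s' = 0"
      hence ins: "ins" using s'(5) by (auto split: if_splits)
      have b0: "b > 0" using b by simp
      note insr = runs_insert_copy[OF S' b0 uv' loop0 bd]
      show "runs insert_copy s' (5000 * X) Q"
        unfolding X_def
      proof (rule runs_mono[OF insr])
        have eq: "c' x y + c' y x + (if {x, y} = {fst s' ''u'', fst s' ''v''} then 1 else 0) =
            copy_count E e b (if ins then b - (k - 1) else k - 1) x y" for x y
          using ins k s'(1) by (simp add: c' copy_count_def e' s'(3,4) Suc_diff_le)
        fix s'' assume "\<exists>c''. settled n b c'' s'' \<and> (\<forall>x y. c'' x y + c'' y x =
          c' x y + c' y x + (if {x, y} = {fst s' ''u'', fst s' ''v''} then 1 else 0))"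
        thus "Q s''" unfolding eq Q_def by blast
      qed simp
    qed simp
    have "runs ?body s' (5000 * X + 20) (I (k - 1))"
    proof (rule runs_Cons[OF runs_mono[OF runs_frame[OF copy] order_refl]])
      fix s'' assume s'': "Q s'' \<and> (\<forall>x. x \<notin> assigned (Cond (Reg ''op'') delete_copy insert_copy) \<longrightarrow> fst s'' x = fst s' x)"
      have Q: "Q s''" and fr: "fst s'' ''p'' = b - k" "fst s'' ''u'' = u" "fst s'' ''v'' = v"
        "fst s'' ''op'' = (if ins then 0 else 1)" "fst s'' ''Q'' = 4 * n * b"
        using s'' s' par by auto
      from Q obtain c'' where c'': "settled n b c'' s''"
        "\<forall>x y. c'' x y + c'' y x = copy_count E e b (if ins then b - (k - 1) else k - 1) x y" by (auto simp: Q_def)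
      have "b \<le> n * b" using n by simp
      hence "Suc (b - k) < 4 * n * b" using k b by linarith
      hence eff: "eff (block [Assign ''p'' (clamp (Add (Reg ''p'') (Const 1)))]) s'' = set_reg ''p'' (b - (k - 1)) s''"
        using fr k s'(1) by (simp add: clamp_def Suc_diff_le)
      have "settled n b c'' (set_reg ''p'' (b - (k - 1)) s'')"
        by (rule settled_regs[OF c''(1)]) auto
      hence "I (k - 1) (set_reg ''p'' (b - (k - 1)) s'')"
        using c''(2) fr s'(1) unfolding I_def by auto
      hence "I (k - 1) (eff (block [Assign ''p'' (clamp (Add (Reg ''p'') (Const 1)))]) s'')" unfolding eff .
      thus "runs (block [Assign ''p'' (clamp (Add (Reg ''p'') (Const 1)))]) s'' 18 (I (k - 1))"
        by (intro runs_straight) (simp_all add: clamp_def)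
    qed simp
    thus "\<exists>k'<k. runs ?body s' (5000 * X + 20) (I k')" using k by (intro exI[of _ "k - 1"]) simp
  qed
  have post: "\<exists>c'. settled n b c' s' \<and> (\<forall>x y. c' x y + c' y x = copy_count E e b (if ins then b else 0) x y)"
    if I: "I k s'" and g: "val (Less (Reg ''p'') (Reg ''b'')) s' = 0" for k s'
  proof -
    from I obtain c' where c': "settled n b c' s'" "\<forall>x y. c' x y + c' y x = copy_count E e b (if ins then b - k else k) x y"
      by (auto simp: I_def)
    have "fst s' ''b'' = b" using c'(1) by (auto simp: settled_def repr_def params_def)
    hence "k = 0" using I g by (auto simp: I_def split: if_splits)
    thus ?thesis using c' by auto
  qed
  have le: "(b + 1) * (1 + cost (Less (Reg ''p'') (Reg ''b'')) + (5000 * X + 20)) \<le> (2 * b) * (5010 * X)"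
    by (intro mult_le_mono) (use X b in auto)
  have bX: "8 \<le> b * X" using mult_le_mono[of 2 b 4 X] b X by simp
  have "runs (block [While (Less (Reg ''p'') (Reg ''b'')) ?body]) (set_reg ''p'' 0 s) ((2 * b) * (5010 * X) + 1) (\<lambda>s'. \<exists>c'. settled n b c' s' \<and>
    (\<forall>x y. c' x y + c' y x = copy_count E e b (if ins then b else 0) x y))"
    by (rule runs_single[OF runs_mono[OF loop le]]) (elim exE conjE, rule post)
  note body = this
  show ?thesis unfolding process_def X_def[symmetric]
    by (rule runs_Cons_straight[where T = "(2 * b) * (5010 * X) + 1"])
      (use body bX bX[unfolded mult.commute[of b]] in \<open>simp_all del: block.simps\<close>)
qed

section \<open>Reading off the orientations\<close>

lemma count_image_Pair: "count (image_mset (Pair w) M) (u, v) = (if w = u then count M v else 0)"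
  by (induction M) auto

lemma count_stored_arcs:
  "count (stored_arcs len adj k n s) (u, v) =
     (if u < n then count (mset (map (\<lambda>i. snd s adj (u * k + i)) [0..<snd s len u])) v else 0)"
proof -
  have "mset (map (\<lambda>i. (w, snd s adj (w * k + i))) [0..<snd s len w]) =
      image_mset (Pair w) (mset (map (\<lambda>i. snd s adj (w * k + i)) [0..<snd s len w]))" for w
    by (simp add: multiset.map_comp comp_def)
  hence "count (stored_arcs len adj k n s) (u, v) =
      (\<Sum>w<n. if w = u then count (mset (map (\<lambda>i. snd s adj (w * k + i)) [0..<snd s len w])) v else 0)"
    unfolding stored_arcs_def count_sum by (simp only: count_image_Pair)
  thus ?thesis by (simp only: sum.delta finite_lessThan lessThan_iff)
qed

lemma outdeg_stored_arcs: "outdeg (stored_arcs len adj k n s) u = (if u < n then snd s len u else 0)"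
proof -
  have "filter_mset P (\<Sum>w\<in>A. f w) = (\<Sum>w\<in>A. filter_mset P (f w))"
    if "finite A" for A :: "nat set" and f :: "nat \<Rightarrow> (nat \<times> nat) multiset" and P
    using that by (induction A) auto
  hence "outdeg (stored_arcs len adj k n s) u =
     size (\<Sum>w<n. {#a \<in># mset (map (\<lambda>i. (w, snd s adj (w * k + i))) [0..<snd s len w]). fst a = u#})"
    unfolding outdeg_def stored_arcs_def by simp
  also have "\<dots> = (\<Sum>w<n. if w = u then snd s len w else 0)"
    unfolding size_multiset_sum by (rule sum.cong) (auto simp: filter_mset_image_mset comp_def)
  finally show ?thesis by simp
qed

text \<open>An edge has exactly two preimages under forgetting directions, distinct because edges
  are not loops; any other pair has multiplicity 0.\<close>

lemma is_orientationI:
  assumes G: "graph n E" and M: "\<And>u v. count M (u, v) + count M (v, u) = (if {u, v} \<in> E then k else 0)"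
  shows "is_orientation M (repeat_mset k (mset_set E))"
  unfolding is_orientation_def
proof (rule multiset_eqI)
  fix e
  let ?f = "\<lambda>(u, v). {u, v :: nat}"
  have "count (image_mset ?f M) e = (\<Sum>a\<in>?f -` {e} \<inter> set_mset M. count M a)"
    by (rule count_image_mset)
  also have "\<dots> = (if e \<in> E then k else 0)"
  proof (cases "e \<in> E")
    case True
    obtain p q where e: "e = {p, q}" "p \<noteq> q" by (rule graph_edgeE[OF G True])
    have "?f -` {e} = {(p, q), (q, p)}"
    proof (rule set_eqI)
      fix a :: "nat \<times> nat"
      obtain x y where "a = (x, y)" by (cases a)
      thus "a \<in> ?f -` {e} \<longleftrightarrow> a \<in> {(p, q), (q, p)}" unfolding e by (simp add: doubleton_eq_iff)
    qed
    hence "(\<Sum>a\<in>?f -` {e} \<inter> set_mset M. count M a) = (\<Sum>a\<in>{(p, q), (q, p)}. count M a)"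
      by (intro sum.mono_neutral_left) (auto simp: count_eq_zero_iff)
    also have "\<dots> = count M (p, q) + count M (q, p)" using e by simp
    finally show ?thesis using M[of p q] True e by simp
  next
    case False
    have "?f -` {e} \<inter> set_mset M = {}"
    proof (intro equals0I)
      fix a assume a: "a \<in> ?f -` {e} \<inter> set_mset M"
      obtain u v where uv: "a = (u, v)" by (cases a)
      have "count M (u, v) = 0" using M[of u v] a uv False by simp
      thus False using a uv by (simp add: count_eq_zero_iff)
    qed
    thus ?thesis using False by simp
  qed
  also have "\<dots> = count (repeat_mset k (mset_set E)) e"
    using graph_finite[OF G] by (simp add: count_mset_set')
  finally show "count (image_mset ?f M) e = count (repeat_mset k (mset_set E)) e" .
qed

definition maintained :: "nat \<Rightarrow> nat \<Rightarrow> nat set set \<Rightarrow> (nat \<Rightarrow> nat \<Rightarrow> nat) \<Rightarrow> state \<Rightarrow> bool" where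
  "maintained n b E c s \<longleftrightarrow> graph n E \<and> settled n b c s \<and> (\<forall>x y. c x y + c y x = (if {x, y} \<in> E then b else 0))"

context
  fixes n b E c s
  assumes maintained: "maintained n b E c s"
begin

lemma maintained_D:
  "graph n E" "repr n b c (deg n c) s" "fairc b c (deg n c)" "c x y + c y x = (if {x, y} \<in> E then b else 0)"
  "copies b E c" "0 < c x y \<Longrightarrow> x < n \<and> y < n"
  using maintained by (auto simp: maintained_def settled_def copies_def repr_def)

lemma count_multi_arcs: "count (multi_arcs n b s) (u, v) = c u v"
proof (cases "u < n")
  case True
  thus ?thesis using maintained_D(2) by (simp add: multi_arcs_def count_stored_arcs repr_def rows_def del: mset_map)
next
  case False
  hence "c u v = 0" using maintained_D(6)[of u v] by auto
  thus ?thesis using False by (simp add: multi_arcs_def count_stored_arcs)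
qed

lemma outdeg_multi_arcs: "u < n \<Longrightarrow> outdeg (multi_arcs n b s) u = deg n c u"
  using repr_deg[OF maintained_D(2)] by (simp add: multi_arcs_def outdeg_stored_arcs)

lemma indexed_simple:
  "indexed n (majority n c u) (snd s ''len'' u) (\<lambda>i. snd s ''adj'' (u * n + i)) (\<lambda>x. snd s ''spos'' (u * n + x))"
  using maintained_D(2) by (simp add: repr_def iset_def)

lemma count_simple_arcs: "count (simple_arcs n s) (u, v) = (if arc c u v then 1 else 0)"
proof (cases "u < n")
  case True
  let ?f = "\<lambda>i. snd s ''adj'' (u * n + i)"
  have bij: "bij_betw ?f {..<snd s ''len'' u} (majority n c u)" by (rule indexed_bij[OF indexed_simple])
  have "mset (map ?f [0..<snd s ''len'' u]) = image_mset ?f (mset_set {0..<snd s ''len'' u})" by simp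
  also have "\<dots> = mset_set (majority n c u)"
    using bij by (subst image_mset_mset_set) (auto simp: bij_betw_def lessThan_atLeast0)
  finally have "count (mset (map ?f [0..<snd s ''len'' u])) v = (if v \<in> majority n c u then 1 else 0)"
    by (simp add: count_mset_set' majority_def)
  moreover have "v \<in> majority n c u \<longleftrightarrow> arc c u v"
    using maintained_D(6)[of u v] by (auto simp: majority_def arc_def)
  ultimately show ?thesis using True by (simp add: simple_arcs_def count_stored_arcs del: mset_map)
next
  case False
  hence "\<not> arc c u v" using maintained_D(6)[of u v] by (auto simp: arc_def)
  thus ?thesis using False by (simp add: simple_arcs_def count_stored_arcs)
qed

lemma orientation_multi: "is_orientation (multi_arcs n b s) (duplicate b E)"
  unfolding duplicate_def
  by (rule is_orientationI[OF maintained_D(1)]) (simp add: count_multi_arcs maintained_D(4))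

lemma orientation_simple:
  assumes "b > 0" shows "is_orientation (simple_arcs n s) (mset_set E)"
proof -
  have "count (simple_arcs n s) (u, v) + count (simple_arcs n s) (v, u) = (if {u, v} \<in> E then 1 else 0)" for u v
  proof (cases "{u, v} \<in> E")
    case True
    have "u \<noteq> v" using graph_edgeD[OF maintained_D(1) True] by simp
    moreover have "0 < c u v + c v u" using maintained_D(4)[of u v] True assms by simp
    ultimately have "arc c u v \<longleftrightarrow> \<not> arc c v u" unfolding arc_def by linarith
    thus ?thesis using True by (simp add: count_simple_arcs)
  next
    case False
    hence "c u v = 0" "c v u = 0" using maintained_D(4)[of u v] by simp_all
    thus ?thesis using False by (simp add: count_simple_arcs arc_def)
  qed
  from is_orientationI[OF maintained_D(1) this] show ?thesis by simp
qed

lemma majority_simple: "follows_majority (simple_arcs n s) (multi_arcs n b s)"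
  unfolding follows_majority_def
proof (intro allI impI)
  fix u v assume "count (multi_arcs n b s) (v, u) < count (multi_arcs n b s) (u, v)"
  hence "arc c u v" by (simp add: count_multi_arcs arc_def)
  hence "count (simple_arcs n s) (u, v) = 1" by (simp add: count_simple_arcs)
  thus "(u, v) \<in># simple_arcs n s" by (metis count_eq_zero_iff zero_neq_one)
qed

lemma fair_multi:
  assumes "b > 0" "\<eta> > 2" "even b \<or> 2 * real b \<le> \<eta> * (real b - 1)"
  shows "fair \<eta> b (multi_arcs n b s)"
  unfolding fair_def
proof clarify
  fix u v assume "(u, v) \<in># multi_arcs n b s"
  hence pos: "0 < c u v" by (simp flip: count_greater_zero_iff add: count_multi_arcs)
  hence uv: "u < n" "v < n" using maintained_D(6) by blast+
  have "c u v + c v u = b" using maintained_D(4)[of u v] pos by (auto split: if_splits)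
  from fairc_imp_fair[OF maintained_D(3) uv pos this assms]
  show "real (outdeg (multi_arcs n b s) u) \<le> (1 + \<eta> / real b) * real (outdeg (multi_arcs n b s) v)"
    using uv by (simp add: outdeg_multi_arcs)
qed

text \<open>An arc in the majority direction accounts for at least half of the \<open>b\<close>
  copies of its edge.\<close>

lemma outdeg_simple_le:
  assumes "u < n"
  shows "b * outdeg (simple_arcs n s) u \<le> 2 * deg n c u"
proof -
  have "outdeg (simple_arcs n s) u = card (majority n c u)"
    using assms indexed_card[OF indexed_simple] by (simp add: simple_arcs_def outdeg_stored_arcs)
  hence "b * outdeg (simple_arcs n s) u = (\<Sum>v\<in>majority n c u. b)" by simp
  also have "\<dots> \<le> (\<Sum>v\<in>majority n c u. 2 * c u v)"
  proof (rule sum_mono)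
    fix v assume "v \<in> majority n c u"
    hence a: "arc c u v" by (simp add: majority_def)
    hence "c u v + c v u = b" using maintained_D(4)[of u v] by (auto simp: arc_def split: if_splits)
    thus "b \<le> 2 * c u v" using a by (auto simp: arc_def)
  qed
  also have "\<dots> \<le> (\<Sum>v<n. 2 * c u v)" by (rule sum_mono2) (auto simp: majority_def)
  finally show ?thesis by (simp add: deg_def sum_distrib_left)
qed

end

section \<open>The invariant across updates and the final bounds\<close>

definition invariant :: "nat \<Rightarrow> nat \<Rightarrow> nat set set \<Rightarrow> state \<Rightarrow> bool" where
  "invariant n b E s \<longleftrightarrow> bounded (n + b) s \<and> (\<exists>c. maintained n b E c s)"

text \<open>Zero-filled memory already represents the edgeless graph, so only two parameters are
  computed, in constant time.\<close>

lemma exec_prepare: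
  assumes "n \<ge> 2" "b \<ge> 2"
  shows "\<exists>t s. exec ((n + b) ^ 12) prepare (start n b) t s \<and> t \<le> 20 \<and> invariant n b {} s"
proof -
  have N: "n + b \<ge> 4" using assms by simp
  define s where "s = eff prepare (start n b)"
  have "straight prepare" "time prepare \<le> 20" by (simp_all add: prepare_def)
  then obtain t where t: "t \<le> 20" "steps prepare (start n b) t s"
    using steps_straight[of prepare "start n b"] unfolding s_def by (meson order_trans)
  have "bounded (n + b) (start n b)"
    by (auto simp: bounded_def start_def reg_deg_def)
  from steps_exec[OF t(2) _ this N]
  have ex: "exec ((n + b) ^ 12) prepare (start n b) t s" "bounded (n + b) s" by simp_all
  have s: "fst s ''n'' = n" "fst s ''b'' = b" "fst s ''D'' = n * b" "fst s ''Q'' = 4 * n * b" "snd s = (\<lambda>_ _. 0)"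
    by (simp_all add: s_def prepare_def start_def)
  have "maintained n b {} (\<lambda>_ _. 0) s"
    by (auto simp: maintained_def settled_def graph_def repr_def params_def s rows_def iset_def indexed_def
        bucket_def majority_def arc_def fairc_def deg_def)
  thus ?thesis using ex t(1) unfolding invariant_def by blast
qed

lemma maintained_deg_le:
  assumes "maintained n b E c s" "n \<ge> 2" "real b > 200 * ln (real n)"
  shows "real (deg n c u) \<le> 6 * real b * max_density n E"
  using fairc_deg_le[OF maintained_D(1,5,3)[OF assms(1)] assms(2,3)] .

text \<open>The density is that of the graph with the updated edge, which contains the graphs before
  and after the update. Having an edge, it has density at least 1/2.\<close>

lemma exec_process:
  assumes I: "invariant n b E s" and x: "valid n E x" and n: "n \<ge> 2" and b: "real b > 200 * ln (real n)" "b > 100"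
  defines "\<rho> \<equiv> max_density n (E \<union> {edge x})"
  shows "\<exists>t s'. exec ((n + b) ^ 12) process (load x s) t s' \<and> invariant n b (apply_update x E) s' \<and>
    real t \<le> 3000000 * (\<rho> * real b ^ 3 * max 1 (ln \<rho>))"
proof -
  obtain c where M: "maintained n b E c s" using I by (auto simp: invariant_def)
  note D = maintained_D[OF M]
  obtain ins u v where x_def: "x = (if ins then Insert u v else Delete u v)" 
    by (cases x) (metis (full_types))+
  have uv: "u < n" "v < n" "u \<noteq> v" "{u, v} \<in> E \<longleftrightarrow> \<not> ins" using x by (auto simp: x_def split: if_splits)
  define E' where "E' = E \<union> {{u, v}}"
  have E': "E \<union> {edge x} = E'" by (simp add: E'_def x_def)
  have G: "graph n E'" using D(1) uv by (auto simp: graph_def E'_def)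
  have \<rho>: "\<rho> \<ge> 1 / 2" unfolding \<rho>_def E' by (rule max_density_ge_half[OF G, of "{u, v}"]) (simp add: E'_def)
  define \<Delta> where "\<Delta> = nat \<lfloor>6 * real b * \<rho>\<rfloor>"
  have \<Delta>: "real \<Delta> \<le> 6 * real b * \<rho>" using \<rho> by (simp add: \<Delta>_def)
  let ?s = "load x s"
  have ld: "snd ?s = snd s" "fst ?s ''u'' = u" "fst ?s ''v'' = v" "fst ?s ''op'' = (if ins then 0 else 1)"
    and ld': "\<And>z. z \<noteq> ''u'' \<Longrightarrow> z \<noteq> ''v'' \<Longrightarrow> z \<noteq> ''op'' \<Longrightarrow> fst ?s z = fst s z"
    by (simp_all add: x_def)
  have "settled n b c s" using M by (simp only: maintained_def)
  hence S: "settled n b c ?s" by (rule settled_regs) (auto simp: ld(1) ld')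
  have c0: "c y z + c z y = copy_count E' {u, v} b (if ins then 0 else b) y z" for y z
    unfolding D(4) copy_count_def E'_def using uv(4) by (cases "{y, z} = {u, v}") simp_all
  have bound: "deg n c w \<le> \<Delta>" if "copies b E' c" "fairc b c (deg n c)" for c w
  proof -
    have "real (deg n c w) \<le> 6 * real b * \<rho>"
      unfolding \<rho>_def E' by (rule fairc_deg_le[OF G that n b(1)])
    thus ?thesis by (simp add: \<Delta>_def le_nat_floor)
  qed
  have r: "runs process ?s (11000 * (b * ((chain_length b \<Delta> + 2) * (\<Delta> + 2)))) (\<lambda>s'. \<exists>c'. settled n b c' s' \<and>
    (\<forall>y z. c' y z + c' z y = copy_count E' {u, v} b (if ins then b else 0) y z))"
    by (rule runs_process[OF S _ G _ ld(4) _ _ c0 bound]) (use b n ld in \<open>auto simp: E'_def\<close>)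
  then obtain t s' c' where t: "steps process ?s t s'" "t \<le> 11000 * (b * ((chain_length b \<Delta> + 2) * (\<Delta> + 2)))"
    and c': "settled n b c' s'" "\<And>y z. c' y z + c' z y = copy_count E' {u, v} b (if ins then b else 0) y z"
    unfolding runs_def by blast
  have N: "n + b \<ge> 4" using n b by simp
  have B: "bounded (n + b) ?s"
  proof -
    have "n + b \<le> (n + b) ^ 3" by (rule self_le_power) (use N in auto)
    hence "u \<le> (n + b) ^ 3" "v \<le> (n + b) ^ 3" "1 \<le> (n + b) ^ 3" using uv N by linarith+
    thus ?thesis using I ld by (auto simp: bounded_def invariant_def reg_deg_def x_def)
  qed
  have ex: "exec ((n + b) ^ 12) process ?s t s' \<and> bounded (n + b) s'"
    by (rule steps_exec[OF t(1) _ B N]) simp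
  have upd: "{y, z} \<in> apply_update x E \<longleftrightarrow> (if {y, z} = {u, v} then ins else {y, z} \<in> E)" for y z
    by (auto simp: x_def)
  have "maintained n b (apply_update x E) c' s'"
    unfolding maintained_def
  proof (intro conjI allI)
    show "graph n (apply_update x E)" using G by (auto simp: graph_def E'_def x_def)
    show "settled n b c' s'" by (rule c'(1))
    show "c' y z + c' z y = (if {y, z} \<in> apply_update x E then b else 0)" for y z
      unfolding c'(2) upd copy_count_def E'_def by (cases "{y, z} = {u, v}") simp_all
  qed
  hence inv: "invariant n b (apply_update x E) s'" using ex by (auto simp: invariant_def)
  define L where "L = max 1 (ln \<rho>)"
  have L: "L \<ge> 1" by (simp add: L_def)
  have b\<rho>: "real b * \<rho> \<ge> 50"
  proof -
    have "50 \<le> real b * (1 / 2)" using b(2) by simp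
    also have "\<dots> \<le> real b * \<rho>" by (rule mult_left_mono) (use \<rho> in auto)
    finally show ?thesis .
  qed
  have bL: "real b * L \<ge> 1" using mult_mono[of 1 "real b" 1 L] L b by simp
  have "real (chain_length b \<Delta>) \<le> 24 * real b * L" unfolding L_def by (rule chain_length_le[OF \<Delta> \<rho>]) (use b in simp)
  hence h: "real (chain_length b \<Delta> + 2) \<le> 26 * (real b * L)" using bL by simp
  have d: "real (\<Delta> + 2) \<le> 7 * (real b * \<rho>)" using \<Delta> b\<rho> by simp
  have "real t \<le> real (11000 * (b * ((chain_length b \<Delta> + 2) * (\<Delta> + 2))))" using t(2) by (rule of_nat_mono)
  also have "\<dots> = 11000 * (real b * (real (chain_length b \<Delta> + 2) * real (\<Delta> + 2)))" by (simp only: of_nat_mult of_nat_numeral)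
  also have "\<dots> \<le> 11000 * (real b * ((26 * (real b * L)) * (7 * (real b * \<rho>))))"
    by (intro mult_left_mono mult_mono h d) (use L in auto)
  \<comment> \<open>\<open>2002000 = 11000 * 26 * 7\<close>. The three factors \<open>b\<close> stem
    from the number of copies, the length of a chain and the cost of a flip.\<close>
  also have "\<dots> = 2002000 * (\<rho> * real b ^ 3 * L)" by (simp add: power3_eq_cube)
  also have "\<dots> \<le> 3000000 * (\<rho> * real b ^ 3 * L)"
    by (rule mult_right_mono) (use L \<rho> in auto)
  finally have "real t \<le> 3000000 * (\<rho> * real b ^ 3 * L)" .
  thus ?thesis using ex inv unfolding L_def by blast
qed

text \<open>\<open>reaches\<close> speaks of arbitrary runs, while the preceding lemmas construct
  particular ones; determinism of \<open>exec\<close> identifies them.\<close>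

lemma reaches_invariant:
  assumes "reaches ((n + b) ^ 12) prepare process n b E s"
    and n: "n \<ge> 2" and b: "real b > 200 * ln (real n)" "b > 100"
  shows "invariant n b E s"
  using assms(1)
proof (induction rule: reaches.induct)
  case (init t s)
  obtain t' s' where "exec ((n + b) ^ 12) prepare (start n b) t' s'" "invariant n b {} s'"
    using exec_prepare[of n b] n b by auto
  with exec_deterministic[OF init] show ?case by blast
next
  case (step E s x t s')
  obtain t' s'' where "exec ((n + b) ^ 12) process (load x s) t' s''" "invariant n b (apply_update x E) s''"
    using exec_process[OF step.IH step.hyps(2) n b] by blast
  with exec_deterministic[OF step.hyps(3)] show ?case by blast
qed

lemma params_large:
  assumes "\<eta> > 2" "b > 0" "\<eta> * inverse (real b) < 1 / (100 * ln (real n) * max (inverse \<gamma>) 1)"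
  shows "n \<ge> 2" "real b > 200 * ln (real n)" "b > 100"
proof -
  define m where "m = max (inverse \<gamma>) 1"
  have m: "m \<ge> 1" by (simp add: m_def)
  have pos: "0 < \<eta> * inverse (real b)" using assms by simp
  show n: "n \<ge> 2"
  proof (rule ccontr)
    assume "\<not> n \<ge> 2"
    hence "n = 0 \<or> n = 1" by auto
    \<comment> \<open>By the conventions \<open>ln 0 = 0\<close> and division by zero, the
      right-hand side of the hypothesis is 0 for \<open>n \<le> 1\<close>, yet the left-hand side is
      positive.\<close>
    hence "ln (real n) = 0" by auto
    thus False using assms(3) pos by simp
  qed
  have "ln (real n) \<ge> ln 2" using n by simp
  moreover have "ln (2 :: real) \<ge> 1 / 2" using exp_half_le2 by (subst ln_ge_iff) auto
  ultimately have ln: "ln (real n) \<ge> 1 / 2" by linarith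
  have K: "100 * ln (real n) * m > 0" using ln m by simp
  have "\<eta> * inverse (real b) * (100 * ln (real n) * m) < 1"
    using assms(3) K by (simp add: pos_less_divide_eq m_def)
  hence lt: "\<eta> * (100 * ln (real n) * m) < real b" using assms(2) by (simp add: field_simps)
  have "2 * (100 * ln (real n) * 1) \<le> \<eta> * (100 * ln (real n) * m)"
    by (intro mult_mono) (use assms(1) ln m in auto)
  thus big: "real b > 200 * ln (real n)" using lt by linarith
  thus "b > 100" using ln by linarith
qed

theorem theorem3:
  fixes \<gamma> :: real
  assumes "\<gamma> > 0"
  shows "\<exists>(C :: real) (C' :: real \<Rightarrow> real) (w :: nat). \<forall>\<eta> :: real. \<eta> > 2 \<longrightarrow>
    (\<exists>ini upd. \<forall>n b :: nat.
      b > 0 \<longrightarrow>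
      \<eta> * inverse (real b) < 1 / (100 * ln (real n) * max (inverse \<gamma>) 1) \<longrightarrow>
      even b \<or> 2 * real b \<le> \<eta> * (real b - 1) \<longrightarrow>
      (let W = (n + b) ^ w in
        (\<exists>t s. exec W ini (start n b) t s \<and> real t \<le> C * real n) \<and>
        (\<forall>E s. reaches W ini upd n b E s \<longrightarrow>
          is_orientation (multi_arcs n b s) (duplicate b E) \<and>
          is_orientation (simple_arcs n s) (mset_set E) \<and>
          follows_majority (simple_arcs n s) (multi_arcs n b s) \<and>
          fair \<eta> b (multi_arcs n b s) \<and>
          (\<forall>u<n. real (outdeg (multi_arcs n b s) u) \<le> C * (real b * max_density n E)) \<and>
          (\<forall>u<n. real (outdeg (simple_arcs n s) u) \<le> C * max_density n E) \<and>
          (\<forall>x. valid n E x \<longrightarrow>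
            (let \<rho> = max_density n (E \<union> {edge x}) in
              \<exists>t s'. exec W upd (load x s) t s' \<and>
                real t \<le> C * (\<rho> * real b ^ 3 * max 1 (ln \<rho>)) \<and>
                (\<forall>K. real b \<le> K * ln (real n) \<longrightarrow>
                  real t \<le> C' K * (\<rho> * ln (real n) ^ 3 * max 1 (ln \<rho>))))))))"
proof -
  \<comment> \<open>The time bound of an update dictates this value; the degree bounds need only 6
    and 12.\<close>
  define C :: real where "C = 3000000"
  \<comment> \<open>Substituting \<open>b \<le> K * ln n\<close> into the cube of \<open>b\<close>
    produces \<open>K ^ 3\<close>.\<close>
  define C' :: "real \<Rightarrow> real" where "C' = (\<lambda>K. C * K ^ 3)"
  have C: "C \<ge> 12" by (simp add: C_def)
  show ?thesis
  proof (rule exI[of _ C], rule exI[of _ C'], rule exI[of _ 12], intro allI impI,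
      rule exI[of _ prepare], rule exI[of _ process], intro allI impI, unfold Let_def, intro conjI allI impI)
    fix \<eta> :: real and n b :: nat
    assume \<eta>: "\<eta> > 2" and b: "b > 0" and eb: "\<eta> * inverse (real b) < 1 / (100 * ln (real n) * max (inverse \<gamma>) 1)"
      and odd: "even b \<or> 2 * real b \<le> \<eta> * (real b - 1)"
    note big = params_large[OF \<eta> b eb]
    let ?W = "(n + b) ^ 12"
    show "\<exists>t s. exec ?W prepare (start n b) t s \<and> real t \<le> C * real n"
    proof -
      obtain t s where "exec ?W prepare (start n b) t s" "t \<le> 20"
        using exec_prepare[of n b] big by auto
      moreover have "C * 2 \<le> C * real n" using big(1) by (simp add: C_def)
      ultimately show ?thesis by (intro exI[of _ t] exI[of _ s]) (simp add: C_def)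
    qed
    fix E s assume "reaches ?W prepare process n b E s"
    from reaches_invariant[OF this big] have I: "invariant n b E s" .
    then obtain c where M: "maintained n b E c s" by (auto simp: invariant_def)
    have \<rho>: "max_density n E \<ge> 0" using max_density_nonneg[of n E] big(1) by simp
    have deg: "real (deg n c u) \<le> 6 * real b * max_density n E" for u by (rule maintained_deg_le[OF M big(1,2)])
    show "is_orientation (multi_arcs n b s) (duplicate b E)" by (rule orientation_multi[OF M])
    show "is_orientation (simple_arcs n s) (mset_set E)" by (rule orientation_simple[OF M b])
    show "follows_majority (simple_arcs n s) (multi_arcs n b s)" by (rule majority_simple[OF M])
    show "fair \<eta> b (multi_arcs n b s)" by (rule fair_multi[OF M b \<eta> odd])
    show "real (outdeg (multi_arcs n b s) u) \<le> C * (real b * max_density n E)" if "u < n" for u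
    proof -
      have "6 * (real b * max_density n E) \<le> C * (real b * max_density n E)"
        by (rule mult_right_mono) (use C \<rho> in auto)
      thus ?thesis using deg[of u] outdeg_multi_arcs[OF M that] by simp
    qed
    show "real (outdeg (simple_arcs n s) u) \<le> C * max_density n E" if "u < n" for u
    proof -
      have "real (b * outdeg (simple_arcs n s) u) \<le> real (2 * deg n c u)"
        using outdeg_simple_le[OF M that] by (rule of_nat_mono)
      hence "real b * real (outdeg (simple_arcs n s) u) \<le> real b * (12 * max_density n E)"
        using deg[of u] by simp
      hence "real (outdeg (simple_arcs n s) u) \<le> 12 * max_density n E"
        using b by (simp add: mult_le_cancel_left_pos)
      also have "\<dots> \<le> C * max_density n E" by (rule mult_right_mono[OF C \<rho>])
      finally show ?thesis .
    qed
    fix x assume x: "valid n E x"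
    define \<rho> where "\<rho> = max_density n (E \<union> {edge x})"
    have \<rho>0: "\<rho> \<ge> 0" unfolding \<rho>_def using big(1) by (intro max_density_nonneg) simp
    obtain t s' where t: "exec ?W process (load x s) t s'" "real t \<le> C * (\<rho> * real b ^ 3 * max 1 (ln \<rho>))"
      using exec_process[OF I x big] unfolding \<rho>_def C_def by blast
    have "real t \<le> C' K * (\<rho> * ln (real n) ^ 3 * max 1 (ln \<rho>))" if K: "real b \<le> K * ln (real n)" for K
    proof -
      have "real b ^ 3 \<le> (K * ln (real n)) ^ 3" by (rule power_mono[OF K]) simp
      hence "C * (\<rho> * real b ^ 3 * max 1 (ln \<rho>)) \<le> C * (\<rho> * (K * ln (real n)) ^ 3 * max 1 (ln \<rho>))"
        by (intro mult_left_mono mult_right_mono) (use \<rho>0 C in auto)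
      also have "\<dots> = C' K * (\<rho> * ln (real n) ^ 3 * max 1 (ln \<rho>))"
        by (simp add: C'_def power_mult_distrib)
      finally show ?thesis using t(2) by linarith
    qed
    thus "\<exists>t s'. exec ?W process (load x s) t s' \<and>
        real t \<le> C * (max_density n (E \<union> {edge x}) * real b ^ 3 * max 1 (ln (max_density n (E \<union> {edge x})))) \<and>
        (\<forall>K. real b \<le> K * ln (real n) \<longrightarrow> real t \<le> C' K *
          (max_density n (E \<union> {edge x}) * ln (real n) ^ 3 * max 1 (ln (max_density n (E \<union> {edge x})))))"
      using t unfolding \<rho>_def by blast
  qed
qed

end
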